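(* Let $[a,b]\subset\mathbb{R}$ be a compact interval, $a<b$. Assume that a function $F$ is not rational and is (i) either a Nevanlinna-Pick function $F(z)=A+Bz+\int\frac{1+zs}{s-z}\,d\mu(s)$ ($A\in\mathbb{R}$, $B\ge 0$, $\mu$ a finite Borel measure on $\mathbb{R}$) with $\operatorname{supp}\mu\cap[a,b]=\emptyset$; (ii) or a P\'olya frequency series satisfying $[a,b]\subset(r_{\mathrm z},r_{\mathrm p})$, where $r_{\mathrm z}$ and $r_{\mathrm p}$ denote, respectively, the largest zero and the smallest pole of $F$ ($r_{\mathrm z}=-\infty$ if $F$ has no zeros and $r_{\mathrm p}=\infty$ if $F$ has no poles). Let $n\ge1$, let $\nu_n$ be a finite Borel measure with $\operatorname{supp}\nu_n\subseteq[a,b]$ and $\#\operatorname{supp}\nu_n\ge n$, and let $T_n=\{a\le t_1<t_2<\cdots<t_n\le b\}$. Then the AAA approximant $R_n$ of $F$ corresponding to the pair $(\nu_n,T_n)$, with normalized barycentric weights $b_1,\dots,b_n$, is uniquely determined. Moreover, set $$P_n(z):=\sum_{k=1}^n b_kL_k(z),\qquad Q_n(z):=\sum_{k=1}^n b_kF(t_k)L_k(z),\qquad L_k(z):=\prod_{i\ne k}(z-t_i),$$ so that $R_n=Q_n/P_n$. Then there exist points $a<t_1'<\cdots<t_{n-1}'<b$ such that $$\frac{P_nF-Q_n}{V_n}\in\mathcal{H}[a,b],\qquad V_n(z):=\prod_{k=1}^n(z-t_k)\prod_{k=1}^{n-1}(z-t_k').$$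
   Context: Nevanlinna-Pick function: an analytic function on the upper half-plane mapping it into itself; such functions are characterized by the representation $F(z)=A+Bz+\int\frac{1+zs}{s-z}d\mu(s)$ with $A$ real, $B\ge0$, $\mu$ a finite Borel measure on $\mathbb{R}$. If $\operatorname{supp}\mu\cap[a,b]=\emptyset$, this formula defines $F$ as a function that is real on $[a,b]$ and analytic in a neighborhood of $[a,b]$. P\'olya frequency series: a function of the form $$F(z)=cz^\lambda e^{\gamma z}\prod_{i=1}^\infty\frac{1+\alpha_iz}{1-\beta_iz},\qquad c,\gamma,\alpha_i,\beta_i\ge0,\ \lambda\in\{0,1,2,\dots\},\ \sum_i(\alpha_i+\beta_i)<\infty;$$ equivalently (Schoenberg, Edrei), $F(z)=\sum_{n\ge0}a_nz^n$ where every minor of the Toeplitz matrix $(a_{i-j})_{i,j=0}^\infty$ ($a_n=0$ for $n<0$) is non-negative. $\mathcal{H}[a,b]$ denotes the set of functions on $[a,b]$ that extend to an analytic function in some domain containing $[a,b]$. Loewner kernel: for a smooth real-valued $f$ on $[a,b]$, $K_f(x,y):=\frac{f(x)-f(y)}{x-y}$, with $K_f(x,x)=f'(x)$. AAA approximant of $f$ corresponding to $(\nu_n,T_n)$: the rational function $$R_n(x)=\Big(\sum_{k=1}^n\frac{b_kf(t_k)}{x-t_k}\Big)\Big/\Big(\sum_{k=1}^n\frac{b_k}{x-t_k}\Big),$$ where the real barycentric weights $b_k$ satisfy $b_1^2+\cdots+b_n^2=1$, the non-zero $b_k$ with the smallest index is positive, and $$\int\Big(\sum_{k=1}^nb_kK_f(x,t_k)\Big)^2d\nu_n(x)=\min_{c_1^2+\cdots+c_n^2=1}\int\Big(\sum_{k=1}^nc_kK_f(x,t_k)\Big)^2d\nu_n(x).$$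 *)

theory Defs
  imports "HOL-Probability.Probability" "HOL-Complex_Analysis.Complex_Analysis"
begin

definition measure_support :: "real measure \<Rightarrow> real set" where
  "measure_support M = {x. \<forall>U. open U \<longrightarrow> x \<in> U \<longrightarrow> emeasure M U > 0}"

(* Functions with a restricted domain are modelled by a total function F together with its
   domain of definition D (an open set); the values of F outside D are irrelevant. *)

definition rational_on :: "complex set \<Rightarrow> (complex \<Rightarrow> complex) \<Rightarrow> bool" where
  "rational_on D F \<longleftrightarrow>
     (\<exists>p q :: complex poly. q \<noteq> 0 \<and> (\<forall>z\<in>D. poly q z \<noteq> 0 \<longrightarrow> F z = poly p z / poly q z))"

definition nevanlinna_pick :: "(complex \<Rightarrow> complex) \<Rightarrow> bool" where
  "nevanlinna_pick F \<longleftrightarrow>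
     F holomorphic_on {z. Im z > 0} \<and> F ` {z. Im z > 0} \<subseteq> {z. Im z > 0}"

definition nevanlinna_pick_representation ::
  "real \<Rightarrow> real \<Rightarrow> real measure \<Rightarrow> complex set \<Rightarrow> (complex \<Rightarrow> complex) \<Rightarrow> bool" where
  "nevanlinna_pick_representation A B M D F \<longleftrightarrow>
     B \<ge> 0 \<and> finite_borel_measure M \<and> D = - complex_of_real ` measure_support M \<and>
     (\<forall>z\<in>D. F z = of_real A + of_real B * z
              + (\<integral>s. (1 + z * of_real s) / (of_real s - z) \<partial>M))"

(* The product is indexed from 0. The domain D consists of the points where no denominator
   vanishes. *)
definition polya_frequency_series :: "complex set \<Rightarrow> (complex \<Rightarrow> complex) \<Rightarrow> bool" where
  "polya_frequency_series D F \<longleftrightarrow>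
     (\<exists>(c::real) (\<gamma>::real) (\<alpha>::nat \<Rightarrow> real) (\<beta>::nat \<Rightarrow> real) (l::nat).
        c \<ge> 0 \<and> \<gamma> \<ge> 0 \<and> (\<forall>i. \<alpha> i \<ge> 0) \<and> (\<forall>i. \<beta> i \<ge> 0) \<and> summable (\<lambda>i. \<alpha> i + \<beta> i) \<and>
        D = {z. \<forall>i. of_real (\<beta> i) * z \<noteq> 1} \<and>
        (\<forall>z\<in>D. F z = of_real c * z ^ l * exp (of_real \<gamma> * z)
                 * (\<Prod>i. (1 + of_real (\<alpha> i) * z) / (1 - of_real (\<beta> i) * z))))"

(* Sup {} and Inf {} in ereal are -\<infinity> and \<infinity>, the conventions for functions without
   zeros or without poles. *)
definition largest_zero :: "complex set \<Rightarrow> (complex \<Rightarrow> complex) \<Rightarrow> ereal" where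
  "largest_zero D F = Sup (ereal ` {x. complex_of_real x \<in> D \<and> F (of_real x) = 0})"

definition smallest_pole :: "(complex \<Rightarrow> complex) \<Rightarrow> ereal" where
  "smallest_pole F = Inf (ereal ` {x. is_pole F (of_real x)})"

definition analytic_class :: "real \<Rightarrow> real \<Rightarrow> (real \<Rightarrow> complex) set" where
  "analytic_class a b =
     {h. \<exists>D g. open D \<and> connected D \<and> complex_of_real ` {a..b} \<subseteq> D \<and> g holomorphic_on D \<and>
               (\<forall>x\<in>{a..b}. h x = g (of_real x))}"

definition loewner_kernel :: "(real \<Rightarrow> real) \<Rightarrow> real \<Rightarrow> real \<Rightarrow> real" where
  "loewner_kernel f x y = (if x = y then deriv f x else (f x - f y) / (x - y))"

(* The integral is taken over {a..b}, which contains the support of \<nu>: off {a..b} the function f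
   is arbitrary, so that the integrand need not be measurable there. *)
definition aaa_objective ::
  "real \<Rightarrow> real \<Rightarrow> (real \<Rightarrow> real) \<Rightarrow> nat \<Rightarrow> real measure \<Rightarrow> (nat \<Rightarrow> real) \<Rightarrow> (nat \<Rightarrow> real) \<Rightarrow> real" where
  "aaa_objective a b f n \<nu> t c =
     (LINT x:{a..b}|\<nu>. (\<Sum>k=1..n. c k * loewner_kernel f x (t k))\<^sup>2)"

(* Weight vectors are functions on {1..n}, extended by undefined, so that uniqueness of weights
   can be expressed by equality of functions. *)
definition aaa_weights ::
  "real \<Rightarrow> real \<Rightarrow> (real \<Rightarrow> real) \<Rightarrow> nat \<Rightarrow> real measure \<Rightarrow> (nat \<Rightarrow> real) \<Rightarrow> (nat \<Rightarrow> real) \<Rightarrow> bool" where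
  "aaa_weights a b f n \<nu> t w \<longleftrightarrow>
     w \<in> extensional {1..n} \<and>
     (\<Sum>k=1..n. (w k)\<^sup>2) = 1 \<and>
     (\<forall>k\<in>{1..n}. w k \<noteq> 0 \<and> (\<forall>j\<in>{1..<k}. w j = 0) \<longrightarrow> w k > 0) \<and>
     (\<forall>c. (\<Sum>k=1..n. (c k)\<^sup>2) = 1 \<longrightarrow> aaa_objective a b f n \<nu> t w \<le> aaa_objective a b f n \<nu> t c)"

definition barycentric ::
  "(real \<Rightarrow> real) \<Rightarrow> nat \<Rightarrow> (nat \<Rightarrow> real) \<Rightarrow> (nat \<Rightarrow> real) \<Rightarrow> complex \<Rightarrow> complex" where
  "barycentric f n t w z =
     (\<Sum>k=1..n. of_real (w k * f (t k)) / (z - of_real (t k)))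
       / (\<Sum>k=1..n. of_real (w k) / (z - of_real (t k)))"

definition aaa_approximant ::
  "real \<Rightarrow> real \<Rightarrow> (real \<Rightarrow> real) \<Rightarrow> nat \<Rightarrow> real measure \<Rightarrow> (nat \<Rightarrow> real) \<Rightarrow>
   (complex \<Rightarrow> complex) \<Rightarrow> (nat \<Rightarrow> real) \<Rightarrow> bool" where
  "aaa_approximant a b f n \<nu> t R w \<longleftrightarrow> aaa_weights a b f n \<nu> t w \<and> R = barycentric f n t w"

definition node_poly :: "nat \<Rightarrow> (nat \<Rightarrow> real) \<Rightarrow> nat \<Rightarrow> complex \<Rightarrow> complex" where
  "node_poly n t k z = (\<Prod>i\<in>{1..n} - {k}. z - of_real (t i))"

definition aaa_P :: "nat \<Rightarrow> (nat \<Rightarrow> real) \<Rightarrow> (nat \<Rightarrow> real) \<Rightarrow> complex \<Rightarrow> complex" where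
  "aaa_P n t w z = (\<Sum>k=1..n. of_real (w k) * node_poly n t k z)"

definition aaa_Q ::
  "(complex \<Rightarrow> complex) \<Rightarrow> nat \<Rightarrow> (nat \<Rightarrow> real) \<Rightarrow> (nat \<Rightarrow> real) \<Rightarrow> complex \<Rightarrow> complex" where
  "aaa_Q F n t w z = (\<Sum>k=1..n. of_real (w k) * F (of_real (t k)) * node_poly n t k z)"

definition aaa_V :: "nat \<Rightarrow> (nat \<Rightarrow> real) \<Rightarrow> (nat \<Rightarrow> real) \<Rightarrow> complex \<Rightarrow> complex" where
  "aaa_V n t t' z = (\<Prod>k=1..n. z - of_real (t k)) * (\<Prod>k=1..n - 1. z - of_real (t' k))"

end

theory Submission
  imports Defs
begin

text \<open>
  The Loewner kernel \<open>K\<close> of \<open>F\<close> is a Chebyshev system on \<open>[a, b]\<close>: a combination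
  \<open>\<Sum>y\<in>Y. c y * K x y\<close> that vanishes at \<open>card Y\<close> points is trivial.

  For a Nevanlinna-Pick function, choose \<open>d\<close> on the set \<open>X\<close> of zeros such that \<open>\<Sum> d x / (s - x)\<close> and
  \<open>\<Sum> c y / (s - y)\<close> have the same numerator \<open>p\<close>; pairing with \<open>d\<close> gives a vanishing integral of a
  positive multiple of \<open>p\<^sup>2\<close>, so that \<open>\<mu>\<close> has finite support or \<open>p = 0\<close>. For a Polya frequency series,
  expand \<open>F z * (\<Sum> c y / (z - y))\<close> in a Laurent series about a point between the zeros of \<open>F\<close> and
  \<open>a\<close>. The factors of \<open>F\<close> do not increase the number of sign changes of the coefficients, and
  Descartes' rule bounds the number of zeros of the regular part, which is the combination.

  The Chebyshev property implies that a combination of \<open>n\<close> kernels with \<open>n - 1\<close> zeros has strictly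
  alternating coefficients. Hence the inverse of the Gram matrix maps alternating vectors to
  strictly alternating ones, the least eigenvalue of the Gram matrix is simple with an alternating
  eigenvector \<open>w\<close>, and \<open>\<Sum> w k * K x (t k)\<close> has \<open>n - 1\<close> zeros in the open interval.
\<close>

section \<open>Unisolvent kernels\<close>

text \<open>The classical route to such a result is sign regularity of the kernel, the Cauchy-Binet
  formula and oscillation matrices. Here no determinants occur: the kernel enters only through the
  non-vanishing of its minors, and alternation is obtained by a duality that uses the symmetry of
  \<open>K\<close>. The optimal weights belong to the least eigenvalue of the Gram matrix, whereas
  Perron's argument speaks of the greatest one. Therefore sign statements concern vectors
  \<open>v\<close> whose image \<open>mom v\<close> has prescribed signs. The measure may consist of
  \<open>n\<close> point masses only. A cell of the interval can then carry no mass, and integral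
  conditions alone would not produce a zero there. The points \<open>t'\<close> arise from the
  identity that \<open>P F - Q\<close> equals the product of all \<open>z - t k\<close> times the
  combination of the Loewner kernels with weights \<open>w k\<close>: they are the zeros of the
  second factor. Irrationality is what makes minors of every order non-zero: the Loewner kernel of a
  rational function has finite rank.\<close>

lemma exists_nontrivial_kernel:
  fixes M :: "'i \<Rightarrow> 'j \<Rightarrow> real"
  assumes "finite I" "finite J" "card I < card J"
  shows "\<exists>c. (\<exists>j\<in>J. c j \<noteq> 0) \<and> (\<forall>i\<in>I. (\<Sum>j\<in>J. M i j * c j) = 0)"
  using assms
proof (induction I arbitrary: J M rule: finite_induct)
  case empty
  then have "J \<noteq> {}" by auto
  then show ?case by (intro exI[of _ "\<lambda>_. 1"]) auto
next
  case (insert i I)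
  show ?case
  proof (cases "\<forall>j\<in>J. M i j = 0")
    case True
    have "card I < card J" using insert.prems insert.hyps by simp
    from insert.IH[OF insert.prems(1) this, of M] obtain c
      where "\<exists>j\<in>J. c j \<noteq> 0" "\<forall>i\<in>I. (\<Sum>j\<in>J. M i j * c j) = 0" by blast
    then show ?thesis using True by (intro exI[of _ c]) auto
  next
    case False
    then obtain j0 where j0: "j0 \<in> J" "M i j0 \<noteq> 0" by blast
    define J' where "J' = J - {j0}"
    have J': "finite J'" "card I < card J'" "J = insert j0 J'" "j0 \<notin> J'"
      using insert j0 by (auto simp: J'_def)
    \<comment> \<open>Gaussian elimination with pivot \<open>M i j0\<close>: the induction
      hypothesis is applied to the remaining rows after column \<open>j0\<close> has been cleared by
      row \<open>i\<close>.\<close>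
    from insert.IH[OF J'(1,2), of "\<lambda>i' j. M i' j - M i' j0 * M i j / M i j0"] obtain c
      where c: "\<exists>j\<in>J'. c j \<noteq> 0"
        "\<forall>i'\<in>I. (\<Sum>j\<in>J'. (M i' j - M i' j0 * M i j / M i j0) * c j) = 0" by blast
    define e where "e = c(j0 := - (\<Sum>j\<in>J'. M i j * c j) / M i j0)"
    have e: "(\<Sum>j\<in>J. M i' j * e j) = M i' j0 * e j0 + (\<Sum>j\<in>J'. M i' j * c j)" for i'
    proof -
      have "(\<Sum>j\<in>J'. M i' j * e j) = (\<Sum>j\<in>J'. M i' j * c j)"
        using J'(4) by (intro sum.cong) (auto simp: e_def)
      then show ?thesis using J' by simp
    qed
    have "(\<Sum>j\<in>J. M i' j * e j) = 0" if "i' \<in> insert i I" for i'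
    proof (cases "i' = i")
      case True
      then show ?thesis using j0 by (simp add: e) (simp add: e_def)
    next
      case False
      then have "(\<Sum>j\<in>J'. (M i' j - M i' j0 * M i j / M i j0) * c j) = 0" using that c(2) by blast
      then have "(\<Sum>j\<in>J'. M i' j * c j) = (\<Sum>j\<in>J'. M i' j0 / M i j0 * (M i j * c j))"
        by (simp add: left_diff_distrib sum_subtractf mult.assoc)
      also have "\<dots> = M i' j0 / M i j0 * (\<Sum>j\<in>J'. M i j * c j)" by (simp add: sum_distrib_left)
      finally show ?thesis by (simp add: e) (simp add: e_def)
    qed
    moreover have "\<exists>j\<in>J. e j \<noteq> 0" using c(1) J' by (auto simp: e_def)
    ultimately show ?thesis by blast
  qed
qed

text \<open>Homogenization: \<open>- q\<close> becomes an extra column, indexed by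
  \<open>None\<close>, so that there are more unknowns than equations. Injectivity keeps the extra
  coordinate of a kernel vector away from 0, and dividing by it solves the system.\<close>

lemma solvable_if_injective:
  fixes A :: "'j \<Rightarrow> 'j \<Rightarrow> real"
  assumes "finite J"
    and inj: "\<And>c. \<forall>i\<in>J. (\<Sum>j\<in>J. A i j * c j) = 0 \<Longrightarrow> \<forall>j\<in>J. c j = 0"
  shows "\<exists>v. \<forall>i\<in>J. (\<Sum>j\<in>J. A i j * v j) = q i"
proof -
  define J' where "J' = insert None (Some ` J)"
  define M where "M = (\<lambda>i j. case j of None \<Rightarrow> - q i | Some j \<Rightarrow> A i j)"
  have "card J < card J'" "finite J'" using assms(1) by (auto simp: J'_def card_image)
  from exists_nontrivial_kernel[OF assms(1) this(2,1), of M] obtain c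
    where c: "\<exists>j\<in>J'. c j \<noteq> 0" "\<forall>i\<in>J. (\<Sum>j\<in>J'. M i j * c j) = 0" by blast
  have s: "(\<Sum>j\<in>J'. M i j * c j) = (\<Sum>j\<in>J. A i j * c (Some j)) - q i * c None" for i
    using assms(1) by (simp add: J'_def M_def sum.reindex)
  have "c None \<noteq> 0"
  proof
    assume "c None = 0"
    then have "\<forall>j\<in>J. c (Some j) = 0" using inj[of "\<lambda>j. c (Some j)"] c(2) s by simp
    then show False using c(1) \<open>c None = 0\<close> by (auto simp: J'_def)
  qed
  have "(\<Sum>j\<in>J. A i j * (c (Some j) / c None)) = q i" if "i \<in> J" for i
  proof -
    have "(\<Sum>j\<in>J. A i j * c (Some j)) = q i * c None" using c(2) s that by auto
    then show ?thesis using \<open>c None \<noteq> 0\<close>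
      by (simp add: sum_divide_distrib[symmetric] times_divide_eq_right)
  qed
  then show ?thesis by (intro exI[of _ "\<lambda>j. c (Some j) / c None"]) auto
qed

lemma alternating_signs:
  fixes d :: "nat \<Rightarrow> real"
  assumes "\<And>k. k \<in> {1..<n} \<Longrightarrow> d k * d (Suc k) < 0" and "n \<ge> 1" and "d 1 \<noteq> 0"
  shows "\<exists>s\<in>{1, -1}. \<forall>k\<in>{1..n}. 0 < s * (-1) ^ k * d k"
proof -
  \<comment> \<open>The indices start at 1, where \<open>(-1) ^ k\<close> is negative; hence the
    minus sign.\<close>
  define s where "s = - sgn (d 1)"
  have "0 < s * (-1) ^ k * d k" if "1 \<le> k" "k \<le> n" for k
    using that
  proof (induction k rule: dec_induct)
    case base
    then show ?case using assms(3) by (simp add: s_def sgn_if)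
  next
    case (step k)
    then have "0 < s * (-1) ^ k * d k" "d k * d (Suc k) < 0" using assms(1)[of k] by auto
    then show ?case by (auto simp: mult_less_0_iff zero_less_mult_iff)
  qed
  moreover have "s \<in> {1, -1}" using assms(3) by (auto simp: s_def sgn_if)
  ultimately show ?thesis by auto
qed

lemma same_sign_if_no_zero:
  fixes h :: "real \<Rightarrow> real"
  assumes "continuous_on {x..y} h" "x \<le> y" "\<And>z. z \<in> {x..y} \<Longrightarrow> h z \<noteq> 0"
  shows "h x * h y > 0"
proof (rule ccontr)
  assume "\<not> h x * h y > 0"
  then have "h x \<le> 0 \<and> 0 \<le> h y \<or> h y \<le> 0 \<and> 0 \<le> h x" by (auto simp: zero_less_mult_iff)
  then have "\<exists>z. x \<le> z \<and> z \<le> y \<and> h z = 0"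
    using IVT'[of h x 0 y] IVT2'[of h y 0 x] assms(1,2) by auto
  then show False using assms(3) by auto
qed

text \<open>Non-vanishing of all square minors of \<open>K\<close> with nodes in
  \<open>[a, b]\<close>. The two node sets may overlap, so the diagonal values of \<open>K\<close>
  take part. All sizes are included because the alternation argument needs size \<open>n - 1\<close>
  besides \<open>n\<close>.\<close>

locale unisolvent_kernel =
  fixes a b :: real and K :: "real \<Rightarrow> real \<Rightarrow> real"
  assumes ab: "a < b"
    and sym: "K x y = K y x"
    and cont: "y \<in> {a..b} \<Longrightarrow> continuous_on {a..b} (\<lambda>x. K x y)"
    and unisolvent: "\<lbrakk>finite X; finite Y; X \<subseteq> {a..b}; Y \<subseteq> {a..b}; card X = card Y;
      \<And>x. x \<in> X \<Longrightarrow> (\<Sum>y\<in>Y. c y * K x y) = 0; y \<in> Y\<rbrakk> \<Longrightarrow> c y = 0"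

locale unisolvent_nodes = unisolvent_kernel +
  fixes n :: nat and t :: "nat \<Rightarrow> real"
  assumes n: "n \<ge> 1" and t_mono: "strict_mono_on {1..n} t" and t_in: "t ` {1..n} \<subseteq> {a..b}"
begin

definition comb :: "(nat \<Rightarrow> real) \<Rightarrow> real \<Rightarrow> real" where
  "comb d x = (\<Sum>k=1..n. d k * K x (t k))"

lemma t_mem: "k \<in> {1..n} \<Longrightarrow> t k \<in> {a..b}"
  using t_in by blast

lemma t_inj: "inj_on t {1..n}"
  using t_mono by (rule strict_mono_on_imp_inj_on)

lemma comb_continuous: "continuous_on {a..b} (comb d)"
proof -
  have "continuous_on {a..b} (\<lambda>x. K x (t k))" if "k \<in> {1..n}" for k
    using that t_mem by (intro cont) blast
  then show ?thesis unfolding comb_def[abs_def] by (intro continuous_intros) auto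
qed

lemma comb_zeros:
  assumes "finite X" "X \<subseteq> {a..b}" "card X = n" "\<And>x. x \<in> X \<Longrightarrow> comb d x = 0" "k \<in> {1..n}"
  shows "d k = 0"
proof -
  define c where "c = (\<lambda>y. d (the_inv_into {1..n} t y))"
  have c: "c (t k) = d k" if "k \<in> {1..n}" for k
    using the_inv_into_f_f[OF t_inj that] by (simp add: c_def)
  have "(\<Sum>y\<in>t ` {1..n}. c y * K x y) = comb d x" for x
    unfolding comb_def by (subst sum.reindex[OF t_inj]) (simp add: c)
  then have "c (t k) = 0"
    using assms(1-4) t_in imageI[OF assms(5), of t]
    by (intro unisolvent[of X "t ` {1..n}" c "t k"]) (simp_all add: card_image[OF t_inj] del: One_nat_def)
  then show ?thesis using c assms by simp
qed

text \<open>Duality isolates two neighbouring coefficients. A combination \<open>h\<close> of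
  kernels centred at the zeros \<open>X\<close> can be made to vanish at all nodes except
  \<open>t k\<close> and \<open>t (Suc k)\<close>. It has no further zero, hence the same sign at
  these two nodes, and pairing it with \<open>d\<close> gives 0, so that \<open>d k\<close> and
  \<open>d (Suc k)\<close> have opposite signs.\<close>

lemma comb_alternates:
  assumes X: "finite X" "X \<subseteq> {a..b}" "card X = n - 1" "\<And>x. x \<in> X \<Longrightarrow> comb d x = 0"
    and d: "\<exists>k\<in>{1..n}. d k \<noteq> 0"
  shows "\<exists>s\<in>{1, -1}. \<forall>k\<in>{1..n}. 0 < s * (-1) ^ k * d k"
proof -
  have ratio: "\<exists>r>0. d k = - r * d (Suc k)" if k: "k \<in> {1..<n}" for k
  proof -
    define I where "I = {1..n} - {k, Suc k}"
    have cI: "card I = n - 2" "finite I" "I \<subseteq> {1..n}" using k by (auto simp: I_def card_Diff_subset)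
    have "card I < card X" using cI X(3) k by auto
    \<comment> \<open>There are \<open>n - 2\<close> conditions on \<open>n - 1\<close>
      coefficients.\<close>
    from exists_nontrivial_kernel[OF cI(2) X(1) this, of "\<lambda>i x. K (t i) x"] obtain c
      where c: "\<exists>x\<in>X. c x \<noteq> 0" "\<And>i. i \<in> I \<Longrightarrow> (\<Sum>x\<in>X. K (t i) x * c x) = 0" by blast
    define h where "h = (\<lambda>y. \<Sum>x\<in>X. c x * K y x)"
    have h0: "h (t i) = 0" if "i \<in> I" for i using c(2)[OF that] by (simp add: h_def mult.commute)
    have hcont: "continuous_on {a..b} h" unfolding h_def using X(2) by (intro continuous_intros cont) auto
    \<comment> \<open>One more zero would make \<open>card X\<close> zeros of a nontrivial
      combination of \<open>card X\<close> kernels.\<close>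
    have hne: "h y \<noteq> 0" if y: "y \<in> {a..b}" "y \<notin> t ` I" for y
    proof
      assume "h y = 0"
      define Y where "Y = insert y (t ` I)"
      have "card (t ` I) = n - 2" using cI t_inj by (metis card_image inj_on_subset)
      then have "card Y = card X" using y cI X(3) k by (simp add: Y_def, simp add: numeral_2_eq_2 Suc_diff_Suc)
      moreover have "h z = 0" if "z \<in> Y" for z using that \<open>h y = 0\<close> h0 by (auto simp: Y_def)
      moreover have "finite Y" "Y \<subseteq> {a..b}" using y t_mem cI by (auto simp: Y_def)
      ultimately have "c x = 0" if "x \<in> X" for x
        using X(1,2) that unfolding h_def by (intro unisolvent[of Y X c]) auto
      then show False using c(1) by blast
    qed
    have tk: "t k \<in> {a..b}" "t (Suc k) \<in> {a..b}"
      using k by (intro t_mem; simp)+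
    have t_less: "t i < t j" if "i < j" "i \<in> {1..n}" "j \<in> {1..n}" for i j
      using t_mono that by (simp add: strict_mono_on_def)
    have tk': "t k < t (Suc k)" using k by (intro t_less) auto
    have pos: "h (t k) * h (t (Suc k)) > 0"
    proof (rule same_sign_if_no_zero[of "t k" "t (Suc k)" h])
      show "continuous_on {t k..t (Suc k)} h"
        using hcont by (rule continuous_on_subset) (use tk tk' in auto)
      show "t k \<le> t (Suc k)" using tk' by simp
      fix z assume z: "z \<in> {t k..t (Suc k)}"
      have "z \<notin> t ` I"
      proof
        assume "z \<in> t ` I"
        then obtain i where i: "i \<in> I" "z = t i" by blast
        then have "i < k \<or> Suc k < i" by (auto simp: I_def)
        then show False
        proof
          assume "i < k"
          then have "t i < t k" using i k by (intro t_less) (auto simp: I_def)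
          then show False using z i by auto
        next
          assume "Suc k < i"
          then have "t (Suc k) < t i" using i k by (intro t_less) (auto simp: I_def)
          then show False using z i by auto
        qed
      qed
      then show "h z \<noteq> 0" using z tk by (intro hne) auto
    qed
    \<comment> \<open>By the symmetry of \<open>K\<close> the pairing can also be read as a sum of
      values of \<open>comb d\<close> on \<open>X\<close>, which are all 0.\<close>
    have "(\<Sum>k=1..n. d k * h (t k)) = (\<Sum>x\<in>X. c x * comb d x)"
      unfolding h_def comb_def sum_distrib_left
      by (subst sum.swap) (intro sum.cong refl, simp add: sym[of "t _"])
    also have "\<dots> = 0" using X(4) by simp
    finally have "0 = (\<Sum>k=1..n. d k * h (t k))" by simp
    also have "\<dots> = (\<Sum>k\<in>{k, Suc k}. d k * h (t k))"
      using k h0 by (intro sum.mono_neutral_right) (auto simp: I_def)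
    finally have "d k * h (t k) + d (Suc k) * h (t (Suc k)) = 0" by simp
    moreover have "h (t k) \<noteq> 0" using pos by auto
    ultimately have "d k = - (h (t (Suc k)) / h (t k)) * d (Suc k)" by (simp add: field_simps)
    moreover have "h (t (Suc k)) / h (t k) > 0" using pos
      by (auto simp: zero_less_mult_iff zero_less_divide_iff)
    ultimately show ?thesis by blast
  qed
  have nz: "d k \<noteq> 0 \<longleftrightarrow> d 1 \<noteq> 0" if "1 \<le> k" "k \<le> n" for k
    using that
  proof (induction k rule: dec_induct)
    case (step k)
    then obtain r where "r > 0" "d k = - r * d (Suc k)" using ratio[of k] by auto
    then show ?case using step by auto
  qed simp
  then have d1: "d 1 \<noteq> 0" using d by (metis atLeastAtMost_iff)
  have "d k * d (Suc k) < 0" if k: "k \<in> {1..<n}" for k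
  proof -
    obtain r where r: "r > 0" "d k = - r * d (Suc k)" using ratio[OF k] by auto
    have "d (Suc k) \<noteq> 0" using nz[of "Suc k"] d1 k by simp
    then have "d (Suc k) * d (Suc k) > 0" using not_square_less_zero[of "d (Suc k)"] by (simp add: less_le)
    then show ?thesis using r by (simp add: mult.assoc)
  qed
  then show ?thesis using n d1 by (intro alternating_signs)
qed

end

section \<open>Minimising the quadratic form\<close>

text \<open>Second countability: the complement of the support is covered by countably many basic
  open sets of measure 0.\<close>

lemma AE_in_measure_support:
  assumes "finite_borel_measure M"
  shows "AE x in M. x \<in> measure_support M"
proof -
  interpret finite_borel_measure M by fact
  obtain \<B> :: "real set set" where B: "countable \<B>" "topological_basis \<B>"
    using ex_countable_basis by blast
  define N where "N = (\<Union>U\<in>{U\<in>\<B>. emeasure M U = 0}. U)"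
  have "N \<in> null_sets M" unfolding N_def
  proof (rule null_sets_UN')
    show "countable {U\<in>\<B>. emeasure M U = 0}" using B(1) by (rule countable_subset[rotated]) auto
    show "U \<in> null_sets M" if "U \<in> {U\<in>\<B>. emeasure M U = 0}" for U
      using that topological_basis_open[OF B(2)] by (auto intro!: null_setsI)
  qed
  moreover have "{x \<in> space M. x \<notin> measure_support M} \<subseteq> N"
  proof
    fix x assume "x \<in> {x \<in> space M. x \<notin> measure_support M}"
    then obtain U where U: "open U" "x \<in> U" "emeasure M U = 0" by (auto simp: measure_support_def)
    then obtain U' where U': "U' \<in> \<B>" "x \<in> U'" "U' \<subseteq> U" using topological_basisE[OF B(2)] by metis
    have "emeasure M U' \<le> emeasure M U" using U U' by (intro emeasure_mono) auto
    then show "x \<in> N" using U U' by (auto simp: N_def)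
  qed
  ultimately show ?thesis by (intro AE_I'[of N]) auto
qed

lemma closed_measure_support: "closed (measure_support M)"
proof -
  have "- measure_support M = \<Union>{U. open U \<and> emeasure M U = 0}"
    by (auto simp: measure_support_def)
  then show ?thesis unfolding closed_def by auto
qed

lemma set_integrable_continuous:
  fixes h :: "real \<Rightarrow> real"
  assumes "finite_borel_measure M" and h: "continuous_on {a..b} h"
  shows "set_integrable M {a..b} h"
proof -
  interpret finite_borel_measure M by fact
  have "compact (h ` {a..b})" using h by (intro compact_continuous_image) auto
  then obtain C where C: "\<And>x. x \<in> {a..b} \<Longrightarrow> norm (h x) \<le> C"
    by (meson bounded_iff compact_imp_bounded imageI)
  have "h \<in> borel_measurable (restrict_space borel {a..b})"
    using h by (rule borel_measurable_continuous_on_restrict)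
  then have "(\<lambda>x. indicator {a..b} x *\<^sub>R h x) \<in> borel_measurable borel"
    by (subst borel_measurable_restrict_space_iff[symmetric]) auto
  then have "(\<lambda>x. indicator {a..b} x *\<^sub>R h x) \<in> borel_measurable M"
    using M_is_borel measurable_cong_sets by blast
  moreover have "norm (indicator {a..b} x *\<^sub>R h x) \<le> \<bar>C\<bar>" for x
    using C[of x] by (cases "x \<in> {a..b}") auto
  ultimately show ?thesis unfolding set_integrable_def
    by (intro integrable_const_bound[of _ "\<bar>C\<bar>"] always_eventually) auto
qed

text \<open>Serves to show that every cell between consecutive cut points is inhabited.\<close>

lemma exists_element_of_rank:
  fixes S :: "'a::linorder set"
  assumes "finite S" "1 \<le> j" "j \<le> card S"
  shows "\<exists>x\<in>S. card {s\<in>S. s \<le> x} = j"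
  using assms
proof (induction S rule: finite_linorder_max_induct)
  case empty
  then show ?case by simp
next
  case (insert b A)
  then have "b \<notin> A" by auto
  show ?case
  proof (cases "j \<le> card A")
    case True
    then obtain x where x: "x \<in> A" "card {s\<in>A. s \<le> x} = j" using insert by blast
    then have "{s\<in>insert b A. s \<le> x} = {s\<in>A. s \<le> x}" using insert.hyps(2) by auto
    then show ?thesis using x by (intro bexI[of _ x]) auto
  next
    case False
    then have "j = card (insert b A)" using insert.prems insert.hyps(1) \<open>b \<notin> A\<close> by simp
    moreover have "{s\<in>insert b A. s \<le> b} = insert b A" using insert.hyps(2) by auto
    ultimately show ?thesis by (intro bexI[of _ b]) auto
  qed
qed

lemma sum_squares_normalized:
  fixes c :: "'a \<Rightarrow> real"
  assumes "(\<Sum>k\<in>A. (c k)\<^sup>2) > 0"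
  shows "(\<Sum>k\<in>A. (1 / sqrt (\<Sum>k\<in>A. (c k)\<^sup>2) * c k)\<^sup>2) = 1"
proof -
  have "(\<Sum>k\<in>A. (1 / sqrt (\<Sum>k\<in>A. (c k)\<^sup>2) * c k)\<^sup>2) = (\<Sum>k\<in>A. (c k)\<^sup>2 / (\<Sum>k\<in>A. (c k)\<^sup>2))"
    using assms by (intro sum.cong refl) (simp add: power_mult_distrib power_divide)
  then show ?thesis using assms by (simp flip: sum_divide_distrib)
qed

section \<open>The Gram matrix of the kernel functions\<close>

locale aaa_problem = unisolvent_nodes +
  fixes \<nu> :: "real measure"
  assumes finite_borel: "finite_borel_measure \<nu>"
    and supp: "measure_support \<nu> \<subseteq> {a..b}"
    and supp_card: "infinite (measure_support \<nu>) \<or> card (measure_support \<nu>) \<ge> n"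
begin

sublocale finite_borel_measure \<nu> by (rule finite_borel)

definition integ :: "(real \<Rightarrow> real) \<Rightarrow> real" where
  "integ h = (LINT x:{a..b}|\<nu>. h x)"

text \<open>The Gram matrix of the functions \<open>K x (t k)\<close> in the space of
  \<open>\<nu>\<close>, applied to \<open>v\<close>; \<open>form\<close> below is the corresponding
  bilinear form.\<close>

definition mom :: "(nat \<Rightarrow> real) \<Rightarrow> nat \<Rightarrow> real" where
  "mom v k = integ (\<lambda>x. comb v x * K x (t k))"

definition form :: "(nat \<Rightarrow> real) \<Rightarrow> (nat \<Rightarrow> real) \<Rightarrow> real" where
  "form u v = integ (\<lambda>x. comb u x * comb v x)"

lemma K_continuous: "k \<in> {1..n} \<Longrightarrow> continuous_on {a..b} (\<lambda>x. K x (t k))"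
  by (intro cont t_mem)

lemma integrable_if_continuous: "continuous_on {a..b} (h :: real \<Rightarrow> real) \<Longrightarrow> set_integrable \<nu> {a..b} h"
  by (rule set_integrable_continuous[OF finite_borel])

lemma integ_sum:
  assumes "\<And>k. k \<in> {1..n} \<Longrightarrow> continuous_on {a..b} (h k)"
  shows "integ (\<lambda>x. \<Sum>k=1..n. c k * h k x) = (\<Sum>k=1..n. c k * integ (h k))"
proof -
  have "set_integrable \<nu> {a..b} (\<lambda>x. c k * h k x)" if "k \<in> {1..n}" for k
    using assms that by (intro integrable_if_continuous continuous_intros)
  then have "integ (\<lambda>x. \<Sum>k=1..n. c k * h k x) = (\<Sum>k=1..n. LINT x:{a..b}|\<nu>. c k * h k x)"
    unfolding integ_def set_lebesgue_integral_def set_integrable_def scaleR_sum_right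
    by (rule Bochner_Integration.integral_sum)
  then show ?thesis by (simp add: integ_def)
qed

lemma form_eq: "form u v = (\<Sum>k=1..n. u k * mom v k)"
proof -
  have "form u v = integ (\<lambda>x. \<Sum>k=1..n. u k * (comb v x * K x (t k)))"
    unfolding form_def by (subst comb_def) (simp add: sum_distrib_left sum_distrib_right mult_ac)
  also have "\<dots> = (\<Sum>k=1..n. u k * mom v k)"
    unfolding mom_def by (intro integ_sum continuous_intros comb_continuous K_continuous)
  finally show ?thesis .
qed

lemma form_commute: "form u v = form v u"
  by (simp add: form_def mult.commute)

lemma nonzero_if_mom_nonzero:
  assumes "\<exists>k\<in>{1..n}. mom v k \<noteq> 0"
  shows "\<exists>k\<in>{1..n}. v k \<noteq> 0"
proof (rule ccontr)
  assume "\<not> ?thesis"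
  then have "comb v x = 0" for x by (auto simp: comb_def)
  then show False using assms by (auto simp: mom_def integ_def)
qed

lemma mom_eq: "mom v k = (\<Sum>l=1..n. integ (\<lambda>x. K x (t l) * K x (t k)) * v l)" if "k \<in> {1..n}"
proof -
  have "mom v k = integ (\<lambda>x. \<Sum>l=1..n. v l * (K x (t l) * K x (t k)))"
    unfolding mom_def comb_def sum_distrib_right by (simp only: mult.assoc)
  also have "\<dots> = (\<Sum>l=1..n. v l * integ (\<lambda>x. K x (t l) * K x (t k)))"
    using that by (intro integ_sum continuous_intros K_continuous)
  finally show ?thesis by (simp add: mult.commute)
qed

text \<open>A vanishing integral gives zeros only almost everywhere. At a point of the support where
  \<open>h\<close> is positive, continuity would give a relatively open set on which
  \<open>h\<close> is positive, and such a set is not null.\<close>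

lemma zero_on_support:
  assumes "continuous_on {a..b} h" "\<And>x. x \<in> {a..b} \<Longrightarrow> h x \<ge> 0" "integ h = 0"
    and "x \<in> measure_support \<nu>"
  shows "h x = 0"
proof (rule ccontr)
  assume "h x \<noteq> 0"
  have x: "x \<in> {a..b}" using assms(4) supp by blast
  have pos: "h x > 0" using assms(2)[OF x] \<open>h x \<noteq> 0\<close> by simp
  have "set_integrable \<nu> {a..b} h" using assms(1) by (rule integrable_if_continuous)
  then have "AE y in \<nu>. indicator {a..b} y *\<^sub>R h y = 0"
    using assms(2,3) unfolding integ_def set_lebesgue_integral_def set_integrable_def
    by (subst integral_nonneg_eq_0_iff_AE[symmetric]) (auto simp: indicator_def)
  then have AE: "AE y in \<nu>. y \<in> {a..b} \<and> h y = 0"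
    using AE_in_measure_support[OF finite_borel]
    by eventually_elim (use supp in \<open>auto simp: indicator_def\<close>)
  have "openin (top_of_set {a..b}) ({a..b} \<inter> h -` {0<..})"
    using assms(1) by (rule continuous_openin_preimage_gen) auto
  then obtain U where U: "open U" "{a..b} \<inter> h -` {0<..} = {a..b} \<inter> U"
    by (auto simp: openin_open)
  have "x \<in> {a..b} \<inter> h -` {0<..}" using x pos by simp
  then have "x \<in> U" unfolding U(2) by blast
  then have "emeasure \<nu> U > 0" using assms(4) U by (auto simp: measure_support_def)
  moreover have "y \<notin> U" if "y \<in> {a..b} \<and> h y = 0" for y
  proof
    assume "y \<in> U"
    then have "y \<in> {a..b} \<inter> h -` {0<..}" using that unfolding U(2) by blast
    then show False using that by simp
  qed
  then have "AE y in \<nu>. y \<notin> U" using AE by (rule eventually_mono[rotated])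
  then have "emeasure \<nu> U = 0" using AE_iff_measurable[of U \<nu> "\<lambda>y. y \<notin> U"] borel_open[OF U(1)] M_is_borel sets_eq_imp_space_eq[OF M_is_borel] by simp
  ultimately show False by simp
qed

text \<open>This is where the size of the support enters: a combination with integral square 0
  vanishes at \<open>n\<close> points of the support, hence is trivial.\<close>

lemma form_pos:
  assumes "\<exists>k\<in>{1..n}. v k \<noteq> 0"
  shows "form v v > 0"
proof -
  have "form v v \<ge> 0"
    unfolding form_def integ_def set_lebesgue_integral_def by (intro integral_nonneg_AE) auto
  moreover have "form v v \<noteq> 0"
  proof
    assume "form v v = 0"
    then have z: "comb v x = 0" if "x \<in> measure_support \<nu>" for x
      using that zero_on_support[of "\<lambda>x. comb v x * comb v x" x]
      by (auto simp: form_def intro!: continuous_intros comb_continuous)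
    obtain X where X: "X \<subseteq> measure_support \<nu>" "finite X" "card X = n"
    proof (cases "finite (measure_support \<nu>)")
      case True
      then show ?thesis using supp_card obtain_subset_with_card_n[of n] that
        by (metis finite_subset)
    next
      case False
      then show ?thesis using infinite_arbitrarily_large[OF False, of n] that by blast
    qed
    have "v k = 0" if "k \<in> {1..n}" for k
      using comb_zeros[OF X(2) subset_trans[OF X(1) supp] X(3) _ that, of v] z X(1) by blast
    then show False using assms by blast
  qed
  ultimately show ?thesis by simp
qed

text \<open>If \<open>comb v\<close> had fewer zeros, \<open>[a, b]\<close> would split into \<open>n - 1\<close> cells on which it has constant
  sign. Some \<open>d \<noteq> 0\<close> makes the integral of \<open>\<bar>comb v\<bar> * comb d\<close> vanish over each cell; then
  \<open>comb d\<close> has \<open>n - 1\<close> zeros, so that \<open>d\<close> alternates strictly, although it is orthogonal to \<open>mom v\<close>.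
  On a cell where \<open>\<bar>comb v\<bar>\<close> has integral 0 a point evaluation of \<open>comb d\<close> replaces the integral.\<close>

lemma zeros_if_weakly_alternating:
  assumes s: "s \<in> {1, -1}" and weak: "\<And>k. k \<in> {1..n} \<Longrightarrow> 0 \<le> s * (-1) ^ k * mom v k"
    and nz: "\<exists>k\<in>{1..n}. mom v k \<noteq> 0"
  shows "\<exists>X\<subseteq>{a<..<b}. finite X \<and> card X = n - 1 \<and> (\<forall>x\<in>X. comb v x = 0)"
proof (rule ccontr)
  assume contra: "\<not> ?thesis"
  define Z where "Z = {x\<in>{a<..<b}. comb v x = 0}"
  note vnz = nonzero_if_mom_nonzero[OF nz]
  have finZ: "finite Z"
  proof (rule ccontr)
    assume "infinite Z"
    then obtain X where X: "X \<subseteq> Z" "finite X" "card X = n"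
      using infinite_arbitrarily_large[of Z n] by blast
    then have "X \<subseteq> {a..b}" by (auto simp: Z_def)
    have "comb v x = 0" if "x \<in> X" for x using that X(1) by (auto simp: Z_def)
    then have "v k = 0" if "k \<in> {1..n}" for k
      using comb_zeros[OF X(2) \<open>X \<subseteq> {a..b}\<close> X(3) _ that, of v] by blast
    then show False using vnz by blast
  qed
  have cZ: "card Z < n - 1"
  proof (rule ccontr)
    assume "\<not> card Z < n - 1"
    then obtain X where "X \<subseteq> Z" "card X = n - 1" "finite X"
      using obtain_subset_with_card_n[of "n - 1" Z] finZ by (metis not_less finite_subset)
    moreover from this have "X \<subseteq> {a<..<b}" "\<forall>x\<in>X. comb v x = 0" by (auto simp: Z_def)
    ultimately show False using contra by blast
  qed
  \<comment> \<open>The zeros are padded by arbitrary points to exactly \<open>n - 2\<close> cut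
    points, which makes \<open>n - 1\<close> cells. As \<open>card Z < n - 1\<close>, the truncated
    subtraction is exact.\<close>
  have "infinite ({a<..<b} - Z)" using finZ ab by (simp add: infinite_Ioo)
  then obtain T where T: "T \<subseteq> {a<..<b} - Z" "finite T" "card T = n - 2 - card Z"
    using infinite_arbitrarily_large by blast
  define S where "S = Z \<union> T"
  have S: "finite S" "S \<subseteq> {a<..<b}" "Z \<subseteq> S" using T finZ by (auto simp: S_def Z_def)
  have "card S = card Z + card T" unfolding S_def using T finZ by (intro card_Un_disjoint) auto
  then have cS: "card S = n - 2" using T(3) cZ by simp
  \<comment> \<open>The level of \<open>x\<close> is the number of cut points not to the right of
    \<open>x\<close>; the cells are its level sets, intervals closed on the left.\<close>
  define lev where "lev = (\<lambda>x. card {s\<in>S. s \<le> x})"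
  have lev_mono: "lev x \<le> lev y" if "x \<le> y" for x y
    unfolding lev_def using that S(1) by (intro card_mono) auto
  have lev_le: "lev x \<le> n - 2" for x
    unfolding lev_def cS[symmetric] using S(1) by (intro card_mono) auto
  define cell where "cell = (\<lambda>j. {x\<in>{a..b}. lev x = j})"
  have cell_sub: "cell j \<subseteq> {a..b}" for j by (auto simp: cell_def)
  have "(\<lambda>x. real (lev x)) \<in> borel_measurable borel"
    by (intro borel_measurable_mono monoI) (simp add: lev_mono)
  then have "{x \<in> space borel. real (lev x) = real j} \<in> sets borel" for j
    by measurable
  then have "{a..b} \<inter> {x. lev x = j} \<in> sets borel" for j by (intro sets.Int) auto
  moreover have "cell j = {a..b} \<inter> {x. lev x = j}" for j by (auto simp: cell_def)
  ultimately have cell_meas: "cell j \<in> sets \<nu>" for j using M_is_borel by simp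
  have integrable_cell: "set_integrable \<nu> (cell j) h" if "continuous_on {a..b} h" for j and h :: "real \<Rightarrow> real"
    using integrable_if_continuous[OF that] cell_meas cell_sub by (rule set_integrable_subset)
  have cell_nonempty: "cell j \<noteq> {}" if j: "j < n - 1" for j
  proof (cases "j = 0")
    case True
    have "{s\<in>S. s \<le> a} = {}" using S(2) by auto
    then have "lev a = 0" unfolding lev_def by (simp only: card.empty)
    then have "a \<in> cell j" using ab True unfolding cell_def by simp
    then show ?thesis by blast
  next
    case False
    then have "1 \<le> j" "j \<le> card S" using cS j by linarith+
    then obtain x where "x \<in> S" "card {s\<in>S. s \<le> x} = j"
      using exists_element_of_rank[OF S(1)] by blast
    then have "x \<in> cell j" using S(2) unfolding cell_def lev_def by auto
    then show ?thesis by blast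
  qed
  define p where "p = (\<lambda>j. SOME x. x \<in> cell j)"
  have p: "p j \<in> cell j" if "j < n - 1" for j
    unfolding p_def using cell_nonempty[OF that] by (simp add: some_in_eq)
  have interval: "{x..y} \<subseteq> cell j" if "x \<in> cell j" "y \<in> cell j" for x y j
  proof
    fix z assume z: "z \<in> {x..y}"
    have "lev x \<le> lev z" "lev z \<le> lev y" using z by (auto intro: lev_mono)
    then show "z \<in> cell j" using that z by (auto simp: cell_def)
  qed
  \<comment> \<open>A strict change of sign inside a cell would produce a zero of
    \<open>comb v\<close> strictly between two of its points. All interior zeros are cut points, so
    the two points would have different levels.\<close>
  have weak_sign: "(\<forall>x\<in>cell j. comb v x \<ge> 0) \<or> (\<forall>x\<in>cell j. comb v x \<le> 0)" for j
  proof -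
    have no_change: False
      if xy: "x \<in> cell j" "y \<in> cell j" "x < y" "comb v x * comb v y < 0" for x y
    proof -
      have c: "continuous_on {x..y} (comb v)"
        using comb_continuous by (rule continuous_on_subset) (use interval[OF xy(1,2)] cell_sub in blast)
      have "\<exists>z. x \<le> z \<and> z \<le> y \<and> comb v z = 0"
        using IVT'[of "comb v" x 0 y] IVT2'[of "comb v" y 0 x] c xy(3,4)
        by (auto simp: mult_less_0_iff)
      then obtain z where z: "x \<le> z" "z \<le> y" "comb v z = 0" by blast
      moreover have "z \<noteq> x" "z \<noteq> y" using z xy(4) by auto
      ultimately have "x < z" "z < y" by auto
      moreover have "a \<le> x" "y \<le> b" using xy by (auto simp: cell_def)
      ultimately have "z \<in> S" using z(3) S(3) by (auto simp: Z_def)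
      then have "{s\<in>S. s \<le> x} \<subset> {s\<in>S. s \<le> y}" using \<open>x < z\<close> \<open>z < y\<close>
        by (intro psubsetI) (auto simp: set_eq_iff intro!: exI[of _ z])
      then have "lev x < lev y" unfolding lev_def using S(1) by (intro psubset_card_mono) auto
      then show False using xy by (simp add: cell_def)
    qed
    show ?thesis
    proof (rule ccontr)
      assume "\<not> ?thesis"
      then obtain x y where "x \<in> cell j" "y \<in> cell j" "comb v x < 0" "comb v y > 0"
        by (auto simp: not_le)
      then show False using no_change[of x y] no_change[of y x]
        by (cases x y rule: linorder_cases) (auto simp: mult_less_0_iff)
    qed
  qed
  \<comment> \<open>The mass of a cell under the density \<open>\<bar>comb v x\<bar>\<close>. If it
    is 0, row \<open>j\<close> of \<open>M\<close> is a point evaluation at \<open>p j\<close>. In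
    either case the \<open>n - 1\<close> rows leave a nontrivial \<open>d\<close>.\<close>
  define W where "W = (\<lambda>j. LINT x:cell j|\<nu>. \<bar>comb v x\<bar>)"
  define M where "M = (\<lambda>j k. if W j = 0 then K (p j) (t k)
    else (LINT x:cell j|\<nu>. \<bar>comb v x\<bar> * K x (t k)))"
  obtain d where d: "\<exists>k\<in>{1..n}. d k \<noteq> 0" "\<And>j. j < n - 1 \<Longrightarrow> (\<Sum>k=1..n. M j k * d k) = 0"
    using exists_nontrivial_kernel[of "{..<n - 1}" "{1..n}" M] n by auto
  have sumM: "(\<Sum>k=1..n. M j k * d k) =
    (if W j = 0 then comb d (p j) else (LINT x:cell j|\<nu>. \<bar>comb v x\<bar> * comb d x))" for j
  proof (cases "W j = 0")
    case True
    then show ?thesis by (simp add: M_def comb_def mult.commute)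
  next
    case False
    have "(LINT x:cell j|\<nu>. \<bar>comb v x\<bar> * comb d x)
      = (LINT x:cell j|\<nu>. (\<Sum>k=1..n. (\<bar>comb v x\<bar> * K x (t k)) * d k))"
      unfolding comb_def[of d] sum_distrib_left by (simp only: mult_ac)
    also have "\<dots> = (\<Sum>k=1..n. LINT x:cell j|\<nu>. (\<bar>comb v x\<bar> * K x (t k)) * d k)"
      unfolding set_lebesgue_integral_def scaleR_sum_right
    proof (rule Bochner_Integration.integral_sum)
      fix k assume "k \<in> {1..n}"
      then have "set_integrable \<nu> (cell j) (\<lambda>x. (\<bar>comb v x\<bar> * K x (t k)) * d k)"
        by (intro integrable_cell continuous_intros comb_continuous K_continuous)
      then show "integrable \<nu> (\<lambda>x. indicat_real (cell j) x *\<^sub>R (\<bar>comb v x\<bar> * K x (t k) * d k))"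
        by (simp add: set_integrable_def)
    qed
    also have "\<dots> = (\<Sum>k=1..n. M j k * d k)" using False by (simp add: M_def)
    finally show ?thesis using False by simp
  qed
  have AE0: "AE x in \<nu>. indicator (cell j) x *\<^sub>R \<bar>comb v x\<bar> = 0" if "W j = 0" for j
  proof -
    have "set_integrable \<nu> (cell j) (\<lambda>x. \<bar>comb v x\<bar>)"
      by (intro integrable_cell continuous_intros comb_continuous)
    then show ?thesis using that unfolding W_def set_lebesgue_integral_def set_integrable_def
      by (subst integral_nonneg_eq_0_iff_AE[symmetric]) auto
  qed
  \<comment> \<open>If \<open>comb d\<close> had no zero in a cell of positive mass, it would have a
    constant sign there, and its weighted integral over the cell could not vanish.\<close>
  have zero_in_cell: "\<exists>x\<in>cell j. comb d x = 0" if j: "j < n - 1" for j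
  proof (cases "W j = 0")
    case True
    then have "comb d (p j) = 0" using sumM[of j] d(2)[OF j] by simp
    then show ?thesis using p[OF j] by blast
  next
    case False
    show ?thesis
    proof (rule ccontr)
      assume no: "\<not> ?thesis"
      have same: "comb d x * comb d y > 0" if xy: "x \<in> cell j" "y \<in> cell j" "x \<le> y" for x y
      proof (rule same_sign_if_no_zero[OF _ xy(3)])
        show "continuous_on {x..y} (comb d)"
          using comb_continuous by (rule continuous_on_subset) (use interval[OF xy(1,2)] cell_sub in blast)
        show "comb d z \<noteq> 0" if "z \<in> {x..y}" for z using no interval[OF xy(1,2)] that by blast
      qed
      define \<sigma> where "\<sigma> = sgn (comb d (p j))"
      have pos: "\<sigma> * comb d x > 0" if "x \<in> cell j" for x
        using same[of x "p j"] same[of "p j" x] p[OF j] that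
        by (cases "x \<le> p j") (auto simp: \<sigma>_def zero_less_mult_iff sgn_if)
      have "set_integrable \<nu> (cell j) (\<lambda>x. \<bar>comb v x\<bar> * (\<sigma> * comb d x))"
        by (intro integrable_cell continuous_intros comb_continuous)
      moreover have "(LINT x:cell j|\<nu>. \<bar>comb v x\<bar> * (\<sigma> * comb d x)) = \<sigma> * (LINT x:cell j|\<nu>. \<bar>comb v x\<bar> * comb d x)"
        by (subst set_integral_mult_right[symmetric]) (simp only: mult_ac)
      moreover have "(LINT x:cell j|\<nu>. \<bar>comb v x\<bar> * comb d x) = 0"
        using sumM[of j] d(2)[OF j] False by simp
      moreover have "0 \<le> indicator (cell j) x *\<^sub>R (\<bar>comb v x\<bar> * (\<sigma> * comb d x))" for x
        using pos[of x] by (cases "x \<in> cell j") auto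
      ultimately have "AE x in \<nu>. indicator (cell j) x *\<^sub>R (\<bar>comb v x\<bar> * (\<sigma> * comb d x)) = 0"
        unfolding set_lebesgue_integral_def set_integrable_def
        by (subst integral_nonneg_eq_0_iff_AE[symmetric]) auto
      then have "AE x in \<nu>. indicator (cell j) x *\<^sub>R \<bar>comb v x\<bar> = 0"
      proof (rule eventually_mono)
        fix x assume "indicator (cell j) x *\<^sub>R (\<bar>comb v x\<bar> * (\<sigma> * comb d x)) = 0"
        then show "indicator (cell j) x *\<^sub>R \<bar>comb v x\<bar> = 0"
          using pos[of x] by (cases "x \<in> cell j") auto
      qed
      then have "W j = 0" unfolding W_def set_lebesgue_integral_def by (rule integral_eq_zero_AE)
      then show False using False by simp
    qed
  qed
  define x where "x = (\<lambda>j. SOME x. x \<in> cell j \<and> comb d x = 0)"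
  have x: "x j \<in> cell j" "comb d (x j) = 0" if "j < n - 1" for j
    using someI_ex[of "\<lambda>x. x \<in> cell j \<and> comb d x = 0"] zero_in_cell[OF that] by (auto simp: x_def)
  have "inj_on x {..<n - 1}"
  proof (rule inj_onI)
    fix i j assume "i \<in> {..<n - 1}" "j \<in> {..<n - 1}" "x i = x j"
    then show "i = j" using x(1)[of i] x(1)[of j] by (auto simp: cell_def)
  qed
  then have cX: "card (x ` {..<n - 1}) = n - 1" by (simp add: card_image)
  have "x ` {..<n - 1} \<subseteq> {a..b}" using x(1) cell_sub by blast
  moreover have "comb d y = 0" if "y \<in> x ` {..<n - 1}" for y using that x(2) by auto
  ultimately have "\<exists>s\<in>{1, -1}. \<forall>k\<in>{1..n}. 0 < s * (-1) ^ k * d k"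
    using cX d(1) by (intro comb_alternates) auto
  then obtain s' where s': "s' \<in> {1, -1}" "\<And>k. k \<in> {1..n} \<Longrightarrow> 0 < s' * (-1) ^ k * d k" by blast
  \<comment> \<open>On one cell \<open>comb v\<close> equals its absolute value up to a constant
    sign \<open>\<tau>\<close>, so the weight can be replaced by \<open>comb v\<close> itself. Cells
    of mass 0 contribute nothing anyway.\<close>
  have cell_zero: "(LINT x:cell j|\<nu>. comb d x * comb v x) = 0" if j: "j < n - 1" for j
  proof (cases "W j = 0")
    case True
    from AE0[OF True] have "AE x in \<nu>. indicator (cell j) x *\<^sub>R (comb d x * comb v x) = 0"
      by (rule eventually_mono) auto
    then show ?thesis unfolding set_lebesgue_integral_def by (rule integral_eq_zero_AE)
  next
    case False
    obtain \<tau> :: real where \<tau>: "\<And>x. x \<in> cell j \<Longrightarrow> comb v x = \<tau> * \<bar>comb v x\<bar>"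
    proof (cases "\<forall>x\<in>cell j. comb v x \<ge> 0")
      case True
      then show ?thesis by (intro that[of 1]) auto
    next
      case False
      then have "\<forall>x\<in>cell j. comb v x \<le> 0" using weak_sign[of j] by blast
      then show ?thesis by (intro that[of "-1"]) auto
    qed
    have "(LINT x:cell j|\<nu>. comb d x * comb v x) = (LINT x:cell j|\<nu>. \<tau> * (\<bar>comb v x\<bar> * comb d x))"
    proof (rule set_lebesgue_integral_cong)
      show "cell j \<in> sets \<nu>" by (rule cell_meas)
      show "\<forall>x. x \<in> cell j \<longrightarrow> comb d x * comb v x = \<tau> * (\<bar>comb v x\<bar> * comb d x)"
        using \<tau> by (metis mult.commute mult.left_commute)
    qed
    also have "\<dots> = \<tau> * (LINT x:cell j|\<nu>. \<bar>comb v x\<bar> * comb d x)"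
      by (rule set_integral_mult_right)
    also have "(LINT x:cell j|\<nu>. \<bar>comb v x\<bar> * comb d x) = 0"
      using sumM[of j] d(2)[OF j] False by simp
    finally show ?thesis by simp
  qed
  have ind: "indicator {a..b} x = (\<Sum>j<n - 1. indicator (cell j) x :: real)" for x
  proof (cases "x \<in> {a..b}")
    case True
    have "lev x < n - 1" using lev_le[of x] cZ by linarith
    have "(\<Sum>j<n - 1. indicator (cell j) x :: real) = (\<Sum>j<n - 1. if lev x = j then 1 else 0)"
      using True by (intro sum.cong) (auto simp: cell_def indicator_def)
    then show ?thesis using True \<open>lev x < n - 1\<close> by simp
  next
    case False
    then have "x \<notin> cell j" for j using cell_sub by blast
    then show ?thesis using False by simp
  qed
  have "form d v = (\<integral>x. (\<Sum>j<n - 1. indicator (cell j) x *\<^sub>R (comb d x * comb v x)) \<partial>\<nu>)"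
    unfolding form_def integ_def set_lebesgue_integral_def ind scaleR_left.sum ..
  also have "\<dots> = (\<Sum>j<n - 1. LINT x:cell j|\<nu>. comb d x * comb v x)"
    unfolding set_lebesgue_integral_def
  proof (rule Bochner_Integration.integral_sum)
    fix j
    have "set_integrable \<nu> (cell j) (\<lambda>x. comb d x * comb v x)"
      by (intro integrable_cell continuous_intros comb_continuous)
    then show "integrable \<nu> (\<lambda>x. indicat_real (cell j) x *\<^sub>R (comb d x * comb v x))"
      by (simp add: set_integrable_def)
  qed
  also have "\<dots> = 0" using cell_zero by simp
  finally have "(\<Sum>k=1..n. d k * mom v k) = 0" by (simp add: form_eq)
  \<comment> \<open>Strictly alternating \<open>d\<close> against weakly alternating, non-zero
    moments: up to the common sign \<open>s' * s\<close> no term is negative and one is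
    positive.\<close>
  moreover have "s' * s * (\<Sum>k=1..n. d k * mom v k) > 0"
  proof -
    obtain k where k: "k \<in> {1..n}" "mom v k \<noteq> 0" using nz by blast
    have e: "s' * s * (d k * mom v k) = (s' * (-1) ^ k * d k) * (s * (-1) ^ k * mom v k)" for k
      by (cases "even k") simp_all
    have "s * (-1) ^ k * mom v k \<noteq> 0" using k(2) s by (cases "even k") auto
    then have "0 < s * (-1) ^ k * mom v k" using weak[OF k(1)] by linarith
    then have "0 < (s' * (-1) ^ k * d k) * (s * (-1) ^ k * mom v k)"
      using s'(2)[OF k(1)] by (rule mult_pos_pos[rotated])
    then have "0 < (\<Sum>k=1..n. (s' * (-1) ^ k * d k) * (s * (-1) ^ k * mom v k))"
    proof (intro sum_pos2[of _ k])
      fix k assume "k \<in> {1..n}"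
      then show "0 \<le> (s' * (-1) ^ k * d k) * (s * (-1) ^ k * mom v k)"
        by (intro mult_nonneg_nonneg[OF less_imp_le[OF s'(2)] weak])
    qed (use k(1) in simp_all)
    then show ?thesis unfolding sum_distrib_left e .
  qed
  ultimately show False by simp
qed

section \<open>The least eigenvalue of the Gram matrix and its eigenvector\<close>

lemma form_add: "form (\<lambda>k. u k + v k) w = form u w + form v w"
  by (simp add: form_eq distrib_right sum.distrib)

lemma form_scale: "form (\<lambda>k. c * u k) w = c * form u w"
  by (simp add: form_eq sum_distrib_left mult.assoc)

lemma mom_add: "k \<in> {1..n} \<Longrightarrow> mom (\<lambda>k. u k + v k) k = mom u k + mom v k"
  by (simp only: mom_eq distrib_left sum.distrib)

lemma mom_scale: "k \<in> {1..n} \<Longrightarrow> mom (\<lambda>k. c * u k) k = c * mom u k"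
  by (simp only: mom_eq sum_distrib_left mult.left_commute)

text \<open>The zeros of \<open>comb v\<close> make \<open>v\<close> alternate strictly up to a
  global sign. Positive definiteness fixes that sign, because \<open>v\<close> must pair positively
  with \<open>mom v\<close>. In other words, the inverse Gram matrix is entrywise positive after
  conjugation by the signs \<open>(-1) ^ k\<close>.\<close>

lemma inverse_alternates:
  assumes weak: "\<And>k. k \<in> {1..n} \<Longrightarrow> 0 \<le> (-1) ^ k * mom v k"
    and nz: "\<exists>k\<in>{1..n}. mom v k \<noteq> 0" and k: "k \<in> {1..n}"
  shows "0 < (-1) ^ k * v k"
proof -
  obtain X where X: "X \<subseteq> {a<..<b}" "finite X" "card X = n - 1" "\<And>x. x \<in> X \<Longrightarrow> comb v x = 0"
    using zeros_if_weakly_alternating[of 1 v] weak nz by auto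
  have "X \<subseteq> {a..b}" using X(1) by auto
  note vnz = nonzero_if_mom_nonzero[OF nz]
  obtain s where s: "s \<in> {1, -1}" "\<And>k. k \<in> {1..n} \<Longrightarrow> 0 < s * (-1) ^ k * v k"
    using comb_alternates[OF X(2) \<open>X \<subseteq> {a..b}\<close> X(3,4) vnz] by blast
  have "s = 1"
  proof (rule ccontr)
    assume "s \<noteq> 1"
    then have neg: "(-1) ^ k * v k \<le> 0" if "k \<in> {1..n}" for k using s that by force
    have "v k * mom v k \<le> 0" if "k \<in> {1..n}" for k
    proof -
      have "((-1) ^ k * v k) * ((-1) ^ k * mom v k) \<le> 0"
        using neg[OF that] weak[OF that] by (rule mult_nonpos_nonneg)
      then show ?thesis by (cases "even k") auto
    qed
    then have "form v v \<le> 0" unfolding form_eq by (rule sum_nonpos)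
    then show False using form_pos[OF vnz] by simp
  qed
  then show ?thesis using s(2)[OF k] by simp
qed

lemma mom_surj: "\<exists>v. \<forall>k\<in>{1..n}. mom v k = q k"
proof -
  have "\<exists>v. \<forall>k\<in>{1..n}. (\<Sum>l=1..n. integ (\<lambda>x. K x (t l) * K x (t k)) * v l) = q k"
  proof (rule solvable_if_injective)
    fix c assume "\<forall>k\<in>{1..n}. (\<Sum>l=1..n. integ (\<lambda>x. K x (t l) * K x (t k)) * c l) = 0"
    then have "mom c k = 0" if "k \<in> {1..n}" for k using that mom_eq[OF that, of c] by simp
    then have "form c c = 0" by (simp add: form_eq)
    then show "\<forall>k\<in>{1..n}. c k = 0" using form_pos[of c] by force
  qed simp
  then show ?thesis using mom_eq by simp
qed

definition minimizer :: "(nat \<Rightarrow> real) \<Rightarrow> bool" where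
  "minimizer w \<longleftrightarrow> (\<Sum>k=1..n. (w k)\<^sup>2) = 1 \<and>
     (\<forall>c. (\<Sum>k=1..n. (c k)\<^sup>2) = 1 \<longrightarrow> form w w \<le> form c c)"

lemma minimizer_nonzero: "minimizer w \<Longrightarrow> \<exists>k\<in>{1..n}. w k \<noteq> 0"
  by (rule ccontr) (auto simp: minimizer_def)

lemma minimizer_bound:
  assumes "minimizer w"
  shows "form w w * (\<Sum>k=1..n. (c k)\<^sup>2) \<le> form c c"
proof (cases "\<exists>k\<in>{1..n}. c k \<noteq> 0")
  case True
  define N where "N = (\<Sum>k=1..n. (c k)\<^sup>2)"
  have N: "N > 0" unfolding N_def using True by (auto intro: sum_pos2)
  define e where "e = (\<lambda>k. (1 / sqrt N) * c k)"
  have "(\<Sum>k=1..n. (e k)\<^sup>2) = 1"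
    using N unfolding e_def N_def by (rule sum_squares_normalized)
  then have "form w w \<le> form e e" using assms by (auto simp: minimizer_def)
  also have "form e e = (1 / sqrt N) * ((1 / sqrt N) * form c c)"
    unfolding e_def by (subst form_scale, subst form_commute, subst form_scale) simp
  also have "\<dots> = form c c / N" using N by (simp add: field_simps)
  finally show ?thesis using N by (simp add: field_simps N_def)
next
  case False
  then show ?thesis by (simp add: form_eq)
qed

text \<open>First variation: perturbing \<open>w\<close> along the unit vector \<open>e\<close> at
  \<open>k\<close> in the Rayleigh inequality leaves
  \<open>2 * s * \<beta> + s\<^sup>2 * \<gamma>\<close> non-negative for every real
  \<open>s\<close>, which forces the linear coefficient to be 0.\<close>

lemma minimizer_eigenvector:
  assumes "minimizer w" "k \<in> {1..n}"
  shows "mom w k = form w w * w k"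
proof -
  define \<mu> where "\<mu> = form w w"
  define e where "e = (\<lambda>j. if j = k then 1 else 0 :: real)"
  define \<beta> where "\<beta> = mom w k - \<mu> * w k"
  define \<gamma> where "\<gamma> = form e e - \<mu>"
  have ek: "(\<Sum>j=1..n. e j * x j) = x k" for x using assms(2) by (simp add: e_def if_distrib if_distribR cong: if_cong)
  have "0 \<le> 2 * s * \<beta> + s\<^sup>2 * \<gamma>" for s
  proof -
    let ?c = "\<lambda>j. w j + s * e j"
    have "form ?c ?c = form w ?c + s * form e ?c" by (simp add: form_add form_scale)
    also have "form w ?c = \<mu> + s * form e w"
      by (subst form_commute) (simp add: form_add form_scale \<mu>_def)
    also have "form e ?c = form e w + s * form e e"
      by (subst form_commute) (simp add: form_add form_scale form_commute[of w e])
    also have "form e w = mom w k" unfolding form_eq by (rule ek)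
    finally have 1: "form ?c ?c = \<mu> + 2 * s * mom w k + s\<^sup>2 * form e e"
      by (simp add: algebra_simps power2_eq_square)
    have "(\<Sum>j=1..n. (?c j)\<^sup>2) = (\<Sum>j=1..n. (w j)\<^sup>2 + 2 * s * (e j * w j) + s\<^sup>2 * (e j * e j))"
      by (intro sum.cong) (auto simp: power2_eq_square algebra_simps)
    also have "\<dots> = (\<Sum>j=1..n. (w j)\<^sup>2) + 2 * s * (\<Sum>j=1..n. e j * w j) + s\<^sup>2 * (\<Sum>j=1..n. e j * e j)"
      by (simp add: sum.distrib sum_distrib_left)
    also have "\<dots> = 1 + 2 * s * w k + s\<^sup>2"
      using assms(1) by (simp only: ek minimizer_def) (simp add: e_def)
    finally have 2: "(\<Sum>j=1..n. (?c j)\<^sup>2) = 1 + 2 * s * w k + s\<^sup>2" .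
    from minimizer_bound[OF assms(1), of ?c, folded \<mu>_def, unfolded 1 2]
    show ?thesis by (simp add: \<beta>_def \<gamma>_def algebra_simps)
  qed
  note q = this
  have "\<beta> = 0"
  proof (rule ccontr)
    assume "\<beta> \<noteq> 0"
    \<comment> \<open>Any positive bound for \<open>\<gamma>\<close> works; the summand 1 makes it
      positive. The choice \<open>s = - \<beta> / r\<close> then gives a negative value.\<close>
    define r where "r = \<bar>\<gamma>\<bar> + 1"
    have r: "r > 0" "\<gamma> \<le> r" by (auto simp: r_def)
    have "0 \<le> 2 * (- \<beta> / r) * \<beta> + (- \<beta> / r)\<^sup>2 * \<gamma>" by (rule q)
    also have "\<dots> \<le> 2 * (- \<beta> / r) * \<beta> + (- \<beta> / r)\<^sup>2 * r" using r by (intro add_left_mono mult_left_mono) auto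
    also have "\<dots> = - (\<beta>\<^sup>2 / r)" using r by (simp add: field_simps power2_eq_square)
    finally show False using \<open>\<beta> \<noteq> 0\<close> r by (simp add: divide_le_0_iff)
  qed
  then show ?thesis by (simp add: \<beta>_def \<mu>_def)
qed

text \<open>Perron's argument for the inverse of the Gram matrix, which preserves alternation: otherwise
  replacing the entries of \<open>w\<close> by \<open>(-1) ^ k * \<bar>w k\<bar>\<close> would raise the quadratic form of the inverse.\<close>

lemma minimizer_alternates:
  assumes w: "minimizer w"
  shows "\<exists>s\<in>{1, -1}. \<forall>k\<in>{1..n}. 0 < s * (-1) ^ k * w k"
proof -
  define \<mu> where "\<mu> = form w w"
  have \<mu>: "\<mu> > 0" unfolding \<mu>_def using minimizer_nonzero[OF w] by (rule form_pos)
  have eig: "mom w k = \<mu> * w k" if "k \<in> {1..n}" for k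
    unfolding \<mu>_def using w that by (rule minimizer_eigenvector)
  have norm1: "(\<Sum>k=1..n. (w k)\<^sup>2) = 1" using w by (simp add: minimizer_def)
  have "\<exists>s\<in>{1, -1}. \<forall>k\<in>{1..n}. 0 \<le> s * (-1) ^ k * w k"
  proof (rule ccontr)
    assume "\<not> ?thesis"
    then obtain i j where i: "i \<in> {1..n}" "(-1) ^ i * w i > 0" and j: "j \<in> {1..n}" "(-1) ^ j * w j < 0"
      by (auto simp: not_le)
    \<comment> \<open>\<open>w\<close> is split along the alternating pattern:
      \<open>q 1 - q (-1)\<close> is \<open>w\<close>, while \<open>q 1 + q (-1)\<close> has entries
      \<open>(-1) ^ k * \<bar>w k\<bar>\<close>. Both parts are weakly alternating, and the indices
      \<open>i\<close> and \<open>j\<close> show that neither is 0. \<open>V s\<close> is the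
      inverse Gram matrix applied to \<open>q s\<close>.\<close>
    define q where "q = (\<lambda>s k. (-1) ^ k * max (s * (-1) ^ k * w k) 0)"
    have "\<exists>V. \<forall>s. \<forall>k\<in>{1..n}. mom (V s) k = q s k" using mom_surj by (intro choice) blast
    then obtain V where V: "mom (V s) k = q s k" if "k \<in> {1..n}" for s k by blast
    have sq: "(-1) ^ k * ((-1) ^ k * x) = x" for k and x :: real by (cases "even k") auto
    have Vpos: "0 < (-1) ^ k * V s k" if s: "s \<in> {1, -1}" and k: "k \<in> {1..n}" for s k
    proof (rule inverse_alternates[OF _ _ k])
      show "0 \<le> (-1) ^ k * mom (V s) k" if "k \<in> {1..n}" for k
        using that by (simp add: V q_def sq)
      show "\<exists>k\<in>{1..n}. mom (V s) k \<noteq> 0"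
      proof (cases "s = 1")
        case True
        then show ?thesis using i by (intro bexI[of _ i]) (auto simp: V q_def max_def)
      next
        case False
        then show ?thesis using j s by (intro bexI[of _ j]) (auto simp: V q_def max_def)
      qed
    qed
    have wq: "w k = q 1 k - q (-1) k" for k by (cases "even k") (auto simp: q_def max_def)
    have qw: "(q 1 k + q (-1) k)\<^sup>2 = (w k)\<^sup>2" for k by (cases "even k") (auto simp: q_def max_def)
    let ?v = "\<lambda>k. V 1 k + V (-1) k"
    let ?q = "\<lambda>k. q 1 k + q (-1) k"
    \<comment> \<open>Symmetry of the Gram matrix and the eigenvalue equation for
      \<open>w\<close>.\<close>
    have V_w: "\<mu> * (\<Sum>k=1..n. V s k * w k) = (\<Sum>k=1..n. q s k * w k)" for s
    proof -
      have "\<mu> * (\<Sum>k=1..n. V s k * w k) = form (V s) w"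
        by (simp add: form_eq eig sum_distrib_left mult_ac)
      also have "\<dots> = form w (V s)" by (rule form_commute)
      also have "\<dots> = (\<Sum>k=1..n. q s k * w k)" by (simp add: form_eq V mult.commute)
      finally show ?thesis .
    qed
    have "\<mu> * (\<Sum>k=1..n. (V 1 k - V (-1) k) * w k) = (\<Sum>k=1..n. q 1 k * w k) - (\<Sum>k=1..n. q (-1) k * w k)"
      by (simp only: left_diff_distrib sum_subtractf right_diff_distrib V_w)
    also have "\<dots> = (\<Sum>k=1..n. (w k)\<^sup>2)"
      unfolding sum_subtractf[symmetric] left_diff_distrib[symmetric] wq[symmetric] by (simp only: power2_eq_square)
    finally have "\<mu> * (\<Sum>k=1..n. (V 1 k - V (-1) k) * w k) = (\<Sum>k=1..n. (w k)\<^sup>2)" .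
    then have lower: "\<mu> * (\<Sum>k=1..n. (V 1 k - V (-1) k) * w k) = 1" unfolding norm1 .
    \<comment> \<open>Passing from \<open>w\<close> to its alternating version turns the sign of the
      cross terms between \<open>V 1\<close>, \<open>q (-1)\<close> and \<open>V (-1)\<close>,
      \<open>q 1\<close>; these are non-negative, and positive at \<open>i\<close>.\<close>
    have "(\<Sum>k=1..n. (V 1 k - V (-1) k) * w k) < (\<Sum>k=1..n. ?v k * ?q k)"
    proof (rule sum_strict_mono_ex1)
      have diff: "?v k * ?q k - (V 1 k - V (-1) k) * w k
          = 2 * ((-1) ^ k * V 1 k) * ((-1) ^ k * q (-1) k) + 2 * ((-1) ^ k * V (-1) k) * ((-1) ^ k * q 1 k)" for k
        unfolding wq[of k] by (cases "even k") (auto simp: algebra_simps)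
      have nonneg: "0 \<le> (-1) ^ k * q s k" for s k by (simp add: q_def sq)
      have Vp: "0 < (-1) ^ k * V 1 k" "0 < (-1) ^ k * V (-1) k" if "k \<in> {1..n}" for k
        using Vpos[of 1 k] Vpos[of "-1" k] that by auto
      show "\<forall>k\<in>{1..n}. (V 1 k - V (-1) k) * w k \<le> ?v k * ?q k"
      proof
        fix k assume k: "k \<in> {1..n}"
        have "0 \<le> ((-1) ^ k * V 1 k) * ((-1) ^ k * q (-1) k)" "0 \<le> ((-1) ^ k * V (-1) k) * ((-1) ^ k * q 1 k)"
          by (rule mult_nonneg_nonneg[OF less_imp_le[OF Vp(1)[OF k]] nonneg] mult_nonneg_nonneg[OF less_imp_le[OF Vp(2)[OF k]] nonneg])+
        then show "(V 1 k - V (-1) k) * w k \<le> ?v k * ?q k" using diff[of k] by linarith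
      qed
      have "0 < (-1) ^ i * q 1 i" using i(2) by (simp add: q_def sq)
      then have "0 < ((-1) ^ i * V (-1) i) * ((-1) ^ i * q 1 i)"
        by (rule mult_pos_pos[OF Vp(2)[OF i(1)]])
      moreover have "0 \<le> ((-1) ^ i * V 1 i) * ((-1) ^ i * q (-1) i)"
        by (rule mult_nonneg_nonneg[OF less_imp_le[OF Vp(1)[OF i(1)]] nonneg])
      ultimately have "(V 1 i - V (-1) i) * w i < ?v i * ?q i" using diff[of i] by linarith
      then show "\<exists>k\<in>{1..n}. (V 1 k - V (-1) k) * w k < ?v k * ?q k" using i(1) by blast
    qed simp
    from mult_strict_left_mono[OF this \<mu>] have "1 < \<mu> * (\<Sum>k=1..n. ?v k * ?q k)"
      unfolding lower .
    \<comment> \<open>The inverse form is at most \<open>1 / \<mu>\<close> on unit vectors: with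
      \<open>P\<close> its value at \<open>?q\<close> and \<open>N\<close> the squared length of
      \<open>?v\<close>, the Rayleigh bound gives \<open>\<mu> * N \<le> P\<close> and
      Cauchy-Schwarz gives \<open>P\<^sup>2 \<le> N\<close>.\<close>
    moreover have "\<mu> * (\<Sum>k=1..n. ?v k * ?q k) \<le> 1"
    proof -
      define P where "P = (\<Sum>k=1..n. ?v k * ?q k)"
      define N where "N = (\<Sum>k=1..n. (?v k)\<^sup>2)"
      have "form ?v ?v = (\<Sum>k=1..n. ?v k * mom ?v k)" by (rule form_eq)
      also have "\<dots> = P"
        unfolding P_def by (intro sum.cong refl) (simp only: mom_add V)
      finally have "\<mu> * N \<le> P" using minimizer_bound[OF w, of ?v] by (simp add: \<mu>_def N_def)
      have "P\<^sup>2 \<le> N * (\<Sum>k=1..n. (?q k)\<^sup>2)" unfolding P_def N_def by (rule Cauchy_Schwarz_ineq_sum)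
      then have "P\<^sup>2 \<le> N" unfolding qw norm1 by simp
      then have "\<mu> * P\<^sup>2 \<le> P" using \<open>\<mu> * N \<le> P\<close> \<mu> by (meson mult_left_mono order.trans less_imp_le)
      show ?thesis
      proof (rule ccontr)
        assume "\<not> ?thesis"
        then have "\<mu> * P > 1" by (simp add: P_def)
        then have "P > 0" using zero_less_mult_pos[of \<mu> P] \<mu> by linarith
        then have "P * 1 < P * (\<mu> * P)" using \<open>\<mu> * P > 1\<close> by (intro mult_strict_left_mono)
        then show False using \<open>\<mu> * P\<^sup>2 \<le> P\<close> by (simp add: power2_eq_square mult_ac)
      qed
    qed
    ultimately show False by simp
  qed
  then obtain s where s: "s \<in> {1, -1}" "\<And>k. k \<in> {1..n} \<Longrightarrow> 0 \<le> s * (-1) ^ k * w k" by blast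
  \<comment> \<open>A weakly alternating eigenvector is strictly alternating, since it is a positive
    multiple of the image of itself under the inverse.\<close>
  have sw: "mom (\<lambda>k. s * w k) k = \<mu> * (s * w k)" if "k \<in> {1..n}" for k
    by (simp only: mom_scale[OF that] eig[OF that] mult.left_commute)
  have "0 < (-1) ^ k * (s * w k)" if "k \<in> {1..n}" for k
  proof (rule inverse_alternates[OF _ _ that])
    show "0 \<le> (-1) ^ k * mom (\<lambda>k. s * w k) k" if "k \<in> {1..n}" for k
      using mult_nonneg_nonneg[OF less_imp_le[OF \<mu>] s(2)[OF that]] by (simp add: sw[OF that] mult_ac)
    show "\<exists>k\<in>{1..n}. mom (\<lambda>k. s * w k) k \<noteq> 0"
      using minimizer_nonzero[OF w] \<mu> s(1) by (auto simp: sw)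
  qed
  then show ?thesis using s(1) by (intro bexI[of _ s]) (auto simp: mult_ac)
qed

lemma minimizer_zeros:
  assumes w: "minimizer w"
  shows "\<exists>X\<subseteq>{a<..<b}. finite X \<and> card X = n - 1 \<and> (\<forall>x\<in>X. comb w x = 0)"
proof -
  obtain s where s: "s \<in> {1, -1}" "\<And>k. k \<in> {1..n} \<Longrightarrow> 0 < s * (-1) ^ k * w k"
    using minimizer_alternates[OF w] by blast
  have \<mu>: "form w w > 0" using minimizer_nonzero[OF w] by (rule form_pos)
  have "0 < s * (-1) ^ k * mom w k" if "k \<in> {1..n}" for k
    using mult_pos_pos[OF \<mu> s(2)[OF that]] by (simp add: minimizer_eigenvector[OF w that] mult_ac)
  then show ?thesis
    using zeros_if_weakly_alternating[OF s(1), of w] n by (force intro: less_imp_le)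
qed

text \<open>All minimizers are eigenvectors for the same eigenvalue. The combination of two of them
  whose first entry is 0 would, if non-zero, be a minimizer after normalization, but alternation
  leaves no entry 0.\<close>

lemma minimizer_unique:
  assumes w: "minimizer w" "0 < w 1" and w': "minimizer w'" "0 < w' 1" and k: "k \<in> {1..n}"
  shows "w k = w' k"
proof -
  define c where "c = w 1 / w' 1"
  have c: "c > 0" using w w' by (simp add: c_def)
  define u where "u = (\<lambda>k. w k - c * w' k)"
  have \<mu>: "form w w = form w' w'"
    using w(1) w'(1) unfolding minimizer_def by (meson antisym)
  have mu: "mom u k = form w w * u k" if "k \<in> {1..n}" for k
    using mom_add[OF that, of w "\<lambda>k. - c * w' k"] mom_scale[OF that, of "- c" w'] \<mu>
      minimizer_eigenvector[OF w(1) that] minimizer_eigenvector[OF w'(1) that]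
    by (simp add: u_def algebra_simps)
  have u0: "u k = 0" if "k \<in> {1..n}" for k
  proof (rule ccontr)
    assume "u k \<noteq> 0"
    define N where "N = (\<Sum>k=1..n. (u k)\<^sup>2)"
    have N: "N > 0" unfolding N_def using \<open>u k \<noteq> 0\<close> that by (intro sum_pos2[of _ k]) auto
    define e where "e = (\<lambda>k. (1 / sqrt N) * u k)"
    have e1: "(\<Sum>k=1..n. (e k)\<^sup>2) = 1"
      using N unfolding e_def N_def by (rule sum_squares_normalized)
    have "form u u = form w w * N"
      by (simp add: form_eq[of u] mu N_def sum_distrib_left power2_eq_square mult_ac)
    moreover have "form e e = (1 / sqrt N) * ((1 / sqrt N) * form u u)"
      unfolding e_def by (subst form_scale, subst form_commute, subst form_scale) simp
    ultimately have "form e e = form w w" using N by (simp add: field_simps)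
    then have "minimizer e" using e1 w(1) by (simp add: minimizer_def)
    from minimizer_alternates[OF this] obtain s where "0 < s * (-1) ^ 1 * e 1" using n by force
    moreover have "u 1 = 0" using w'(2) by (simp add: u_def c_def)
    ultimately show False by (simp add: e_def)
  qed
  then have wc: "w k = c * w' k" if "k \<in> {1..n}" for k using that by (simp add: u_def)
  have "1 = (\<Sum>k=1..n. (w k)\<^sup>2)" using w(1) by (simp add: minimizer_def)
  also have "\<dots> = c\<^sup>2 * (\<Sum>k=1..n. (w' k)\<^sup>2)" by (simp add: wc power_mult_distrib sum_distrib_left)
  also have "\<dots> = c\<^sup>2" using w'(1) by (simp add: minimizer_def)
  finally have "c = 1" using c by (metis less_imp_le power2_eq_1_iff not_one_le_zero neg_0_le_iff_le le_minus_one_simps(1) order.trans)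
  then show ?thesis using wc[OF k] by simp
qed

lemma minimizer_exists: "\<exists>w. minimizer w"
proof -
  \<comment> \<open>Coordinates outside \<open>{1..n}\<close> are pinned to 0, so that the cube is
    compact in the product topology on all functions; weights are later compared only through their
    entries in \<open>{1..n}\<close>.\<close>
  define C where "C = (PiE UNIV (\<lambda>k. if k \<in> {1..n} then {-1..1} else {0}) :: (nat \<Rightarrow> real) set)"
  define S where "S = C \<inter> {c. (\<Sum>k=1..n. (c k)\<^sup>2) = 1}"
  have "compactin (product_topology (\<lambda>i. euclidean) UNIV) C"
    unfolding C_def compactin_PiE by auto
  then have "compact C" by (simp add: euclidean_product_topology)
  moreover have "closed {c :: nat \<Rightarrow> real. (\<Sum>k=1..n. (c k)\<^sup>2) = 1}"
    by (intro closed_Collect_eq continuous_intros continuous_on_product_coordinates)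
  ultimately have "compact S" unfolding S_def by (rule compact_Int_closed)
  moreover have "S \<noteq> {}"
  proof -
    have "(\<lambda>k. if k = 1 then 1 else 0) \<in> S"
      using n by (auto simp: S_def C_def if_distrib[of "\<lambda>x. x\<^sup>2"] cong: if_cong)
    then show ?thesis by blast
  qed
  moreover have "continuous_on S (\<lambda>c. form c c)"
  proof -
    have "form c c = (\<Sum>k=1..n. c k * (\<Sum>l=1..n. integ (\<lambda>x. K x (t l) * K x (t k)) * c l))" for c
      unfolding form_eq by (intro sum.cong refl) (simp add: mom_eq)
    then have "(\<lambda>c. form c c) = (\<lambda>c. \<Sum>k=1..n. c k * (\<Sum>l=1..n. integ (\<lambda>x. K x (t l) * K x (t k)) * c l))"
      by (rule ext)
    moreover have "continuous_on UNIV (\<lambda>c. \<Sum>k=1..n. c k * (\<Sum>l=1..n. integ (\<lambda>x. K x (t l) * K x (t k)) * c l))"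
      by (intro continuous_intros continuous_on_product_coordinates)
    ultimately show ?thesis using continuous_on_subset by (metis top_greatest)
  qed
  ultimately obtain w where w: "w \<in> S" "\<And>c. c \<in> S \<Longrightarrow> form w w \<le> form c c"
    using continuous_attains_inf[of S "\<lambda>c. form c c"] by blast
  have "form w w \<le> form c c" if c: "(\<Sum>k=1..n. (c k)\<^sup>2) = 1" for c
  proof -
    define c' where "c' = (\<lambda>k. if k \<in> {1..n} then c k else 0)"
    have "\<bar>c k\<bar> \<le> 1" if "k \<in> {1..n}" for k
    proof -
      have "(c k)\<^sup>2 \<le> (\<Sum>k=1..n. (c k)\<^sup>2)" using that by (intro member_le_sum) auto
      then show ?thesis using c by (simp add: abs_square_le_1)
    qed
    then have "c' \<in> C" by (auto simp: C_def c'_def abs_le_iff)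
    moreover have "(\<Sum>k=1..n. (c' k)\<^sup>2) = 1" using c by (simp add: c'_def)
    ultimately have "c' \<in> S" by (simp add: S_def)
    then have "form w w \<le> form c' c'" by (rule w)
    moreover have "comb c' = comb c" by (rule ext) (simp add: comb_def c'_def)
    ultimately show ?thesis by (simp add: form_def)
  qed
  then show ?thesis using w(1) by (auto simp: minimizer_def S_def)
qed

end

section \<open>Loewner kernels of analytic functions\<close>

text \<open>The node comes first, so that partial application is the difference quotient as a
  function of the variable, with its removable singularity filled.\<close>

definition complex_loewner :: "(complex \<Rightarrow> complex) \<Rightarrow> complex \<Rightarrow> complex \<Rightarrow> complex" where
  "complex_loewner F w z = (if z = w then deriv F w else (F z - F w) / (z - w))"

lemma holomorphic_complex_loewner:
  "F holomorphic_on S \<Longrightarrow> open S \<Longrightarrow> complex_loewner F w holomorphic_on S"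
  using pole_lemma_open[of F S w] unfolding complex_loewner_def[abs_def] .

lemma complex_loewner_mult: "(z - w) * complex_loewner F w z = F z - F w"
  by (simp add: complex_loewner_def)

text \<open>The zeros are removed one at a time: where \<open>h w = 0\<close>, the difference
  quotient of \<open>h\<close> at \<open>w\<close> is holomorphic and equals \<open>h\<close>
  divided by the linear factor.\<close>

lemma divide_out_zeros:
  assumes "finite Z" "open S" "g holomorphic_on S" "Z \<subseteq> S" "\<And>z. z \<in> Z \<Longrightarrow> g z = 0"
  shows "\<exists>h. h holomorphic_on S \<and> (\<forall>z\<in>S. g z = h z * (\<Prod>w\<in>Z. z - w))"
  using assms(1,4,5)
proof (induction Z rule: finite_induct)
  case empty
  then show ?case using assms(3) by auto
next
  case (insert w Z)
  then obtain h where h: "h holomorphic_on S" "\<And>z. z \<in> S \<Longrightarrow> g z = h z * (\<Prod>w\<in>Z. z - w)" by auto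
  have "(\<Prod>v\<in>Z. w - v) \<noteq> 0" using insert.hyps by auto
  then have "h w = 0" using h(2)[of w] insert.prems by auto
  then have "h z = complex_loewner h w z * (z - w)" for z
    using complex_loewner_mult[of z w h] by (simp add: mult.commute)
  then have "g z = complex_loewner h w z * (\<Prod>w\<in>insert w Z. z - w)" if "z \<in> S" for z
    using h(2)[OF that] insert.hyps by (metis mult.assoc prod.insert)
  then show ?case using holomorphic_complex_loewner[OF h(1) assms(2)] by blast
qed

lemma finite_set_strict_mono_enumeration:
  fixes X :: "'a::linorder set"
  assumes "finite X" "card X = m"
  shows "\<exists>e. strict_mono_on {1..m} e \<and> bij_betw e {1..m} X"
proof -
  let ?l = "sorted_list_of_set X"
  define e where "e = (\<lambda>k. ?l ! (k - 1))"
  have len: "length ?l = m" using assms by simp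
  have "strict_mono_on {1..m} e"
  proof (rule strict_mono_onI)
    fix i j assume "i \<in> {1..m}" "j \<in> {1..m}" "i < j"
    then show "e i < e j"
      using sorted_wrt_nth_less[OF strict_sorted_list_of_set, of "i - 1" "j - 1" X] len
      by (auto simp: e_def)
  qed
  moreover have "e ` {1..m} = X"
  proof -
    have "e ` {1..m} = (\<lambda>i. ?l ! i) ` (\<lambda>k. k - 1) ` {1..m}" by (simp add: e_def image_image)
    also have "(\<lambda>k. k - 1) ` {1..m} = {..<m}"
    proof
      show "{..<m} \<subseteq> (\<lambda>k. k - 1) ` {1..m}"
      proof
        fix i assume "i \<in> {..<m}"
        then show "i \<in> (\<lambda>k. k - 1) ` {1..m}" by (intro image_eqI[of _ _ "Suc i"]) auto
      qed
    qed auto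
    also have "(\<lambda>i. ?l ! i) ` {..<m} = set ?l" using len by (auto simp: set_conv_nth)
    finally show ?thesis using assms by simp
  qed
  ultimately show ?thesis using strict_mono_on_imp_inj_on by (metis bij_betw_def)
qed

locale real_analytic_function =
  fixes a b :: real and S :: "complex set" and F :: "complex \<Rightarrow> complex"
  assumes ab: "a < b" and S_open: "open S" and holo: "F holomorphic_on S"
    and S_sup: "complex_of_real ` {a..b} \<subseteq> S"
    and real: "complex_of_real x \<in> S \<Longrightarrow> Im (F (of_real x)) = 0"
begin

abbreviation f :: "real \<Rightarrow> real" where
  "f \<equiv> \<lambda>x. Re (F (complex_of_real x))"

lemma S_mem: "x \<in> {a..b} \<Longrightarrow> complex_of_real x \<in> S"
  using S_sup by blast

lemma F_of_real: "x \<in> {a..b} \<Longrightarrow> F (of_real x) = of_real (f x)"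
  using real[OF S_mem] by (simp add: complex_eq_iff)

text \<open>The complex derivative may be taken along the real axis, where the imaginary part of
  \<open>F\<close> vanishes near \<open>x\<close> because \<open>S\<close> is open.\<close>

lemma deriv_of_real:
  assumes "x \<in> {a..b}"
  shows "deriv F (of_real x) = of_real (deriv f x)"
proof -
  have xS: "of_real x \<in> S" using assms S_sup by blast
  have "(F has_field_derivative deriv F (of_real x)) (at (of_real x))"
    using holo S_open xS by (rule holomorphic_derivI)
  then have v: "((\<lambda>x. F (of_real x)) has_vector_derivative deriv F (of_real x)) (at x)"
    by (rule has_vector_derivative_real_field)
  have re: "(f has_real_derivative Re (deriv F (of_real x))) (at x)"
    using v by (simp add: has_vector_derivative_complex_iff has_real_derivative_iff_has_vector_derivative)
  have im: "((\<lambda>x. Im (F (of_real x))) has_real_derivative Im (deriv F (of_real x))) (at x)"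
    using v by (simp add: has_vector_derivative_complex_iff has_real_derivative_iff_has_vector_derivative)
  have "open (complex_of_real -` S)" using S_open by (intro open_vimage continuous_intros)
  then have "eventually (\<lambda>y. y \<in> complex_of_real -` S) (nhds x)"
    using xS by (intro eventually_nhds_in_open) auto
  then have "eventually (\<lambda>y. Im (F (of_real y)) = 0) (nhds x)"
    by (rule eventually_mono) (simp add: real)
  then have "((\<lambda>y. 0) has_real_derivative Im (deriv F (of_real x))) (at x)"
    using im DERIV_cong_ev[OF refl _ refl, of "\<lambda>y. Im (F (complex_of_real y))" "\<lambda>y. 0"] by simp
  then have "Im (deriv F (of_real x)) = 0" using DERIV_const DERIV_unique by blast
  then show ?thesis using DERIV_imp_deriv[OF re] by (simp add: complex_eq_iff)
qed

lemma complex_loewner_of_real: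
  assumes "x \<in> {a..b}" "y \<in> {a..b}"
  shows "complex_loewner F (of_real y) (of_real x) = of_real (loewner_kernel f x y)"
proof -
  have "F (of_real x) - F (of_real y) = of_real (f x - f y)"
    using real[OF S_mem[OF assms(1)]] real[OF S_mem[OF assms(2)]] by (simp add: complex_eq_iff)
  then show ?thesis
    by (simp add: complex_loewner_def loewner_kernel_def deriv_of_real[OF assms(2)])
qed

lemma unisolvent_loewnerI:
  assumes "\<And>X Y c y. \<lbrakk>finite X; finite Y; X \<subseteq> {a..b}; Y \<subseteq> {a..b}; card X = card Y;
      \<And>x. x \<in> X \<Longrightarrow> (\<Sum>y\<in>Y. c y * loewner_kernel f x y) = 0; y \<in> Y\<rbrakk> \<Longrightarrow> c y = 0"
  shows "unisolvent_kernel a b (loewner_kernel f)"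
proof
  show "a < b" by (rule ab)
  show "loewner_kernel f x y = loewner_kernel f y x" for x y
    by (auto simp: loewner_kernel_def) (metis minus_diff_eq minus_divide_divide)
  show "continuous_on {a..b} (\<lambda>x. loewner_kernel f x y)" if y: "y \<in> {a..b}" for y
  proof -
    have "continuous_on S (complex_loewner F (of_real y))"
      by (intro holomorphic_on_imp_continuous_on holomorphic_complex_loewner holo S_open)
    then have "continuous_on {a..b} (\<lambda>x. Re (complex_loewner F (of_real y) (of_real x)))"
      by (rule continuous_on_Re[OF continuous_on_compose2[OF _ _ S_sup]]) (intro continuous_intros)
    then show ?thesis by (rule continuous_on_eq) (simp only: complex_loewner_of_real[OF _ y] Re_complex_of_real)
  qed
qed (use assms in blast)

end

locale aaa_analytic = real_analytic_function + aaa_problem a b "loewner_kernel (\<lambda>x. Re (F (complex_of_real x)))"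
begin

text \<open>No entry of a minimizer is 0, so the first non-zero weight is always the first
  one.\<close>

lemma aaa_weights_iff:
  "aaa_weights a b f n \<nu> t w \<longleftrightarrow> w \<in> extensional {1..n} \<and> minimizer w \<and> w 1 > 0"
proof -
  have obj: "aaa_objective a b f n \<nu> t c = form c c" for c
    by (simp add: aaa_objective_def form_def integ_def comb_def power2_eq_square)
  have "(\<forall>k\<in>{1..n}. w k \<noteq> 0 \<and> (\<forall>j\<in>{1..<k}. w j = 0) \<longrightarrow> w k > 0) \<longleftrightarrow> w 1 > 0" if "minimizer w"
  proof
    have "w 1 \<noteq> 0" using minimizer_alternates[OF that] n by force
    then show "w 1 > 0" if "\<forall>k\<in>{1..n}. w k \<noteq> 0 \<and> (\<forall>j\<in>{1..<k}. w j = 0) \<longrightarrow> w k > 0"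
      using that n by (auto dest: bspec[of _ _ 1])
    show "\<forall>k\<in>{1..n}. w k \<noteq> 0 \<and> (\<forall>j\<in>{1..<k}. w j = 0) \<longrightarrow> w k > 0" if "w 1 > 0"
    proof (intro ballI impI)
      fix k assume "k \<in> {1..n}" "w k \<noteq> 0 \<and> (\<forall>j\<in>{1..<k}. w j = 0)"
      then have "k = 1" using that by (cases "k = 1") (auto dest: bspec[of _ _ 1])
      then show "w k > 0" using that by simp
    qed
  qed
  then show ?thesis unfolding aaa_weights_def obj minimizer_def by blast
qed

lemma aaa_weights_exist: "\<exists>w. aaa_weights a b f n \<nu> t w"
proof -
  obtain w where w: "minimizer w" using minimizer_exists by blast
  obtain s where s: "s \<in> {1, -1}" "\<And>k. k \<in> {1..n} \<Longrightarrow> 0 < s * (-1) ^ k * w k"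
    using minimizer_alternates[OF w] by blast
  \<comment> \<open>The sign \<open>- s\<close> makes the entry at 1 positive, since
    \<open>(-1) ^ 1\<close> is negative.\<close>
  define u where "u = restrict (\<lambda>k. - s * w k) {1..n}"
  have u: "form u v = - s * form w v" for v
  proof -
    have "form u v = form (\<lambda>k. - s * w k) v" unfolding form_eq u_def by (intro sum.cong) simp_all
    then show ?thesis by (simp only: form_scale)
  qed
  have "form u u = - s * (- s * form w w)"
    unfolding u form_commute[of w u] by simp
  then have "form u u = form w w" using s(1) by auto
  moreover have "(\<Sum>k=1..n. (u k)\<^sup>2) = (\<Sum>k=1..n. (w k)\<^sup>2)"
    using s(1) by (intro sum.cong) (auto simp: u_def)
  ultimately have "minimizer u" using w by (simp add: minimizer_def)
  moreover have "u 1 > 0" using s(2)[of 1] n by (simp add: u_def)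
  moreover have "u \<in> extensional {1..n}" by (simp add: u_def)
  ultimately show ?thesis unfolding aaa_weights_iff by blast
qed

lemma aaa_weights_unique:
  assumes "aaa_weights a b f n \<nu> t w" "aaa_weights a b f n \<nu> t w'"
  shows "w = w'"
  using assms unfolding aaa_weights_iff
  by (intro extensionalityI[of w "{1..n}" w'] minimizer_unique[of w w']) simp_all

lemma barycentric_eq:
  assumes "z \<notin> complex_of_real ` t ` {1..n}"
  shows "barycentric f n t w z = aaa_Q F n t w z / aaa_P n t w z"
proof -
  define N where "N = (\<Prod>i\<in>{1..n}. z - of_real (t i))"
  have "N \<noteq> 0" using assms by (auto simp: N_def)
  have L: "node_poly n t k z = N / (z - of_real (t k))" if "k \<in> {1..n}" for k
  proof -
    have "N = (z - of_real (t k)) * node_poly n t k z"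
      unfolding N_def node_poly_def using that by (subst prod.remove[of _ k]) auto
    then show ?thesis using \<open>N \<noteq> 0\<close> by auto
  qed
  have "aaa_P n t w z = N * (\<Sum>k=1..n. of_real (w k) / (z - of_real (t k)))"
    unfolding aaa_P_def sum_distrib_left by (intro sum.cong refl) (simp add: L)
  moreover have "aaa_Q F n t w z = N * (\<Sum>k=1..n. of_real (w k * f (t k)) / (z - of_real (t k)))"
    unfolding aaa_Q_def sum_distrib_left
  proof (intro sum.cong refl)
    fix k assume k: "k \<in> {1..n}"
    show "of_real (w k) * F (of_real (t k)) * node_poly n t k z
        = N * (of_real (w k * f (t k)) / (z - of_real (t k)))"
      by (subst F_of_real[OF t_mem[OF k]]) (simp add: L[OF k])
  qed
  ultimately show ?thesis using \<open>N \<noteq> 0\<close> by (simp add: barycentric_def)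
qed

text \<open>Clearing denominators in the weighted sum of difference quotients gives
  \<open>P F - Q\<close>. The nodes \<open>t k\<close> are therefore divided out by the analytic
  kernel itself, and the zeros of \<open>comb w\<close> supply the remaining \<open>n - 1\<close>
  linear factors.\<close>

lemma interpolation:
  assumes w: "aaa_weights a b f n \<nu> t w"
  shows "\<exists>t'. strict_mono_on {1..n - 1} t' \<and> t' ` {1..n - 1} \<subseteq> {a<..<b} \<and>
    (\<exists>h\<in>analytic_class a b. \<forall>x\<in>{a..b}. aaa_V n t t' (of_real x) \<noteq> 0 \<longrightarrow>
       h x = (aaa_P n t w (of_real x) * F (of_real x) - aaa_Q F n t w (of_real x))
               / aaa_V n t t' (of_real x))"
proof -
  have "minimizer w" using w by (simp add: aaa_weights_iff)
  from minimizer_zeros[OF this] obtain X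
    where X: "X \<subseteq> {a<..<b}" "finite X" "card X = n - 1" "\<And>x. x \<in> X \<Longrightarrow> comb w x = 0" by blast
  obtain t' where t': "strict_mono_on {1..n - 1} t'" "bij_betw t' {1..n - 1} X"
    using finite_set_strict_mono_enumeration[OF X(2,3)] by blast
  define H where "H = (\<lambda>z. \<Sum>k=1..n. of_real (w k) * complex_loewner F (of_real (t k)) z)"
  have H_holo: "H holomorphic_on S"
    unfolding H_def by (intro holomorphic_intros holomorphic_complex_loewner holo S_open)
  have H_real: "H (of_real x) = of_real (comb w x)" if "x \<in> {a..b}" for x
    unfolding H_def comb_def of_real_sum
    by (intro sum.cong refl) (simp add: complex_loewner_of_real[OF that t_mem])
  have XS: "complex_of_real ` X \<subseteq> S" using X(1) S_sup by force
  have "H z = 0" if z: "z \<in> complex_of_real ` X" for z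
  proof -
    obtain x where x: "x \<in> X" "z = of_real x" using z by blast
    then have "x \<in> {a..b}" using X(1) by auto
    then show ?thesis using H_real X(4)[OF x(1)] x(2) by simp
  qed
  with divide_out_zeros[OF _ S_open H_holo XS] X(2) obtain h
    where h: "h holomorphic_on S" "\<And>z. z \<in> S \<Longrightarrow> H z = h z * (\<Prod>v\<in>complex_of_real ` X. z - v)"
    by blast
  \<comment> \<open>\<open>S\<close> may be disconnected, whereas \<open>analytic_class\<close> asks
    for a connected domain.\<close>
  define S' where "S' = connected_component_set S (of_real a)"
  have S': "open S'" "connected S'" "S' \<subseteq> S"
    using S_open by (auto simp: S'_def open_connected_component connected_component_subset)
  have "complex_of_real ` {a..b} \<subseteq> S'" unfolding S'_def
    using S_sup ab by (intro connected_component_maximal connected_continuous_image continuous_intros) auto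
  then have cl: "(\<lambda>x. h (of_real x)) \<in> analytic_class a b"
    using S' holomorphic_on_subset[OF h(1)] unfolding analytic_class_def
    by (intro CollectI exI[of _ S'] exI[of _ h]) auto
  have eq: "aaa_P n t w z * F z - aaa_Q F n t w z = aaa_V n t t' z * h z" if "z \<in> S" for z
  proof -
    have "aaa_P n t w z * F z - aaa_Q F n t w z
        = (\<Sum>k=1..n. of_real (w k) * (F z - F (of_real (t k))) * node_poly n t k z)"
      unfolding aaa_P_def aaa_Q_def sum_distrib_right
      by (subst sum_subtractf[symmetric]) (simp add: algebra_simps)
    also have "\<dots> = (\<Sum>k=1..n. (\<Prod>i=1..n. z - of_real (t i)) * (of_real (w k) * complex_loewner F (of_real (t k)) z))"
    proof (intro sum.cong refl)
      fix k assume "k \<in> {1..n}"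
      then have "(\<Prod>i=1..n. z - of_real (t i)) = (z - of_real (t k)) * node_poly n t k z"
        unfolding node_poly_def by (subst prod.remove[of _ k]) auto
      then show "of_real (w k) * (F z - F (of_real (t k))) * node_poly n t k z
          = (\<Prod>i=1..n. z - of_real (t i)) * (of_real (w k) * complex_loewner F (of_real (t k)) z)"
        by (simp add: complex_loewner_mult[symmetric] mult_ac)
    qed
    also have "\<dots> = (\<Prod>i=1..n. z - of_real (t i)) * H z" by (simp add: H_def sum_distrib_left)
    also have "(\<Prod>v\<in>complex_of_real ` X. z - v) = (\<Prod>k=1..n - 1. z - of_real (t' k))"
      using prod.reindex_bij_betw[OF t'(2), of "\<lambda>x. z - of_real x"] by (simp add: prod.reindex inj_on_def)
    then have "H z = h z * (\<Prod>k=1..n - 1. z - of_real (t' k))" using h(2)[OF that] by simp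
    finally show ?thesis by (simp add: aaa_V_def mult_ac)
  qed
  have hx: "h (of_real x) = (aaa_P n t w (of_real x) * F (of_real x) - aaa_Q F n t w (of_real x))
               / aaa_V n t t' (of_real x)" if "x \<in> {a..b}" "aaa_V n t t' (of_real x) \<noteq> 0" for x
  proof -
    show ?thesis using eq[OF S_mem[OF that(1)]] that(2) by simp
  qed
  have "t' ` {1..n - 1} \<subseteq> {a<..<b}" using t'(2) X(1) by (simp add: bij_betw_def)
  then show ?thesis using t'(1) cl hx by (intro exI[of _ t'] conjI bexI[of _ "\<lambda>x. h (of_real x)"]) auto
qed

lemma aaa_theorem:
  "(\<exists>!(R, w). aaa_approximant a b f n \<nu> t R w)
    \<and> (\<exists>!R. \<exists>w. aaa_approximant a b f n \<nu> t R w)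
    \<and> (\<forall>R w. aaa_approximant a b f n \<nu> t R w \<longrightarrow>
         (\<forall>z. z \<notin> complex_of_real ` t ` {1..n} \<longrightarrow> R z = aaa_Q F n t w z / aaa_P n t w z) \<and>
         (\<exists>t'. strict_mono_on {1..n - 1} t' \<and> t' ` {1..n - 1} \<subseteq> {a<..<b} \<and>
            (\<exists>h\<in>analytic_class a b. \<forall>x\<in>{a..b}. aaa_V n t t' (of_real x) \<noteq> 0 \<longrightarrow>
               h x = (aaa_P n t w (of_real x) * F (of_real x) - aaa_Q F n t w (of_real x))
                       / aaa_V n t t' (of_real x))))"
proof (intro conjI allI impI)
  obtain w where w: "aaa_weights a b f n \<nu> t w" using aaa_weights_exist by blast
  show "\<exists>!(R, w). aaa_approximant a b f n \<nu> t R w"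
    using w aaa_weights_unique by (intro ex1I[of _ "(barycentric f n t w, w)"]) (auto simp: aaa_approximant_def)
  show "\<exists>!R. \<exists>w. aaa_approximant a b f n \<nu> t R w"
    using w aaa_weights_unique by (intro ex1I[of _ "barycentric f n t w"]) (auto simp: aaa_approximant_def)
next
  fix R w z assume "aaa_approximant a b f n \<nu> t R w" "z \<notin> complex_of_real ` t ` {1..n}"
  then show "R z = aaa_Q F n t w z / aaa_P n t w z" by (simp add: aaa_approximant_def barycentric_eq)
qed (use interpolation in \<open>simp only: aaa_approximant_def\<close>)

end

section \<open>Nevanlinna-Pick functions\<close>

lemma rational_on_add:
  assumes "rational_on D F" "rational_on D G"
  shows "rational_on D (\<lambda>z. F z + G z)"
proof -
  obtain p q p' q' where q: "q \<noteq> 0" "\<And>z. z \<in> D \<Longrightarrow> poly q z \<noteq> 0 \<Longrightarrow> F z = poly p z / poly q z"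
    and q': "q' \<noteq> 0" "\<And>z. z \<in> D \<Longrightarrow> poly q' z \<noteq> 0 \<Longrightarrow> G z = poly p' z / poly q' z"
    using assms unfolding rational_on_def by metis
  have "F z + G z = poly (p * q' + p' * q) z / poly (q * q') z" if "z \<in> D" "poly (q * q') z \<noteq> 0" for z
    using that q(2)[of z] q'(2)[of z] by (simp add: add_frac_eq)
  then show ?thesis unfolding rational_on_def using q(1) q'(1)
    by (intro exI[of _ "p * q' + p' * q"] exI[of _ "q * q'"]) auto
qed

lemma rational_on_divide:
  assumes "q \<noteq> 0"
  shows "rational_on D (\<lambda>z. poly p z / poly q z)"
  using assms unfolding rational_on_def by blast

lemma rational_on_sum:
  "finite I \<Longrightarrow> (\<And>i. i \<in> I \<Longrightarrow> rational_on D (F i)) \<Longrightarrow> rational_on D (\<lambda>z. \<Sum>i\<in>I. F i z)"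
proof (induction I rule: finite_induct)
  case empty
  then show ?case using rational_on_divide[of 1 D 0] by simp
next
  case (insert i I)
  then show ?case using rational_on_add[of D "F i"] by simp
qed

lemma rational_on_cong: "(\<And>z. z \<in> D \<Longrightarrow> F z = G z) \<Longrightarrow> rational_on D F \<longleftrightarrow> rational_on D G"
  by (simp add: rational_on_def)

text \<open>The numerator of the sum of all \<open>c y / (s - y)\<close> over the common
  denominator.\<close>

definition lagrange_sum :: "'a::field set \<Rightarrow> ('a \<Rightarrow> 'a) \<Rightarrow> 'a poly" where
  "lagrange_sum Y c = (\<Sum>y\<in>Y. smult (c y) (\<Prod>v\<in>Y - {y}. [:- v, 1:]))"

lemma poly_lagrange_sum:
  "poly (lagrange_sum Y c) s = (\<Sum>y\<in>Y. c y * (\<Prod>v\<in>Y - {y}. s - v))"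
  by (simp add: lagrange_sum_def poly_sum poly_prod)

lemma poly_lagrange_sum_node:
  assumes "finite Y" "y \<in> Y"
  shows "poly (lagrange_sum Y c) y = c y * (\<Prod>v\<in>Y - {y}. y - v)"
proof -
  have "(\<Sum>w\<in>Y - {y}. c w * (\<Prod>v\<in>Y - {w}. y - v)) = 0"
    using assms by (intro sum.neutral) (auto simp: prod_zero_iff)
  then show ?thesis using assms by (simp add: poly_lagrange_sum sum.remove)
qed

lemma degree_prod_linear: "degree (\<Prod>v\<in>Z. [:- v, 1:] :: 'a::field poly) = card Z"
  by (subst degree_prod_eq_sum_degree) auto

lemma degree_lagrange_sum: "finite Y \<Longrightarrow> degree (lagrange_sum Y c) \<le> card Y - 1"
  unfolding lagrange_sum_def
  by (intro degree_sum_le order.trans[OF degree_smult_le]) (auto simp: degree_prod_linear)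

text \<open>Node sets of equal size with the same numerator thus have the same total weight, which
  turns the contribution of the linear term \<open>B * z\<close> into a square.\<close>

lemma coeff_lagrange_sum: "coeff (lagrange_sum Y c) (card Y - 1) = (\<Sum>y\<in>Y. c y)" if "finite Y"
proof -
  have "coeff (\<Prod>v\<in>Y - {y}. [:- v, 1:]) (card Y - 1) = 1" if y: "y \<in> Y" for y
  proof -
    have "card (Y - {y}) = card Y - 1" using \<open>finite Y\<close> y by simp
    moreover have "lead_coeff (\<Prod>v\<in>Y - {y}. [:- v, 1:]) = 1" by (simp add: lead_coeff_prod)
    ultimately show ?thesis by (simp add: degree_prod_linear)
  qed
  then show ?thesis by (simp add: lagrange_sum_def coeff_sum)
qed

lemma lagrange_sum_eq_0D:
  assumes "finite Y" "lagrange_sum Y c = 0" "y \<in> Y"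
  shows "c y = 0"
  using poly_lagrange_sum_node[OF assms(1,3), of c] assms by (auto simp: prod_zero_iff)

text \<open>Lagrange interpolation: every polynomial of degree less than \<open>card X\<close> is a
  numerator over \<open>X\<close>.\<close>

lemma lagrange_sum_exchange:
  assumes "finite X" "finite Y" "card X = card Y"
  shows "\<exists>d. lagrange_sum X d = lagrange_sum Y c"
proof -
  define p where "p = lagrange_sum Y c"
  define d where "d = (\<lambda>x. poly p x / (\<Prod>v\<in>X - {x}. x - v))"
  have "lagrange_sum X d = p"
  proof (cases "X = {}")
    case True
    then have "Y = {}" using assms by auto
    then show ?thesis using True by (simp add: p_def lagrange_sum_def)
  next
    case False
    have "poly (lagrange_sum X d) x = poly p x" if "x \<in> X" for x
    proof -
      have "(\<Prod>v\<in>X - {x}. x - v) \<noteq> 0" using assms(1) by auto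
      then show ?thesis using poly_lagrange_sum_node[OF assms(1) that, of d] by (simp add: d_def)
    qed
    moreover have "card X > 0" using False assms(1) by (simp add: card_gt_0_iff)
    then have "degree (lagrange_sum X d) < card X" "degree p < card X"
      using degree_lagrange_sum[OF assms(1), of d] degree_lagrange_sum[OF assms(2), of c] assms(3)
      unfolding p_def by linarith+
    ultimately show ?thesis by (intro poly_eqI_degree[of X]) auto
  qed
  then show ?thesis unfolding p_def by blast
qed

lemma lagrange_sum_partial_fractions:
  assumes "finite Y" "s \<notin> Y"
  shows "(\<Sum>y\<in>Y. c y / (s - y)) = poly (lagrange_sum Y c) s / (\<Prod>y\<in>Y. s - y)"
proof -
  have "(\<Prod>v\<in>Y - {y}. s - v) = (\<Prod>y\<in>Y. s - y) / (s - y)" if "y \<in> Y" for y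
    using assms that by (subst (2) prod.remove[of _ y]) auto
  moreover have "(\<Prod>y\<in>Y. s - y) \<noteq> 0" using assms by auto
  ultimately show ?thesis by (simp add: poly_lagrange_sum sum_divide_distrib)
qed

section \<open>Integral representation of the Loewner kernel\<close>

locale nevanlinna_function =
  fixes A B :: real and \<mu> :: "real measure" and D :: "complex set" and F :: "complex \<Rightarrow> complex"
    and a b :: real
  assumes ab: "a < b" and rep: "nevanlinna_pick_representation A B \<mu> D F"
    and disjoint: "measure_support \<mu> \<inter> {a..b} = {}"
begin

lemma B_nonneg: "B \<ge> 0"
  using rep by (simp add: nevanlinna_pick_representation_def)

sublocale finite_borel_measure \<mu>
  using rep by (simp add: nevanlinna_pick_representation_def)

lemma F_eq: "z \<in> D \<Longrightarrow> F z = of_real A + of_real B * z + (\<integral>s. (1 + z * of_real s) / (of_real s - z) \<partial>\<mu>)"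
  using rep by (simp add: nevanlinna_pick_representation_def)

lemma D_eq: "D = - complex_of_real ` measure_support \<mu>"
  using rep by (simp add: nevanlinna_pick_representation_def)

lemma AE_support: "AE s in \<mu>. s \<in> measure_support \<mu>"
  by (rule AE_in_measure_support[OF finite_borel_measure_axioms])

lemmas [measurable_cong] = M_is_borel

lemma open_D: "open D"
proof -
  have "closed (complex_of_real ` measure_support \<mu>)"
    using closed_measure_support by (intro closed_injective_linear_image) (auto intro: linear_of_real simp: inj_on_def)
  then show ?thesis unfolding D_eq by blast
qed

lemma segment_in_D: "complex_of_real ` {a..b} \<subseteq> D"
  using disjoint by (auto simp: D_eq)

text \<open>Near \<open>w\<close> the distance to the support stays positive, and for large
  \<open>s\<close> it grows like \<open>\<bar>s\<bar>\<close>. One constant for all \<open>z\<close>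
  near \<open>w\<close> is what dominated convergence will need.\<close>

lemma kernel_bound:
  assumes "w \<in> D"
  shows "\<exists>\<epsilon>>0. \<exists>C>0. \<forall>z s. dist z w < \<epsilon> \<longrightarrow> s \<in> measure_support \<mu> \<longrightarrow> 1 + \<bar>s\<bar> \<le> C * norm (of_real s - z)"
proof -
  obtain \<delta> where \<delta>: "\<delta> > 0" "ball w \<delta> \<subseteq> D" using open_D assms openE by blast
  define \<epsilon> where "\<epsilon> = \<delta> / 2"
  \<comment> \<open>With \<open>r\<close> the distance from \<open>z\<close> to \<open>s\<close>,
    the triangle inequality gives
    \<open>1 + \<bar>s\<bar> \<le> (1 + norm w + \<epsilon>) + r\<close>, and
    \<open>1 \<le> r / \<epsilon>\<close> absorbs the constant term.\<close>
  define C where "C = (1 + norm w + \<epsilon>) / \<epsilon> + 1"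
  have \<epsilon>: "\<epsilon> > 0" using \<delta> by (simp add: \<epsilon>_def)
  have "1 + \<bar>s\<bar> \<le> C * norm (of_real s - z)" if z: "dist z w < \<epsilon>" and s: "s \<in> measure_support \<mu>" for z s
  proof -
    define r where "r = norm (of_real s - z)"
    have "of_real s \<notin> ball w \<delta>" using s \<delta>(2) by (auto simp: D_eq)
    then have "\<delta> \<le> dist w (of_real s)" by simp
    also have "\<dots> \<le> dist w z + dist z (of_real s)" by (rule dist_triangle)
    finally have "\<epsilon> \<le> r" using z by (simp add: \<epsilon>_def r_def dist_commute dist_norm norm_minus_commute)
    have "norm z \<le> norm w + \<epsilon>" using z norm_triangle_sub[of z w] by (simp add: dist_norm)
    moreover have "\<bar>s\<bar> \<le> norm z + r" using norm_triangle_sub[of "of_real s" z] by (simp add: r_def)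
    ultimately have "1 + \<bar>s\<bar> \<le> (1 + norm w + \<epsilon>) * 1 + r" by simp
    also have "(1 + norm w + \<epsilon>) * 1 \<le> (1 + norm w + \<epsilon>) * (r / \<epsilon>)"
      using \<open>\<epsilon> \<le> r\<close> \<epsilon> by (intro mult_left_mono) auto
    finally show ?thesis by (simp add: C_def r_def algebra_simps)
  qed
  moreover have "C > 0" using \<epsilon> by (simp add: C_def add_pos_nonneg add_nonneg_pos)
  ultimately show ?thesis using \<epsilon> by (intro exI[of _ \<epsilon>] exI[of _ C] conjI) auto
qed

lemma kernel_bound':
  assumes "1 + \<bar>s\<bar> \<le> C * norm (of_real s - z)" "1 + \<bar>s\<bar> \<le> C * norm (of_real s - w)"
  shows "norm ((1 + (of_real s)\<^sup>2) / ((of_real s - z) * (of_real s - w)) :: complex) \<le> C\<^sup>2"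
proof -
  have pos: "of_real s \<noteq> z" "of_real s \<noteq> w" using assms by auto
  have "norm (1 + (of_real s)\<^sup>2 :: complex) \<le> 1 + \<bar>s\<bar>\<^sup>2"
    using norm_triangle_ineq[of 1 "(of_real s)\<^sup>2 :: complex"] by (simp add: norm_power)
  also have "\<dots> \<le> (1 + \<bar>s\<bar>) * (1 + \<bar>s\<bar>)" by (simp add: power2_eq_square algebra_simps)
  also have "\<dots> \<le> (C * norm (of_real s - z)) * (C * norm (of_real s - w))"
    using assms by (intro mult_mono) auto
  finally have "norm (1 + (of_real s)\<^sup>2 :: complex) \<le> C\<^sup>2 * (norm (of_real s - z) * norm (of_real s - w))"
    by (simp only: power2_eq_square mult_ac)
  moreover have "0 < norm (of_real s - z) * norm (of_real s - w)" using pos by simp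
  ultimately show ?thesis by (simp only: norm_divide norm_mult pos_divide_le_eq)
qed

text \<open>The divided difference of \<open>(1 + z * s) / (s - z)\<close> with respect to
  \<open>z\<close>, in the closed form that also makes sense for \<open>z = w\<close>.\<close>

definition ker :: "complex \<Rightarrow> complex \<Rightarrow> real \<Rightarrow> complex" where
  "ker z w s = (1 + (of_real s)\<^sup>2) / ((of_real s - z) * (of_real s - w))"

lemma ker_measurable [measurable]: "ker z w \<in> borel_measurable \<mu>"
  unfolding ker_def by measurable

lemma ker_bound:
  assumes "w \<in> D"
  shows "\<exists>\<epsilon>>0. \<exists>C. \<forall>z. dist z w < \<epsilon> \<longrightarrow> (AE s in \<mu>. norm (ker z w s) \<le> C)"
proof -
  obtain \<epsilon> C where C: "\<epsilon> > 0" "C > 0"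
    "\<And>z s. dist z w < \<epsilon> \<Longrightarrow> s \<in> measure_support \<mu> \<Longrightarrow> 1 + \<bar>s\<bar> \<le> C * norm (of_real s - z)"
    using kernel_bound[OF assms] by blast
  have "AE s in \<mu>. norm (ker z w s) \<le> C\<^sup>2" if "dist z w < \<epsilon>" for z
    using AE_support
  proof (rule eventually_mono)
    fix s assume s: "s \<in> measure_support \<mu>"
    show "norm (ker z w s) \<le> C\<^sup>2"
      unfolding ker_def using C(3)[OF that s] C(3)[of w s] C(1) s by (intro kernel_bound') auto
  qed
  then show ?thesis using C(1) by blast
qed

lemma cauchy_integrable:
  assumes "z \<in> D"
  shows "integrable \<mu> (\<lambda>s. (1 + z * of_real s) / (of_real s - z))"
proof -
  obtain \<epsilon> C where C: "\<epsilon> > 0" "C > 0"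
    "\<And>z' s. dist z' z < \<epsilon> \<Longrightarrow> s \<in> measure_support \<mu> \<Longrightarrow> 1 + \<bar>s\<bar> \<le> C * norm (of_real s - z')"
    using kernel_bound[OF assms] by blast
  have "AE s in \<mu>. norm ((1 + z * of_real s) / (of_real s - z)) \<le> (1 + norm z) * C"
    using AE_support
  proof (rule eventually_mono)
    fix s assume s: "s \<in> measure_support \<mu>"
    have "norm (1 + z * of_real s) \<le> 1 + norm z * \<bar>s\<bar>"
      using norm_triangle_ineq[of 1 "z * of_real s"] by (simp add: norm_mult)
    also have "\<dots> \<le> (1 + norm z) * (1 + \<bar>s\<bar>)" by (simp add: algebra_simps)
    also have "\<dots> \<le> (1 + norm z) * (C * norm (of_real s - z))"
      using C(3)[of z s] C(1) s by (intro mult_left_mono) auto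
    finally have "norm (1 + z * of_real s) \<le> (1 + norm z) * C * norm (of_real s - z)" by simp
    moreover have "of_real s \<noteq> z" using s assms by (auto simp: D_eq)
    ultimately show "norm ((1 + z * of_real s) / (of_real s - z)) \<le> (1 + norm z) * C"
      by (simp add: norm_divide field_simps)
  qed
  then show ?thesis by (intro integrable_const_bound) auto
qed

lemma ker_integrable_diff:
  assumes "z \<in> D" "w \<in> D" "z \<noteq> w"
  shows "integrable \<mu> (ker z w)" "(F z - F w) / (z - w) = of_real B + (\<integral>s. ker z w s \<partial>\<mu>)"
proof -
  let ?g = "\<lambda>z s. (1 + z * of_real s) / (of_real s - z)"
  have eq: "AE s in \<mu>. (?g z s - ?g w s) / (z - w) = ker z w s"
    using AE_support
  proof (rule eventually_mono)
    fix s assume s: "s \<in> measure_support \<mu>"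
    then have ne: "of_real s - z \<noteq> 0" "of_real s - w \<noteq> 0" "z - w \<noteq> 0" using assms by (auto simp: D_eq)
    have "?g z s - ?g w s
        = ((1 + z * of_real s) * (of_real s - w) - (1 + w * of_real s) * (of_real s - z)) / ((of_real s - z) * (of_real s - w))"
      using ne by (simp add: diff_frac_eq)
    also have "(1 + z * of_real s) * (of_real s - w) - (1 + w * of_real s) * (of_real s - z) = (z - w) * (1 + (of_real s)\<^sup>2)"
      by (simp add: algebra_simps power2_eq_square)
    finally show "(?g z s - ?g w s) / (z - w) = ker z w s" using ne by (simp add: ker_def)
  qed
  have int: "integrable \<mu> (\<lambda>s. (?g z s - ?g w s) / (z - w))"
    using assms by (intro integrable_divide Bochner_Integration.integrable_diff cauchy_integrable)
  show "integrable \<mu> (ker z w)"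
    using int eq by (subst integrable_cong_AE[symmetric]) (auto intro: borel_measurable_integrable)
  have "(\<integral>s. ker z w s \<partial>\<mu>) = (\<integral>s. (?g z s - ?g w s) / (z - w) \<partial>\<mu>)"
    using int eq by (intro integral_cong_AE) (auto intro: borel_measurable_integrable elim: eventually_mono)
  also have "\<dots> = ((\<integral>s. ?g z s \<partial>\<mu>) - (\<integral>s. ?g w s \<partial>\<mu>)) / (z - w)"
    using assms by (simp add: Bochner_Integration.integral_diff cauchy_integrable)
  finally show "(F z - F w) / (z - w) = of_real B + (\<integral>s. ker z w s \<partial>\<mu>)"
    using assms by (simp add: F_eq field_simps)
qed

text \<open>Dominated convergence in the formula for difference quotients yields holomorphy and, at
  once, the same formula on the diagonal.\<close>

lemma F_deriv:
  assumes w: "w \<in> D"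
  shows "integrable \<mu> (ker w w)" "(F has_field_derivative of_real B + (\<integral>s. ker w w s \<partial>\<mu>)) (at w)"
proof -
  obtain \<epsilon> C where C: "\<epsilon> > 0" "\<And>z. dist z w < \<epsilon> \<Longrightarrow> AE s in \<mu>. norm (ker z w s) \<le> C"
    using ker_bound[OF w] by blast
  show "integrable \<mu> (ker w w)" using C(2)[of w] C(1) by (intro integrable_const_bound[of _ C]) auto
  have "((\<lambda>z. of_real B + (\<integral>s. ker z w s \<partial>\<mu>)) \<longlongrightarrow> of_real B + (\<integral>s. ker w w s \<partial>\<mu>)) (at w)"
  proof (intro tendsto_intros)
    show "((\<lambda>z. \<integral>s. ker z w s \<partial>\<mu>) \<longlongrightarrow> (\<integral>s. ker w w s \<partial>\<mu>)) (at w)"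
      unfolding tendsto_at_iff_sequentially
    proof (intro allI impI)
      fix Z assume Z: "\<forall>i. Z i \<in> UNIV - {w}" "Z \<longlonglongrightarrow> w"
      \<comment> \<open>The bound holds only near \<open>w\<close>, so an initial segment of the
        sequence is dropped.\<close>
      obtain N where N: "\<And>i. i \<ge> N \<Longrightarrow> dist (Z i) w < \<epsilon>"
        using Z(2) C(1) unfolding lim_sequentially by blast
      have "(\<lambda>i. \<integral>s. ker (Z (i + N)) w s \<partial>\<mu>) \<longlonglongrightarrow> (\<integral>s. ker w w s \<partial>\<mu>)"
      proof (rule integral_dominated_convergence[where w = "\<lambda>_. C"])
        show "AE s in \<mu>. (\<lambda>i. ker (Z (i + N)) w s) \<longlonglongrightarrow> ker w w s"
          using AE_support
        proof (rule eventually_mono)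
          fix s assume s: "s \<in> measure_support \<mu>"
          then have "of_real s - w \<noteq> 0" using w by (auto simp: D_eq)
          then show "(\<lambda>i. ker (Z (i + N)) w s) \<longlonglongrightarrow> ker w w s"
            unfolding ker_def by (intro tendsto_intros LIMSEQ_ignore_initial_segment[OF Z(2)]) auto
        qed
        show "AE s in \<mu>. norm (ker (Z (i + N)) w s) \<le> C" for i by (intro C(2) N) simp
      qed auto
      then show "((\<lambda>z. \<integral>s. ker z w s \<partial>\<mu>) \<circ> Z) \<longlonglongrightarrow> (\<integral>s. ker w w s \<partial>\<mu>)"
        unfolding comp_def by (rule LIMSEQ_offset)
    qed
  qed
  then show "(F has_field_derivative of_real B + (\<integral>s. ker w w s \<partial>\<mu>)) (at w)"
    unfolding has_field_derivative_iff
  proof (rule Lim_transform_eventually)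
    have "eventually (\<lambda>z. z \<in> D) (at w)" using open_D w by (rule eventually_at_in_open')
    moreover have "eventually (\<lambda>z. z \<noteq> w) (at w)" by (auto simp: eventually_at_filter)
    ultimately show "eventually (\<lambda>z. of_real B + (\<integral>s. ker z w s \<partial>\<mu>) = (F z - F w) / (z - w)) (at w)"
      by eventually_elim (simp add: ker_integrable_diff w)
  qed
qed

lemma F_real:
  assumes "complex_of_real x \<in> D"
  shows "Im (F (of_real x)) = 0"
proof -
  have "(\<integral>s. (1 + complex_of_real x * of_real s) / (of_real s - of_real x) \<partial>\<mu>) = of_real (\<integral>s. (1 + x * s) / (s - x) \<partial>\<mu>)"
    by (subst integral_complex_of_real[symmetric]) simp
  then show ?thesis using F_eq[OF assms] by simp
qed

sublocale real_analytic_function a b D F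
proof
  show "F holomorphic_on D"
    using F_deriv(2) by (subst holomorphic_on_open[OF open_D]) blast
  show "a < b" by (rule ab)
  show "open D" by (rule open_D)
  show "complex_of_real ` {a..b} \<subseteq> D" by (rule segment_in_D)
  show "Im (F (complex_of_real x)) = 0" if "complex_of_real x \<in> D" for x using that by (rule F_real)
qed

lemma ker_of_real:
  "ker (of_real x) (of_real y) s = of_real ((1 + s\<^sup>2) / ((s - x) * (s - y)))"
  by (simp add: ker_def)

lemma loewner_eq:
  assumes "x \<in> {a..b}" "y \<in> {a..b}"
  shows "integrable \<mu> (\<lambda>s. (1 + s\<^sup>2) / ((s - x) * (s - y)))"
    "loewner_kernel f x y = B + (\<integral>s. (1 + s\<^sup>2) / ((s - x) * (s - y)) \<partial>\<mu>)"
proof -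
  note D = S_mem[OF assms(1)] S_mem[OF assms(2)]
  have "integrable \<mu> (ker (of_real x) (of_real y))"
    using ker_integrable_diff(1)[OF D] F_deriv(1)[OF D(2)] by (cases "x = y") auto
  then have "integrable \<mu> (\<lambda>s. complex_of_real ((1 + s\<^sup>2) / ((s - x) * (s - y))))"
    by (simp only: ker_of_real[abs_def])
  then show "integrable \<mu> (\<lambda>s. (1 + s\<^sup>2) / ((s - x) * (s - y)))"
    by (simp only: complex_of_real_integrable_eq)
  have "complex_loewner F (of_real y) (of_real x) = of_real B + (\<integral>s. ker (of_real x) (of_real y) s \<partial>\<mu>)"
    using ker_integrable_diff(2)[OF D] DERIV_imp_deriv[OF F_deriv(2)[OF D(2)]]
    by (cases "x = y") (auto simp: complex_loewner_def)
  also have "(\<integral>s. ker (of_real x) (of_real y) s \<partial>\<mu>) = of_real (\<integral>s. (1 + s\<^sup>2) / ((s - x) * (s - y)) \<partial>\<mu>)"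
    unfolding ker_of_real by (rule integral_complex_of_real)
  finally have "complex_of_real (loewner_kernel f x y) = of_real (B + (\<integral>s. (1 + s\<^sup>2) / ((s - x) * (s - y)) \<partial>\<mu>))"
    using complex_loewner_of_real[OF assms] by simp
  then show "loewner_kernel f x y = B + (\<integral>s. (1 + s\<^sup>2) / ((s - x) * (s - y)) \<partial>\<mu>)"
    by (simp only: of_real_eq_iff)
qed

text \<open>The integral collapses to a finite sum over point masses.\<close>

lemma rational_if_finite_support:
  assumes "finite Z" "AE s in \<mu>. s \<in> Z"
  shows "rational_on D F"
proof -
  define m where "m = (\<lambda>\<zeta>. measure \<mu> {\<zeta>})"
  have "(\<integral>s. g s \<partial>\<mu>) = (\<Sum>\<zeta>\<in>Z. of_real (m \<zeta>) * g \<zeta>)" if "g \<in> borel_measurable \<mu>" for g :: "real \<Rightarrow> complex"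
  proof -
    have sing: "{\<zeta>} \<in> sets \<mu>" for \<zeta> using M_is_borel by simp
    have "(\<integral>s. g s \<partial>\<mu>) = (\<integral>s. (\<Sum>\<zeta>\<in>Z. indicator {\<zeta>} s *\<^sub>R g \<zeta>) \<partial>\<mu>)"
    proof (rule integral_cong_AE)
      show "(\<lambda>s. \<Sum>\<zeta>\<in>Z. indicator {\<zeta>} s *\<^sub>R g \<zeta>) \<in> borel_measurable \<mu>"
        using sing by measurable
      show "AE s in \<mu>. g s = (\<Sum>\<zeta>\<in>Z. indicator {\<zeta>} s *\<^sub>R g \<zeta>)"
        using assms(2)
      proof (rule eventually_mono)
        fix s assume "s \<in> Z"
        then have "(\<Sum>\<zeta>\<in>Z. indicator {\<zeta>} s *\<^sub>R g \<zeta>) = (\<Sum>\<zeta>\<in>{s}. indicator {\<zeta>} s *\<^sub>R g \<zeta>)"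
          using assms(1) by (intro sum.mono_neutral_right) auto
        then show "g s = (\<Sum>\<zeta>\<in>Z. indicator {\<zeta>} s *\<^sub>R g \<zeta>)" by simp
      qed
    qed fact
    also have "\<dots> = (\<Sum>\<zeta>\<in>Z. \<integral>s. indicator {\<zeta>} s *\<^sub>R g \<zeta> \<partial>\<mu>)"
      using sing by (intro Bochner_Integration.integral_sum) (auto intro!: integrable_scaleR_left integrable_real_indicator simp: emeasure_eq_measure)
    also have "\<dots> = (\<Sum>\<zeta>\<in>Z. of_real (m \<zeta>) * g \<zeta>)"
      using sing by (simp add: m_def scaleR_conv_of_real)
    finally show ?thesis .
  qed
  then have "F z = (of_real A + of_real B * z) + (\<Sum>\<zeta>\<in>Z. of_real (m \<zeta>) * ((1 + z * of_real \<zeta>) / (of_real \<zeta> - z)))"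
    if "z \<in> D" for z
    unfolding F_eq[OF that] using borel_measurable_integrable[OF cauchy_integrable[OF that]] by simp
  moreover have "rational_on D (\<lambda>z. (of_real A + of_real B * z)
      + (\<Sum>\<zeta>\<in>Z. of_real (m \<zeta>) * ((1 + z * of_real \<zeta>) / (of_real \<zeta> - z))))"
  proof (rule rational_on_add)
    show "rational_on D (\<lambda>z. of_real A + of_real B * z)"
      using rational_on_divide[of 1 D "[:of_real A, of_real B:]"] by (simp add: mult.commute)
    have "rational_on D (\<lambda>z. of_real (m \<zeta>) * ((1 + z * of_real \<zeta>) / (of_real \<zeta> - z)))" for \<zeta>
      using rational_on_divide[of "[:of_real \<zeta>, -1:]" D "smult (of_real (m \<zeta>)) [:1, of_real \<zeta>:]"] by (simp add: algebra_simps)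
    then show "rational_on D (\<lambda>z. \<Sum>\<zeta>\<in>Z. of_real (m \<zeta>) * ((1 + z * of_real \<zeta>) / (of_real \<zeta> - z)))"
      by (intro rational_on_sum assms(1))
  qed
  ultimately show ?thesis by (simp cong: rational_on_cong)
qed

lemma unisolvent:
  assumes "\<not> rational_on D F"
  shows "unisolvent_kernel a b (loewner_kernel f)"
proof (rule unisolvent_loewnerI, rule ccontr)
  fix X Y c y
  assume XY: "finite X" "finite Y" "X \<subseteq> {a..b}" "Y \<subseteq> {a..b}" "card X = card Y" "y \<in> Y"
    and zero: "\<And>x. x \<in> X \<Longrightarrow> (\<Sum>y\<in>Y. c y * loewner_kernel f x y) = 0" and "c y \<noteq> 0"
  define p where "p = lagrange_sum Y c"
  have "p \<noteq> 0" using lagrange_sum_eq_0D[OF XY(2) _ XY(6)] \<open>c y \<noteq> 0\<close> by (auto simp: p_def)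
  obtain d where d: "lagrange_sum X d = p" using lagrange_sum_exchange[OF XY(1,2,5)] p_def by blast
  have sums: "(\<Sum>x\<in>X. d x) = (\<Sum>y\<in>Y. c y)"
    using coeff_lagrange_sum[OF XY(1), of d] coeff_lagrange_sum[OF XY(2), of c] XY(5) by (simp add: d p_def)
  let ?k = "\<lambda>x y s. (1 + s\<^sup>2) / ((s - x) * (s - y))"
  let ?I = "\<lambda>s. \<Sum>x\<in>X. \<Sum>y\<in>Y. d x * c y * ?k x y s"
  have int: "integrable \<mu> (\<lambda>s. d x * c y * ?k x y s)" if "x \<in> X" "y \<in> Y" for x y
    using loewner_eq(1)[of x y] that XY by (intro integrable_mult_right) blast
  have "0 = (\<Sum>x\<in>X. d x * (\<Sum>y\<in>Y. c y * loewner_kernel f x y))" using zero by simp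
  also have "\<dots> = (\<Sum>x\<in>X. \<Sum>y\<in>Y. B * (d x * c y) + (\<integral>s. d x * c y * ?k x y s \<partial>\<mu>))"
    unfolding sum_distrib_left
  proof (intro sum.cong refl)
    fix x y assume "x \<in> X" "y \<in> Y"
    then have "x \<in> {a..b}" "y \<in> {a..b}" using XY by auto
    from loewner_eq(2)[OF this]
    show "d x * (c y * loewner_kernel f x y) = B * (d x * c y) + (\<integral>s. d x * c y * ?k x y s \<partial>\<mu>)"
      by (simp only: integral_mult_right_zero) (simp only: ring_distribs mult_ac)
  qed
  also have "\<dots> = B * ((\<Sum>x\<in>X. d x) * (\<Sum>y\<in>Y. c y)) + (\<integral>s. ?I s \<partial>\<mu>)"
  proof -
    have "(\<integral>s. ?I s \<partial>\<mu>) = (\<Sum>x\<in>X. \<integral>s. (\<Sum>y\<in>Y. d x * c y * ?k x y s) \<partial>\<mu>)"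
      using int by (intro Bochner_Integration.integral_sum Bochner_Integration.integrable_sum)
    also have "\<dots> = (\<Sum>x\<in>X. \<Sum>y\<in>Y. \<integral>s. d x * c y * ?k x y s \<partial>\<mu>)"
      using int by (intro sum.cong refl Bochner_Integration.integral_sum)
    finally have "(\<integral>s. ?I s \<partial>\<mu>) = (\<Sum>x\<in>X. \<Sum>y\<in>Y. \<integral>s. d x * c y * ?k x y s \<partial>\<mu>)" .
    moreover have "(\<Sum>x\<in>X. \<Sum>y\<in>Y. B * (d x * c y)) = B * ((\<Sum>x\<in>X. d x) * (\<Sum>y\<in>Y. c y))"
      unfolding sum_product by (simp only: sum_distrib_left)
    ultimately show ?thesis by (simp only: sum.distrib)
  qed
  finally have eq0: "B * ((\<Sum>y\<in>Y. c y) * (\<Sum>y\<in>Y. c y)) + (\<integral>s. ?I s \<partial>\<mu>) = 0" unfolding sums by simp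
  \<comment> \<open>The double sum factors into two partial fraction sums with the same numerator
    \<open>p\<close>, one over \<open>X\<close> and one over \<open>Y\<close>. Outside
    \<open>[a, b]\<close> all factors \<open>s - x\<close> and \<open>s - y\<close> have the same
    sign and their number is even.\<close>
  have I: "?I s = (1 + s\<^sup>2) * (poly p s)\<^sup>2 / ((\<Prod>x\<in>X. s - x) * (\<Prod>y\<in>Y. s - y))"
    and pos: "(\<Prod>x\<in>X. s - x) * (\<Prod>y\<in>Y. s - y) > 0" if s: "s \<in> measure_support \<mu>" for s
  proof -
    have sab: "s \<notin> {a..b}" using s disjoint by blast
    then have "s \<notin> X" "s \<notin> Y" using XY by auto
    have "?I s = (1 + s\<^sup>2) * ((\<Sum>x\<in>X. d x / (s - x)) * (\<Sum>y\<in>Y. c y / (s - y)))"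
      unfolding sum_product unfolding sum_distrib_left by (intro sum.cong refl) (simp add: mult_ac)
    also have "\<dots> = (1 + s\<^sup>2) * (poly p s / (\<Prod>x\<in>X. s - x) * (poly p s / (\<Prod>y\<in>Y. s - y)))"
      using lagrange_sum_partial_fractions[OF XY(1) \<open>s \<notin> X\<close>, of d]
        lagrange_sum_partial_fractions[OF XY(2) \<open>s \<notin> Y\<close>, of c] by (simp add: d p_def)
    finally show "?I s = (1 + s\<^sup>2) * (poly p s)\<^sup>2 / ((\<Prod>x\<in>X. s - x) * (\<Prod>y\<in>Y. s - y))"
      by (simp add: power2_eq_square)
    show "(\<Prod>x\<in>X. s - x) * (\<Prod>y\<in>Y. s - y) > 0"
    proof (cases "s < a")
      case True
      have neg: "(\<Prod>x\<in>Z. s - x) = (-1) ^ card Z * (\<Prod>x\<in>Z. x - s)" for Z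
        by (simp add: prod.distrib[symmetric] flip: prod_constant)
      have "(\<Prod>x\<in>Z. x - s) > 0" if "Z \<subseteq> {a..b}" for Z using that True by (intro prod_pos) auto
      then have "(\<Prod>x\<in>X. x - s) * (\<Prod>y\<in>Y. y - s) > 0" using XY by simp
      then show ?thesis unfolding neg XY(5) by (simp add: mult_ac flip: power_add)
    next
      case False
      then have "s > b" using sab by auto
      then have "(\<Prod>x\<in>Z. s - x) > 0" if "Z \<subseteq> {a..b}" for Z using that by (intro prod_pos) auto
      then show ?thesis using XY by simp
    qed
  qed
  have nonneg: "AE s in \<mu>. 0 \<le> ?I s"
    using AE_support
  proof (rule eventually_mono)
    fix s assume "s \<in> measure_support \<mu>"
    show "0 \<le> ?I s"
      unfolding I[OF \<open>s \<in> _\<close>] using pos[OF \<open>s \<in> _\<close>] by (intro divide_nonneg_pos mult_nonneg_nonneg) auto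
  qed
  have intI: "integrable \<mu> ?I" using int by (intro Bochner_Integration.integrable_sum)
  have "0 \<le> (\<integral>s. ?I s \<partial>\<mu>)" using nonneg by (rule integral_nonneg_AE)
  moreover have "0 \<le> B * ((\<Sum>y\<in>Y. c y) * (\<Sum>y\<in>Y. c y))" using B_nonneg by simp
  ultimately have "(\<integral>s. ?I s \<partial>\<mu>) = 0" using eq0 by linarith
  then have "AE s in \<mu>. ?I s = 0" using integral_nonneg_eq_0_iff_AE[OF intI nonneg] by blast
  \<comment> \<open>The non-negative integrand vanishes almost everywhere, so almost all of
    \<open>\<mu>\<close> sits on the finitely many roots of \<open>p\<close>.\<close>
  then have "AE s in \<mu>. s \<in> {s. poly p s = 0}"
    using AE_support
  proof eventually_elim
    fix s assume s: "?I s = 0" "s \<in> measure_support \<mu>"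
    have "1 + s\<^sup>2 \<noteq> 0" using zero_le_power2[of s] by linarith
    then show "s \<in> {s. poly p s = 0}" using s(1) pos[OF s(2)] unfolding I[OF s(2)] by auto
  qed
  then have "rational_on D F" using poly_roots_finite[OF \<open>p \<noteq> 0\<close>] by (intro rational_if_finite_support)
  then show False using assms by blast
qed

end

section \<open>Sign changes\<close>

text \<open>At least \<open>r\<close> strict sign changes, witnessed by \<open>r + 1\<close>
  indices. The case \<open>r = 0\<close> says that the sequence is not identically 0, so a bound
  \<open>r < 0\<close> for every \<open>r\<close> forces the zero sequence.\<close>

definition alternates :: "(int \<Rightarrow> real) \<Rightarrow> nat \<Rightarrow> bool" where
  "alternates e r \<longleftrightarrow> (\<exists>i s. s \<in> {1, -1} \<and> (\<forall>k<r. i k < i (Suc k)) \<and> (\<forall>k\<le>r. 0 < s * (-1) ^ k * e (i k)))"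

lemma alternatesI:
  assumes "s \<in> {1, -1}" "\<And>k. k < r \<Longrightarrow> i k < i (Suc k)" "\<And>k. k \<le> r \<Longrightarrow> 0 < s * (-1) ^ k * e (i k)"
  shows "alternates e r"
  using assms unfolding alternates_def by blast

text \<open>Only the non-zero entries are constrained; where \<open>e\<close> vanishes,
  \<open>e'\<close> may be arbitrary.\<close>

lemma alternates_weight:
  assumes "alternates e r" "\<And>i. e i \<noteq> 0 \<Longrightarrow> \<exists>w>0. e' i = w * e i"
  shows "alternates e' r"
proof -
  from assms(1) obtain i s where i: "s \<in> {1, -1}" "\<And>k. k < r \<Longrightarrow> i k < i (Suc k)"
    "\<And>k. k \<le> r \<Longrightarrow> 0 < s * (-1) ^ k * e (i k)" unfolding alternates_def by blast
  have "0 < s * (-1) ^ k * e' (i k)" if "k \<le> r" for k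
  proof -
    have "e (i k) \<noteq> 0" using i(3)[OF that] by auto
    then obtain w where "w > 0" "e' (i k) = w * e (i k)" using assms(2) by blast
    then show ?thesis using mult_pos_pos[OF \<open>w > 0\<close> i(3)[OF that]] by (simp add: mult_ac)
  qed
  then show ?thesis using i(1,2) by (intro alternatesI)
qed

text \<open>Each value of the new sequence shares its sign with one of the two old entries that
  enter it. The chosen old indices are weakly increasing, and opposite signs keep neighbours
  distinct.\<close>

lemma alternates_mult:
  assumes alt: "alternates (\<lambda>i. p * e i + q * e (i - 1)) r" and pq: "p \<ge> 0" "q \<ge> 0"
  shows "alternates e r"
proof -
  from alt obtain i s where i: "s \<in> {1, -1}" "\<And>k. k < r \<Longrightarrow> i k < i (Suc k)"
    "\<And>k. k \<le> r \<Longrightarrow> 0 < s * (-1) ^ k * (p * e (i k) + q * e (i k - 1))" unfolding alternates_def by blast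
  have "\<exists>j. (j = i k \<or> j = i k - 1) \<and> 0 < s * (-1) ^ k * e j" if "k \<le> r" for k
  proof (rule ccontr)
    assume "\<not> ?thesis"
    then have "s * (-1) ^ k * e (i k) \<le> 0" "s * (-1) ^ k * e (i k - 1) \<le> 0" by (auto simp: not_less)
    then have "p * (s * (-1) ^ k * e (i k)) + q * (s * (-1) ^ k * e (i k - 1)) \<le> 0"
      by (intro add_nonpos_nonpos mult_nonneg_nonpos[OF pq(1)] mult_nonneg_nonpos[OF pq(2)])
    then show False using i(3)[OF that] by (simp add: algebra_simps)
  qed
  then obtain j where j: "\<And>k. k \<le> r \<Longrightarrow> j k = i k \<or> j k = i k - 1" "\<And>k. k \<le> r \<Longrightarrow> 0 < s * (-1) ^ k * e (j k)"
    by metis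
  have "j k < j (Suc k)" if "k < r" for k
  proof -
    have "j k \<le> j (Suc k)" using j(1)[of k] j(1)[of "Suc k"] i(2)[OF that] that by auto
    moreover have "j k \<noteq> j (Suc k)"
    proof
      assume "j k = j (Suc k)"
      then show False using j(2)[of k] j(2)[of "Suc k"] that by simp
    qed
    ultimately show ?thesis by simp
  qed
  then show ?thesis using i(1) j(2) by (intro alternatesI)
qed

lemma int_step_up:
  fixes D :: "int \<Rightarrow> real"
  assumes "m < n" "D m < D n"
  shows "\<exists>j. m < j \<and> j \<le> n \<and> D (j - 1) < D j"
proof (rule ccontr)
  assume no: "\<not> ?thesis"
  have "D k \<le> D m" if "m \<le> k" "k \<le> n" for k
    using that
  proof (induction k rule: int_ge_induct)
    case (step k)
    then show ?case using no by (auto simp: not_less)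
  qed simp
  from this[of n] show False using assms by simp
qed

lemma alternates_steps:
  fixes D :: "int \<Rightarrow> real"
  assumes i: "s \<in> {1, -1}" "\<And>k. k < r \<Longrightarrow> i k < i (Suc k)" "\<And>k. k \<le> r \<Longrightarrow> 0 < s * (-1) ^ k * D (i k)"
    and k: "k < r"
  shows "\<exists>j. i k < j \<and> j \<le> i (Suc k) \<and> 0 < s * (-1) ^ Suc k * (D j - D (j - 1))"
proof -
  let ?E = "\<lambda>j. s * (-1) ^ Suc k * D j"
  have "?E (i k) < 0" using i(3)[of k] k by simp
  also have "0 < ?E (i (Suc k))" using i(3)[of "Suc k"] k by simp
  finally obtain j where "i k < j" "j \<le> i (Suc k)" "?E (j - 1) < ?E j"
    using int_step_up[of "i k" "i (Suc k)" ?E] i(2)[OF k] by blast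
  then show ?thesis by (intro exI[of _ j]) (simp add: algebra_simps)
qed

text \<open>A discrete form of Rolle's theorem: vanishing at \<open>-\<infinity>\<close> and at \<open>\<infinity>\<close> each
  contributes one further sign change of the differences.\<close>

lemma alternates_diff:
  fixes D :: "int \<Rightarrow> real"
  assumes alt: "alternates D r" and lim: "(D \<longlongrightarrow> 0) at_bot"
  shows "alternates (\<lambda>i. D i - D (i - 1)) r"
    and "(D \<longlongrightarrow> 0) at_top \<Longrightarrow> alternates (\<lambda>i. D i - D (i - 1)) (Suc r)"
proof -
  from alt obtain i s where i: "s \<in> {1, -1}" "\<And>k. k < r \<Longrightarrow> i k < i (Suc k)"
    "\<And>k. k \<le> r \<Longrightarrow> 0 < s * (-1) ^ k * D (i k)" unfolding alternates_def by blast
  obtain j where j: "\<And>k. k < r \<Longrightarrow> i k < j k \<and> j k \<le> i (Suc k) \<and> 0 < s * (-1) ^ Suc k * (D (j k) - D (j k - 1))"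
    using alternates_steps[of s r i D] i by metis
  have s1: "\<bar>s * (-1) ^ k * x\<bar> = \<bar>x\<bar>" for k x using i(1) by (auto simp: abs_mult)
  \<comment> \<open>Far to the left \<open>D\<close> is smaller in modulus than at the first
    witness, so a step in the direction of the sign of \<open>D (i 0)\<close> occurs before
    it.\<close>
  have "eventually (\<lambda>n. \<bar>D n\<bar> < \<bar>D (i 0)\<bar>) at_bot"
    using lim i(3)[of 0] by (intro order_tendstoD(2)[of _ 0] tendsto_rabs_zero) auto
  moreover have "eventually (\<lambda>n. n < i 0) at_bot"
    using eventually_le_at_bot[of "i 0 - 1"] by (rule eventually_mono) simp
  ultimately have "eventually (\<lambda>n. \<bar>D n\<bar> < \<bar>D (i 0)\<bar> \<and> n < i 0) at_bot" by (rule eventually_conj)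
  then obtain N where N: "\<bar>D N\<bar> < \<bar>D (i 0)\<bar>" "N < i 0" by (auto simp: eventually_at_bot_linorder)
  have "s * D N < s * D (i 0)"
    using N(1) i(3)[of 0] s1[of 0 "D N"] s1[of 0 "D (i 0)"] by (auto simp: abs_if split: if_splits)
  then obtain j0 where j0: "j0 \<le> i 0" "s * D (j0 - 1) < s * D j0"
    using int_step_up[of N "i 0" "\<lambda>j. s * D j"] N(2) by blast
  \<comment> \<open>\<open>J k\<close> is the step that leads up to the witness \<open>i k\<close>;
    the one for \<open>k = 0\<close> comes from the limit at \<open>-\<infinity>\<close>.\<close>
  define J where "J = (\<lambda>k. case k of 0 \<Rightarrow> j0 | Suc k \<Rightarrow> j k)"
  have J_pos: "0 < s * (-1) ^ k * (D (J k) - D (J k - 1))" if "k \<le> r" for k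
    using that j j0 by (cases k) (auto simp: J_def right_diff_distrib)
  have J_le: "J k \<le> i k" if "k \<le> r" for k using that j j0 by (cases k) (auto simp: J_def)
  have J_less: "J k < J (Suc k)" if "k < r" for k
    using J_le[of k] j[OF that] that by (simp add: J_def)
  show "alternates (\<lambda>i. D i - D (i - 1)) r"
    using i(1) J_less J_pos by (rule alternatesI)
  assume "(D \<longlongrightarrow> 0) at_top"
  then have "eventually (\<lambda>n. \<bar>D n\<bar> < \<bar>D (i r)\<bar>) at_top"
    using i(3)[of r] by (intro order_tendstoD(2)[of _ 0] tendsto_rabs_zero) auto
  moreover have "eventually (\<lambda>n. i r < n) at_top" by (rule eventually_gt_at_top)
  ultimately have "eventually (\<lambda>n. \<bar>D n\<bar> < \<bar>D (i r)\<bar> \<and> i r < n) at_top" by (rule eventually_conj)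
  then obtain M where M: "\<bar>D M\<bar> < \<bar>D (i r)\<bar>" "i r < M" by (auto simp: eventually_at_top_linorder)
  have "\<bar>s * (-1) ^ r * D M\<bar> < s * (-1) ^ r * D (i r)"
    using M(1) i(3)[of r] s1[of r "D M"] s1[of r "D (i r)"] by linarith
  then have "s * (-1) ^ Suc r * D (i r) < s * (-1) ^ Suc r * D M" by (simp add: abs_if split: if_splits)
  then obtain j1 where j1: "i r < j1" "s * (-1) ^ Suc r * D (j1 - 1) < s * (-1) ^ Suc r * D j1"
    using int_step_up[of "i r" M "\<lambda>j. s * (-1) ^ Suc r * D j"] M(2) by blast
  define J' where "J' = J(Suc r := j1)"
  have "0 < s * (-1) ^ k * (D (J' k) - D (J' k - 1))" if "k \<le> Suc r" for k
    using that J_pos[of k] j1(2) by (cases "k = Suc r") (auto simp: J'_def right_diff_distrib)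
  moreover have "J' k < J' (Suc k)" if "k < Suc r" for k
    using that J_less[of k] J_le[of r] j1(1) by (cases "k = r") (auto simp: J'_def)
  ultimately show "alternates (\<lambda>i. D i - D (i - 1)) (Suc r)"
    using i(1) by (intro alternatesI[of s _ J'])
qed

text \<open>If \<open>e\<close> has the coefficients of a quotient by \<open>p - q u\<close>, the
  recurrence expression has those of the numerator. After scaling by powers of \<open>p / q\<close>
  it becomes a plain difference, to which the discrete Rolle theorem applies.\<close>

lemma alternates_divide:
  assumes alt: "alternates e r" and pq: "p > 0" "q > 0"
    and lim: "((\<lambda>i. e i * (p / q) powi i) \<longlongrightarrow> 0) at_bot"
  shows "alternates (\<lambda>i. p * e i - q * e (i - 1)) r"
proof -
  let ?D = "\<lambda>i. e i * (p / q) powi i"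
  have "alternates ?D r"
    using alt by (rule alternates_weight) (use pq in \<open>auto intro!: exI[of _ "(p / q) powi _"] simp: mult.commute\<close>)
  then have "alternates (\<lambda>i. ?D i - ?D (i - 1)) r" using lim by (rule alternates_diff(1))
  then show ?thesis
  proof (rule alternates_weight)
    fix i
    have "(p / q) powi i = (p / q) powi (i - 1) * (p / q)"
      using pq power_int_add_1[of "p / q" "i - 1"] by simp
    then have "?D i - ?D (i - 1) = ((p / q) powi (i - 1) / q) * (p * e i - q * e (i - 1))"
      using pq by (simp add: field_simps)
    moreover have "(p / q) powi (i - 1) / q > 0" using pq by simp
    ultimately show "\<exists>w>0. p * e i - q * e (i - 1) = w * (?D i - ?D (i - 1))"
      using pq by (intro exI[of _ "1 / ((p / q) powi (i - 1) / q)"]) simp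
  qed
qed

text \<open>A sum of \<open>m\<close> exponentials has fewer than \<open>m\<close> sign changes.
  Dividing by one exponential makes its term constant, and differencing removes that term at the
  cost of at most one sign change. These sequences are the Laurent coefficients at infinity of a sum
  of simple fractions.\<close>

lemma exponential_sum_alternates:
  fixes w :: "'a \<Rightarrow> real"
  assumes "finite Y" "\<And>y. y \<in> Y \<Longrightarrow> w y > 0"
    and "alternates (\<lambda>i. if i < 0 then \<Sum>y\<in>Y. c y * w y powi (-i - 1) else 0) r"
  shows "r < card Y"
  using assms
proof (induction Y arbitrary: c r rule: finite_induct)
  case empty
  then obtain s i where "\<forall>k\<le>r. 0 < s * (-1) ^ k * (0 :: real)" "s \<in> {1, -1 :: real}"
    by (auto simp: alternates_def cong: if_cong)
  then show ?case by auto
next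
  case (insert v Y)
  show ?case
  proof (cases r)
    case 0
    then show ?thesis using insert by simp
  next
    case (Suc r')
    have pos: "w v > 0" "\<And>y. y \<in> Y \<Longrightarrow> w y > 0" using insert.prems by auto
    define E where "E = (\<lambda>i. if i < 0 then \<Sum>y\<in>insert v Y. c y * w y powi (-i - 1) else 0)"
    define D where "D = (\<lambda>i. E i * w v powi i)"
    let ?c = "\<lambda>y. c y * (1 - w y / w v)"
    let ?e' = "\<lambda>i. if i < 0 then \<Sum>y\<in>Y. ?c y * w y powi (-i - 1) else 0"
    have "alternates D r"
      using insert.prems(2) unfolding E_def[symmetric]
      by (rule alternates_weight) (use pos in \<open>auto intro!: exI[of _ "w v powi _"] simp: D_def mult.commute\<close>)
    then obtain i s where i: "s \<in> {1, -1}" "\<And>k. k < r \<Longrightarrow> i k < i (Suc k)"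
      "\<And>k. k \<le> r \<Longrightarrow> 0 < s * (-1) ^ k * D (i k)" unfolding alternates_def by blast
    obtain j where j: "\<And>k. k < r \<Longrightarrow> i k < j k \<and> j k \<le> i (Suc k) \<and> 0 < s * (-1) ^ Suc k * (D (j k) - D (j k - 1))"
      using alternates_steps[of s r i D] i by metis
    \<comment> \<open>Each term acquires the factor \<open>1 - w y / w v\<close>, which is 0 for
      \<open>y = v\<close>.\<close>
    have diff: "D n - D (n - 1) = w v powi n * ?e' n" if "n < 0" for n
    proof -
      have "c y * w y powi (-n - 1) * w v powi n - c y * w y powi (-(n - 1) - 1) * w v powi (n - 1)
          = w v powi n * (?c y * w y powi (-n - 1))" if "y \<in> insert v Y" for y
      proof -
        have "w y > 0" using that pos by auto
        have "-(n - 1) - 1 = (-n - 1) + 1" by simp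
        then have "w y powi (-(n - 1) - 1) = w y powi (-n - 1) * w y"
          using power_int_add_1[of "w y" "-n - 1"] \<open>w y > 0\<close> by (metis less_irrefl)
        moreover have "w v powi n = w v powi (n - 1) * w v"
          using power_int_add_1[of "w v" "n - 1"] pos by simp
        then have "w v powi (n - 1) = w v powi n / w v" using pos by simp
        ultimately show ?thesis using pos by (simp add: algebra_simps)
      qed
      then have "(\<Sum>y\<in>insert v Y. c y * w y powi (-n - 1) * w v powi n) - (\<Sum>y\<in>insert v Y. c y * w y powi (-(n - 1) - 1) * w v powi (n - 1))
          = (\<Sum>y\<in>insert v Y. w v powi n * (?c y * w y powi (-n - 1)))"
        unfolding sum_subtractf[symmetric] by (intro sum.cong refl)
      also have "\<dots> = w v powi n * ?e' n"
        using that insert.hyps pos by (simp add: sum_distrib_left)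
      finally show ?thesis using that by (simp add: D_def E_def sum_distrib_right)
    qed
    have "alternates ?e' r'"
    proof (rule alternatesI)
      show "- s \<in> {1, -1}" using i(1) by auto
      show "j k < j (Suc k)" if "k < r'" for k using j[of k] j[of "Suc k"] that Suc by force
      fix k assume "k \<le> r'"
      then have k: "k < r" using Suc by simp
      have "E (i (Suc k)) \<noteq> 0" using i(3)[of "Suc k"] k by (auto simp: D_def)
      then have "i (Suc k) < 0" by (simp add: E_def split: if_splits)
      then have "j k < 0" using j[OF k] by linarith
      then have "0 < s * (-1) ^ Suc k * (w v powi j k * ?e' (j k))" using j[OF k] diff[OF \<open>j k < 0\<close>] by simp
      then have "0 < w v powi j k * (- s * (-1) ^ k * ?e' (j k))" by (simp only: power_Suc mult_ac mult_minus_left mult_minus_right mult_1_left)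
      moreover have "w v powi j k > 0" using pos by simp
      ultimately show "0 < - s * (-1) ^ k * ?e' (j k)" using zero_less_mult_pos by blast
    qed
    then have "r' < card Y" using insert.IH[of ?c r'] pos by blast
    then show ?thesis using Suc insert.hyps by simp
  qed
qed

text \<open>Descartes' rule of signs for power series. Dividing the series by \<open>1 - u / v\<close>, where \<open>v\<close>
  is a zero, turns the coefficients into partial sums, which lose a sign change.\<close>

lemma descartes:
  fixes e :: "nat \<Rightarrow> real"
  assumes "finite X" "X \<subseteq> {0<..<\<rho>}" "\<And>k. \<bar>e k\<bar> * \<rho> ^ k \<le> M" "\<And>x. x \<in> X \<Longrightarrow> (\<lambda>k. e k * x ^ k) sums 0"
    and "\<exists>k. e k \<noteq> 0"
  shows "alternates (\<lambda>i. if i < 0 then 0 else e (nat i)) (card X)"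
  using assms
proof (induction X arbitrary: e M rule: finite_induct)
  case empty
  then obtain k where "e k \<noteq> 0" by blast
  then show ?case by (intro alternatesI[of "sgn (e k)" _ "\<lambda>_. int k"]) (auto simp: sgn_if)
next
  case (insert v X)
  have v: "0 < v" "v < \<rho>" using insert.prems(1) by auto
  define S where "S = (\<lambda>k. \<Sum>j\<le>k. e j * v ^ j)"
  define e' where "e' = (\<lambda>k. S k / v ^ k)"
  have v_sum: "(\<lambda>k. e k * v ^ k) sums 0" using insert.prems(3) by simp
  then have S_lim: "S \<longlonglongrightarrow> 0" unfolding S_def sums_def_le .
  \<comment> \<open>Since the whole series sums to 0 at \<open>v\<close>, the partial sum is minus a
    tail and decays like \<open>(v / \<rho>) ^ k\<close>. This restores the growth hypothesis for
    the quotient.\<close>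
  have e'_bound: "\<bar>e' k\<bar> * \<rho> ^ k \<le> M * (v / \<rho>) / (1 - v / \<rho>)" for k
  proof -
    have tail: "(\<lambda>j. e (j + Suc k) * v ^ (j + Suc k)) sums (0 - S k)"
      using sums_split_initial_segment[OF v_sum, of "Suc k"] by (simp add: S_def lessThan_Suc_atMost)
    have geo: "(\<lambda>j. M * (v / \<rho>) ^ Suc k * (v / \<rho>) ^ j) sums (M * (v / \<rho>) ^ Suc k * (1 / (1 - v / \<rho>)))"
      using v by (intro sums_mult geometric_sums) simp
    have le: "\<bar>e (j + Suc k) * v ^ (j + Suc k)\<bar> \<le> M * (v / \<rho>) ^ Suc k * (v / \<rho>) ^ j" for j
    proof -
      have "\<bar>e (j + Suc k) * v ^ (j + Suc k)\<bar> = (\<bar>e (j + Suc k)\<bar> * \<rho> ^ (j + Suc k)) * (v / \<rho>) ^ (j + Suc k)"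
        using v by (simp add: abs_mult power_divide)
      also have "\<dots> \<le> M * (v / \<rho>) ^ (j + Suc k)"
        using v insert.prems(2)[of "j + Suc k"] by (intro mult_right_mono) simp_all
      finally show ?thesis by (simp add: power_add mult_ac)
    qed
    have "\<bar>0 - S k\<bar> \<le> M * (v / \<rho>) ^ Suc k * (1 / (1 - v / \<rho>))"
      using norm_suminf_le[OF _ sums_summable[OF geo], of "\<lambda>j. e (j + Suc k) * v ^ (j + Suc k)"] le
        sums_unique[OF tail] sums_unique[OF geo] by simp
    then have "\<bar>S k\<bar> * (\<rho> / v) ^ k \<le> M * (v / \<rho>) ^ Suc k * (1 / (1 - v / \<rho>)) * (\<rho> / v) ^ k"
      using v by (intro mult_right_mono) auto
    also have "\<dots> = M * (v / \<rho>) / (1 - v / \<rho>) * ((v / \<rho>) * (\<rho> / v)) ^ k"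
    proof -
      have "M * x ^ Suc k * (1 / (1 - x)) * y ^ k = M * x / (1 - x) * (x * y) ^ k" for x y :: real
        by (simp add: power_mult_distrib)
      then show ?thesis .
    qed
    finally show ?thesis using v by (simp add: e'_def power_divide)
  qed
  have rec: "e' (Suc k) = e (Suc k) + e' k / v" for k
    using v by (simp add: e'_def S_def add_divide_distrib)
  have e'0: "e' 0 = e 0" by (simp add: e'_def S_def)
  \<comment> \<open>The recurrence \<open>rec\<close> says that the quotient times
    \<open>1 - x / v\<close> is the old series, and that factor is not 0 as \<open>x\<close> differs
    from \<open>v\<close>.\<close>
  have "(\<lambda>k. e' k * x ^ k) sums 0" if x: "x \<in> X" for x
  proof -
    have x': "0 < x" "x < \<rho>" "x \<noteq> v" using insert.prems(1) insert.hyps x by auto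
    have le: "norm (e' k * x ^ k) \<le> (M * (v / \<rho>) / (1 - v / \<rho>)) * (x / \<rho>) ^ k" for k
    proof -
      have "norm (e' k * x ^ k) = (\<bar>e' k\<bar> * \<rho> ^ k) * (x / \<rho>) ^ k"
        using x' by (simp add: abs_mult power_divide)
      also have "\<dots> \<le> (M * (v / \<rho>) / (1 - v / \<rho>)) * (x / \<rho>) ^ k"
        using x' e'_bound[of k] by (intro mult_right_mono) auto
      finally show ?thesis .
    qed
    have "summable (\<lambda>k. (M * (v / \<rho>) / (1 - v / \<rho>)) * (x / \<rho>) ^ k)"
      using x' by (intro summable_mult summable_geometric) auto
    then have "summable (\<lambda>k. e' k * x ^ k)" by (rule summable_comparison_test'[of _ 0]) (rule le)
    then obtain \<sigma> where \<sigma>: "(\<lambda>k. e' k * x ^ k) sums \<sigma>" by (auto simp: summable_def)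
    have "(\<lambda>k. e' (Suc k) * x ^ Suc k) sums (\<sigma> - e' 0)"
      using \<sigma> by (subst sums_Suc_iff) simp
    moreover have "(\<lambda>k. e (Suc k) * x ^ Suc k) sums (0 - e 0)"
      using insert.prems(3)[of x] x by (subst sums_Suc_iff) simp
    then have "(\<lambda>k. e (Suc k) * x ^ Suc k + (x / v) * (e' k * x ^ k)) sums ((0 - e 0) + (x / v) * \<sigma>)"
      using \<sigma> by (intro sums_add sums_mult)
    moreover have "e' (Suc k) * x ^ Suc k = e (Suc k) * x ^ Suc k + (x / v) * (e' k * x ^ k)" for k
      by (simp add: rec algebra_simps)
    ultimately have "\<sigma> - e' 0 = (0 - e 0) + (x / v) * \<sigma>" using sums_unique2 by (metis (no_types, lifting) sums_cong)
    then have "\<sigma> * (1 - x / v) = 0" by (simp add: e'0 algebra_simps)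
    then have "\<sigma> = 0" using x' v by simp
    then show ?thesis using \<sigma> by simp
  qed
  moreover have "\<exists>k. e' k \<noteq> 0"
  proof (rule ccontr)
    assume "\<not> ?thesis"
    then have z: "e' k = 0" for k by blast
    have "e k = 0" for k
      using e'0 rec[of "k - 1"] by (cases k) (simp_all add: z)
    then show False using insert.prems(4) by blast
  qed
  ultimately have "alternates (\<lambda>i. if i < 0 then 0 else e' (nat i)) (card X)"
    using insert.prems(1) e'_bound by (intro insert.IH) auto
  then have alt: "alternates (\<lambda>i. if i < 0 then 0 else S (nat i)) (card X)"
  proof (rule alternates_weight)
    fix i :: int
    show "\<exists>w>0. (if i < 0 then 0 else S (nat i)) = w * (if i < 0 then 0 else e' (nat i))"
      using v by (intro exI[of _ "v ^ nat i"]) (simp add: e'_def)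
  qed
  have bot: "((\<lambda>i :: int. if i < 0 then 0 else S (nat i)) \<longlongrightarrow> 0) at_bot"
    by (rule tendsto_eventually) (use eventually_le_at_bot[of "-1::int"] in \<open>eventually_elim, simp\<close>)
  have "((\<lambda>i. S (nat i)) \<longlongrightarrow> 0) (at_top :: int filter)"
    using S_lim filterlim_nat_sequentially by (rule filterlim_compose)
  then have top: "((\<lambda>i :: int. if i < 0 then 0 else S (nat i)) \<longlongrightarrow> 0) at_top"
    by (rule Lim_transform_eventually) (use eventually_ge_at_top[of "0::int"] in \<open>eventually_elim, simp\<close>)
  \<comment> \<open>The partial sums tend to 0 at both ends, so differencing them gains one sign
    change; the differences are the original coefficients with positive weights.\<close>
  have "alternates (\<lambda>i. (if i < 0 then 0 else S (nat i)) - (if i - 1 < 0 then 0 else S (nat (i - 1)))) (Suc (card X))"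
    using alternates_diff(2)[OF alt bot top] .
  then have "alternates (\<lambda>i. if i < 0 then 0 else e (nat i)) (Suc (card X))"
  proof (rule alternates_weight)
    fix i :: int
    have "S (nat i) - (if i - 1 < 0 then 0 else S (nat (i - 1))) = e (nat i) * v ^ nat i" if "i \<ge> 0"
    proof (cases "nat i")
      case (Suc k)
      then have "nat (i - 1) = k" "\<not> i - 1 < 0" by auto
      then show ?thesis using Suc by (simp add: S_def)
    qed (use that in \<open>simp add: S_def\<close>)
    then show "\<exists>w>0. (if i < 0 then 0 else e (nat i))
        = w * ((if i < 0 then 0 else S (nat i)) - (if i - 1 < 0 then 0 else S (nat (i - 1))))"
      using v by (intro exI[of _ "1 / v ^ nat i"]) auto
  qed
  then show ?case using insert.hyps by simp
qed

section \<open>Laurent coefficients\<close>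

lemma power_int_minus_Suc: "u powi (- int k - 1) = 1 / u ^ Suc k" for u :: "'a::field"
proof -
  have "- int k - 1 = - int (Suc k)" by simp
  then have "u powi (- int k - 1) = inverse (u powi int (Suc k))" by (simp only: power_int_minus)
  then show ?thesis by (simp only: power_int_of_nat) (simp add: inverse_eq_divide)
qed

lemma power_int_tendsto_0_at_bot:
  fixes x :: real
  assumes "x > 1"
  shows "((\<lambda>i :: int. x powi i) \<longlongrightarrow> 0) at_bot"
proof -
  have "filterlim (\<lambda>i :: int. - i) at_top at_bot"
    unfolding filterlim_at_top
  proof
    fix Z :: int
    show "eventually (\<lambda>i. Z \<le> - i) at_bot"
      using eventually_le_at_bot[of "- Z"] by (rule eventually_mono) simp
  qed
  then have "filterlim (\<lambda>i :: int. nat (- i)) at_top at_bot"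
    by (rule filterlim_compose[OF filterlim_nat_sequentially])
  then have "((\<lambda>i :: int. (1 / x) ^ nat (- i)) \<longlongrightarrow> 0) at_bot"
    using assms by (intro filterlim_compose[OF LIMSEQ_realpow_zero]) auto
  then show ?thesis
  proof (rule Lim_transform_eventually)
    show "eventually (\<lambda>i :: int. (1 / x) ^ nat (- i) = x powi i) at_bot"
      using eventually_le_at_bot[of 0]
    proof (rule eventually_mono)
      fix i :: int assume "i \<le> 0"
      then have "x powi i = inverse (x powi (- i))" by (simp add: power_int_minus)
      also have "x powi (- i) = x ^ nat (- i)" using \<open>i \<le> 0\<close> by (simp add: power_int_def)
      finally show "(1 / x) ^ nat (- i) = x powi i" by (simp add: power_one_over inverse_eq_divide)
    qed
  qed
qed

text \<open>\<open>exp z\<close> is the \<open>n\<close>-th power of \<open>exp (z / n)\<close>,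
  whose distance from \<open>1 + z / n\<close> is of second order.\<close>

lemma norm_exp_minus_power_le:
  fixes z :: complex
  assumes "norm z \<le> R" "n > 0"
  shows "norm (exp z - (1 + z / of_nat n) ^ n) \<le> exp (2 * R) * R\<^sup>2 / real n"
proof -
  define x where "x = exp (z / of_nat n)"
  define y where "y = 1 + z / of_nat n"
  define M where "M = exp (R / real n)"
  have R: "R \<ge> 0" using assms(1) norm_ge_zero order.trans by blast
  have zn: "norm (z / of_nat n) \<le> R / real n" using assms by (simp add: norm_divide divide_right_mono)
  have "R / real n \<le> R / 1" using R assms(2) by (intro divide_left_mono) auto
  then have Rn: "R / real n \<le> R" by simp
  have M: "M \<ge> 1" using R by (simp add: M_def)
  have "norm x \<le> exp (norm (z / of_nat n))" unfolding x_def by (rule norm_exp)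
  also have "\<dots> \<le> M" using zn by (simp add: M_def)
  finally have xM: "norm x \<le> M" .
  have "norm y \<le> 1 + norm (z / of_nat n)" unfolding y_def using norm_triangle_ineq[of 1 "z / of_nat n"] by simp
  also have "\<dots> \<le> 1 + R / real n" using zn by simp
  also have "\<dots> \<le> M" unfolding M_def by (rule exp_ge_add_one_self)
  finally have yM: "norm y \<le> M" .
  have "norm (exp z - y ^ n) = norm (x ^ n - y ^ n)" using assms(2) by (simp add: x_def exp_divide_power_eq)
  \<comment> \<open>\<open>norm_power_diff\<close> wants points of the unit disc, hence the scaling
    by \<open>M\<close>; the lost factor \<open>M ^ n\<close> is just \<open>exp R\<close>.\<close>
  also have "x ^ n - y ^ n = of_real (M ^ n) * ((x / of_real M) ^ n - (y / of_real M) ^ n)"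
    using M by (simp add: power_divide field_simps)
  also have "norm \<dots> = M ^ n * norm ((x / of_real M) ^ n - (y / of_real M) ^ n)"
    using M by (simp add: norm_mult norm_power)
  also have "norm ((x / of_real M) ^ n - (y / of_real M) ^ n) \<le> real n * norm (x / of_real M - y / of_real M)"
    using xM yM M by (intro norm_power_diff) (auto simp: norm_divide)
  also have "norm (x / of_real M - y / of_real M) = norm (x - y) / M"
    using M by (simp add: norm_divide flip: diff_divide_distrib)
  also have "norm (x - y) / M \<le> norm (x - y) / 1" using M by (intro divide_left_mono) auto
  also have "norm (x - y) / 1 \<le> exp R * (R / real n)\<^sup>2"
  proof -
    have "norm (x - y) \<le> exp (norm (z / of_nat n)) * (norm (z / of_nat n) ^ Suc 1) / fact 1"
      using Taylor_exp_field[of "z / of_nat n" 1] by (simp add: x_def y_def diff_diff_eq)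
    also have "\<dots> = exp (norm (z / of_nat n)) * (norm (z / of_nat n))\<^sup>2" by (simp add: power2_eq_square)
    also have "\<dots> \<le> exp R * (R / real n)\<^sup>2"
      using zn Rn by (intro mult_mono power_mono) auto
    finally show ?thesis by simp
  qed
  finally have "norm (exp z - y ^ n) \<le> M ^ n * (real n * (exp R * (R / real n)\<^sup>2))"
    using M by (simp add: mult_left_mono)
  also have "M ^ n = exp R" using assms(2) by (simp add: M_def exp_divide_power_eq)
  also have "exp R * (real n * (exp R * (R / real n)\<^sup>2)) = exp (2 * R) * R\<^sup>2 / real n"
    using assms(2) by (simp add: power2_eq_square field_simps mult_exp_exp)
  finally show ?thesis by (simp add: y_def)
qed

section \<open>Products with a sum of simple fractions on a circle\<close>

locale cauchy_kernel =
  fixes \<rho> :: real and Y :: "real set" and c :: "real \<Rightarrow> real"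
  assumes rho: "\<rho> > 0" and Y: "finite Y" "Y \<subseteq> {0<..<\<rho>}"
begin

definition cauchy :: "complex \<Rightarrow> complex" where
  "cauchy u = (\<Sum>v\<in>Y. of_real (c v) / (u - of_real v))"

text \<open>Laurent coefficients of \<open>H u * cauchy u\<close> on the circle, which encloses all
  poles of \<open>cauchy\<close>. They make sense for merely continuous \<open>H\<close>.\<close>

definition laurent :: "(complex \<Rightarrow> complex) \<Rightarrow> int \<Rightarrow> complex" where
  "laurent H i = contour_integral (circlepath 0 \<rho>) (\<lambda>u. H u * cauchy u * u powi (- i - 1)) / (2 * pi * \<i>)"

lemma Y_ne:
  assumes "u \<in> sphere 0 \<rho>" "v \<in> Y"
  shows "u \<noteq> complex_of_real v"
proof
  assume "u = complex_of_real v"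
  moreover have "0 < v" "v < \<rho>" using assms(2) Y(2) by auto
  ultimately show False using assms(1) by simp
qed

lemma quotient_continuous:
  fixes f :: "complex \<Rightarrow> complex"
  assumes "v \<in> Y" "continuous_on (sphere 0 \<rho>) f"
  shows "continuous_on (sphere 0 \<rho>) (\<lambda>u. f u / (u - of_real v))"
  using Y_ne[OF _ assms(1)] by (intro continuous_on_divide assms(2) continuous_intros) (simp add: eq_iff_diff_eq_0[symmetric])

lemma cauchy_continuous: "continuous_on (sphere 0 \<rho>) cauchy"
  unfolding cauchy_def[abs_def] by (intro continuous_on_sum quotient_continuous continuous_on_const)

lemma power_continuous: "continuous_on (sphere 0 \<rho>) (\<lambda>u :: complex. u powi i)"
  using rho by (intro continuous_intros) auto

lemma integrable:
  assumes "continuous_on (sphere 0 \<rho>) f"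
  shows "f contour_integrable_on circlepath 0 \<rho>"
  using assms rho by (intro contour_integrable_continuous_circlepath) simp

lemma integrand_integrable:
  assumes "continuous_on (sphere 0 \<rho>) H"
  shows "(\<lambda>u. H u * cauchy u * u powi i) contour_integrable_on circlepath 0 \<rho>"
  by (intro integrable continuous_intros assms cauchy_continuous power_continuous)

lemma laurent_cong:
  assumes "\<And>u. u \<in> sphere 0 \<rho> \<Longrightarrow> H u = H' u"
  shows "laurent H i = laurent H' i"
  unfolding laurent_def using assms rho by (intro arg_cong2[of _ _ _ _ "(/)"] contour_integral_eq) auto

lemma laurent_linear:
  assumes "continuous_on (sphere 0 \<rho>) H"
  shows "laurent (\<lambda>u. (p + q * u) * H u) i = p * laurent H i + q * laurent H (i - 1)"
proof -
  let ?I = "\<lambda>i u. H u * cauchy u * u powi (- i - 1)"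
  have int: "(\<lambda>u. q * ?I i u) contour_integrable_on circlepath 0 \<rho>" for q i
    by (intro contour_integrable_lmul integrand_integrable assms)
  have "contour_integral (circlepath 0 \<rho>) (\<lambda>u. (p + q * u) * H u * cauchy u * u powi (- i - 1))
      = contour_integral (circlepath 0 \<rho>) (\<lambda>u. p * ?I i u + q * ?I (i - 1) u)"
  proof (rule contour_integral_eq)
    fix u assume "u \<in> path_image (circlepath 0 \<rho>)"
    then have "u \<noteq> 0" using rho by auto
    then have "u * u powi (- i - 1) = u powi (- (i - 1) - 1)"
      using power_int_add_1'[of u "- i - 1"] by simp
    then show "(p + q * u) * H u * cauchy u * u powi (- i - 1) = p * ?I i u + q * ?I (i - 1) u"
      by (simp add: algebra_simps)
  qed
  also have "\<dots> = p * contour_integral (circlepath 0 \<rho>) (?I i) + q * contour_integral (circlepath 0 \<rho>) (?I (i - 1))"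
    by (simp only: contour_integral_add[OF int int] contour_integral_lmul integrand_integrable[OF assms])
  finally show ?thesis by (simp add: laurent_def add_divide_distrib)
qed

lemma laurent_bound:
  assumes "continuous_on (sphere 0 \<rho>) H"
  shows "\<exists>M\<ge>0. \<forall>i. norm (laurent H i) \<le> M * \<rho> powi (- i)"
proof -
  have "compact ((\<lambda>u. H u * cauchy u) ` sphere 0 \<rho>)"
    by (intro compact_continuous_image continuous_intros assms cauchy_continuous) auto
  then have "bounded ((\<lambda>u. H u * cauchy u) ` sphere 0 \<rho>)" by (rule compact_imp_bounded)
  then obtain M where M': "M > 0" "\<forall>x\<in>(\<lambda>u. H u * cauchy u) ` sphere 0 \<rho>. norm x \<le> M"
    unfolding bounded_pos by blast
  then have M: "\<And>u. u \<in> sphere 0 \<rho> \<Longrightarrow> norm (H u * cauchy u) \<le> M" "M > 0" by auto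
  have "norm (laurent H i) \<le> M * \<rho> powi (- i)" for i
  proof -
    let ?I = "contour_integral (circlepath 0 \<rho>) (\<lambda>u. H u * cauchy u * u powi (- i - 1))"
    have "norm ?I \<le> (M * \<rho> powi (- i - 1)) * (2 * pi * \<rho>)"
    proof (rule has_contour_integral_bound_circlepath)
      show "((\<lambda>u. H u * cauchy u * u powi (- i - 1)) has_contour_integral ?I) (circlepath 0 \<rho>)"
        by (intro has_contour_integral_integral integrand_integrable assms)
      show "norm (H u * cauchy u * u powi (- i - 1)) \<le> M * \<rho> powi (- i - 1)" if "norm (u - 0) = \<rho>" for u
      proof -
        have "norm (H u * cauchy u) \<le> M" using M(1)[of u] that by simp
        then have "norm (H u * cauchy u) * \<rho> powi (- i - 1) \<le> M * \<rho> powi (- i - 1)"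
          using rho by (intro mult_right_mono) auto
        then show ?thesis using that by (simp add: norm_mult norm_power_int)
      qed
    qed (use M rho in auto)
    also have "\<dots> = M * (\<rho> powi (- i - 1) * \<rho>) * (2 * pi)" by simp
    also have "\<rho> powi (- i - 1) * \<rho> = \<rho> powi (- i)"
      using power_int_add_1[of \<rho> "- i - 1"] rho by simp
    finally show ?thesis by (simp add: laurent_def norm_divide norm_mult field_simps)
  qed
  then show ?thesis using M(2) by (intro exI[of _ M]) auto
qed

lemma integral_power_int:
  "contour_integral (circlepath 0 \<rho>) (\<lambda>u. u powi (- int k - 1)) = (if k = 0 then 2 * pi * \<i> else 0)"
proof -
  have "((\<lambda>u. 1 / (u - 0) ^ Suc k) has_contour_integral ((2 * pi * \<i>) / fact k * (deriv ^^ k) (\<lambda>_. 1) 0)) (circlepath 0 \<rho>)"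
    using rho by (intro Cauchy_has_contour_integral_higher_derivative_circlepath) auto
  moreover have "1 / (u - 0) ^ Suc k = u powi (- int k - 1)" for u :: complex
    by (simp only: power_int_minus_Suc diff_zero)
  ultimately show ?thesis using contour_integral_unique by (fastforce simp: higher_deriv_const)
qed

text \<open>For negative \<open>i\<close> this is Cauchy's formula. For \<open>i \<ge> 0\<close> the
  contributions of 0 and \<open>v\<close> cancel; the identity
  \<open>v / (u - v) = u / (u - v) - 1\<close> gives a recursion that starts from
  \<open>i = -1\<close>.\<close>

lemma integral_cauchy_power:
  assumes v: "v \<in> Y"
  shows "contour_integral (circlepath 0 \<rho>) (\<lambda>u. u powi (- i - 1) / (u - of_real v))
    = (if i < 0 then 2 * pi * \<i> * of_real v powi (- i - 1) else 0)"
proof -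
  have v': "0 < v" "v < \<rho>" using v Y by auto
  let ?J = "\<lambda>i. contour_integral (circlepath 0 \<rho>) (\<lambda>u. u powi (- i - 1) / (u - of_real v))"
  have neg: "?J i = 2 * pi * \<i> * of_real v powi (- i - 1)" if "i < 0" for i
  proof -
    have "0 \<le> - i - 1" using that by simp
    then obtain n where n: "- i - 1 = int n" using zero_le_imp_eq_int by blast
    have "((\<lambda>u. u ^ n / (u - of_real v)) has_contour_integral (2 * of_real pi * \<i> * of_real v ^ n)) (circlepath 0 \<rho>)"
      using v' by (intro Cauchy_integral_circlepath continuous_intros holomorphic_intros) auto
    then show ?thesis using contour_integral_unique by (fastforce simp: n)
  qed
  have cont: "continuous_on (sphere 0 \<rho>) (\<lambda>u :: complex. u powi j / (u - of_real v))" for j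
    by (intro quotient_continuous v power_continuous)
  have rec: "of_real v * ?J i = ?J (i - 1) - contour_integral (circlepath 0 \<rho>) (\<lambda>u. u powi (- i - 1))" for i
  proof -
    have "of_real v * ?J i = contour_integral (circlepath 0 \<rho>) (\<lambda>u. of_real v * (u powi (- i - 1) / (u - of_real v)))"
      by (subst contour_integral_lmul) (auto intro: integrable cont)
    also have "\<dots> = contour_integral (circlepath 0 \<rho>) (\<lambda>u. u powi (- (i - 1) - 1) / (u - of_real v) - u powi (- i - 1))"
    proof (rule contour_integral_eq)
      fix u assume u: "u \<in> path_image (circlepath 0 \<rho>)"
      then have "u \<noteq> 0" "u \<noteq> of_real v" using Y_ne[OF _ v, of u] rho by auto
      then have "u powi (- (i - 1) - 1) = u * u powi (- i - 1)"
        using power_int_add_1'[of u "- i - 1"] by simp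
      then show "of_real v * (u powi (- i - 1) / (u - of_real v)) = u powi (- (i - 1) - 1) / (u - of_real v) - u powi (- i - 1)"
        using \<open>u \<noteq> of_real v\<close> by (simp add: field_simps)
    qed
    also have "\<dots> = ?J (i - 1) - contour_integral (circlepath 0 \<rho>) (\<lambda>u. u powi (- i - 1))"
      by (intro contour_integral_diff integrable cont power_continuous)
    finally show ?thesis .
  qed
  have "?J (int k) = 0" for k
  proof (induction k)
    case 0
    have "of_real v * ?J 0 = 0"
      using rec[of 0] neg[of "-1"] integral_power_int[of 0] by simp
    then show ?case using v' by simp
  next
    case (Suc k)
    have "of_real v * ?J (int (Suc k)) = 0"
      using rec[of "int (Suc k)"] Suc integral_power_int[of "Suc k"] by simp
    then show ?case using v' by simp
  qed
  from this[of "nat i"] neg[of i] show ?thesis by auto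
qed

lemma laurent_one:
  "laurent (\<lambda>_. 1) i = (if i < 0 then \<Sum>v\<in>Y. of_real (c v) * of_real v powi (- i - 1) else 0)"
proof -
  have "contour_integral (circlepath 0 \<rho>) (\<lambda>u. 1 * cauchy u * u powi (- i - 1))
      = contour_integral (circlepath 0 \<rho>) (\<lambda>u. \<Sum>v\<in>Y. of_real (c v) * (u powi (- i - 1) / (u - of_real v)))"
    by (simp add: cauchy_def sum_distrib_right)
  also have "\<dots> = (\<Sum>v\<in>Y. contour_integral (circlepath 0 \<rho>) (\<lambda>u. of_real (c v) * (u powi (- i - 1) / (u - of_real v))))"
    by (intro contour_integral_sum Y integrable continuous_on_mult continuous_on_const quotient_continuous power_continuous)
  also have "\<dots> = (\<Sum>v\<in>Y. of_real (c v) * (if i < 0 then 2 * pi * \<i> * of_real v powi (- i - 1) else 0))"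
  proof (intro sum.cong refl)
    fix v assume v: "v \<in> Y"
    have "(\<lambda>u. u powi (- i - 1) / (u - of_real v)) contour_integrable_on circlepath 0 \<rho>"
      by (intro integrable quotient_continuous v power_continuous)
    then show "contour_integral (circlepath 0 \<rho>) (\<lambda>u. of_real (c v) * (u powi (- i - 1) / (u - of_real v)))
        = of_real (c v) * (if i < 0 then 2 * pi * \<i> * of_real v powi (- i - 1) else 0)"
      by (simp only: contour_integral_lmul integral_cauchy_power[OF v])
  qed
  finally have "laurent (\<lambda>_. 1) i = (\<Sum>v\<in>Y. of_real (c v) * (if i < 0 then 2 * pi * \<i> * of_real v powi (- i - 1) else 0) / (2 * pi * \<i>))"
    by (simp only: laurent_def sum_divide_distrib)
  moreover have "x * (k * y) / k = x * y" if "k \<noteq> 0" for x y k :: complex using that by simp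
  from this[of "2 * pi * \<i>"]
  have "of_real (c v) * (if i < 0 then 2 * pi * \<i> * of_real v powi (- i - 1) else 0) / (2 * pi * \<i>)
      = (if i < 0 then of_real (c v) * of_real v powi (- i - 1) else 0 :: complex)" for v by simp
  ultimately show ?thesis by simp
qed

text \<open>For nonnegative indices the singular part of \<open>H u * cauchy u\<close> does not contribute.\<close>

lemma laurent_taylor:
  assumes H: "H holomorphic_on ball 0 R" and R: "\<rho> < R"
  shows "laurent H (int k) = (deriv ^^ k) (\<lambda>u. \<Sum>v\<in>Y. of_real (c v) * complex_loewner H (of_real v) u) 0 / fact k"
proof -
  let ?G = "\<lambda>u. \<Sum>v\<in>Y. of_real (c v) * complex_loewner H (of_real v) u"
  have G: "?G holomorphic_on ball 0 R"
    by (intro holomorphic_intros holomorphic_complex_loewner H) auto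
  have sub: "sphere 0 \<rho> \<subseteq> ball (0::complex) R" "cball 0 \<rho> \<subseteq> ball (0::complex) R" "ball 0 \<rho> \<subseteq> ball (0::complex) R"
    using R by auto
  have Gc: "continuous_on (ball 0 R) ?G" using G by (rule holomorphic_on_imp_continuous_on)
  have "contour_integral (circlepath 0 \<rho>) (\<lambda>u. H u * cauchy u * u powi (- int k - 1))
    = contour_integral (circlepath 0 \<rho>) (\<lambda>u. ?G u * u powi (- int k - 1)
        + (\<Sum>v\<in>Y. of_real (c v) * H (of_real v) * (u powi (- int k - 1) / (u - of_real v))))"
  proof (rule contour_integral_eq)
    fix u assume "u \<in> path_image (circlepath 0 \<rho>)"
    then have u: "u \<in> sphere 0 \<rho>" using rho by simp
    \<comment> \<open>Splitting off the value at the pole leaves the holomorphic difference quotient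
      plus a pure simple fraction.\<close>
    have "H u * (of_real (c v) / (u - of_real v))
        = of_real (c v) * complex_loewner H (of_real v) u + of_real (c v) * H (of_real v) / (u - of_real v)" if "v \<in> Y" for v
      using Y_ne[OF u that] by (simp add: complex_loewner_def diff_divide_distrib right_diff_distrib mult_ac)
    then have "H u * cauchy u = ?G u + (\<Sum>v\<in>Y. of_real (c v) * H (of_real v) / (u - of_real v))"
      unfolding cauchy_def sum_distrib_left sum.distrib[symmetric] by (intro sum.cong refl)
    then show "H u * cauchy u * u powi (- int k - 1) = ?G u * u powi (- int k - 1)
        + (\<Sum>v\<in>Y. of_real (c v) * H (of_real v) * (u powi (- int k - 1) / (u - of_real v)))"
      by (simp add: distrib_right sum_distrib_right)
  qed
  also have "\<dots> = contour_integral (circlepath 0 \<rho>) (\<lambda>u. ?G u * u powi (- int k - 1))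
      + (\<Sum>v\<in>Y. contour_integral (circlepath 0 \<rho>) (\<lambda>u. of_real (c v) * H (of_real v) * (u powi (- int k - 1) / (u - of_real v))))"
  proof -
    have 1: "(\<lambda>u. ?G u * u powi (- int k - 1)) contour_integrable_on circlepath 0 \<rho>"
      by (intro integrable continuous_on_mult power_continuous continuous_on_subset[OF Gc sub(1)])
    have 2: "(\<lambda>u. of_real (c v) * H (of_real v) * (u powi (- int k - 1) / (u - of_real v))) contour_integrable_on circlepath 0 \<rho>"
      if "v \<in> Y" for v
      by (intro integrable continuous_on_mult continuous_on_const quotient_continuous that power_continuous)
    show ?thesis
      by (subst contour_integral_add[OF 1 contour_integrable_sum[OF Y(1) 2]], assumption)
         (subst contour_integral_sum[OF Y(1) 2], assumption, rule refl)
  qed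
  also have "(\<Sum>v\<in>Y. contour_integral (circlepath 0 \<rho>) (\<lambda>u. of_real (c v) * H (of_real v) * (u powi (- int k - 1) / (u - of_real v)))) = 0"
  proof (rule sum.neutral, rule ballI)
    fix v assume v: "v \<in> Y"
    have "(\<lambda>u. u powi (- int k - 1) / (u - of_real v)) contour_integrable_on circlepath 0 \<rho>"
      by (intro integrable quotient_continuous v power_continuous)
    then show "contour_integral (circlepath 0 \<rho>) (\<lambda>u. of_real (c v) * H (of_real v) * (u powi (- int k - 1) / (u - of_real v))) = 0"
      by (simp only: contour_integral_lmul integral_cauchy_power[OF v]) simp
  qed
  also have "contour_integral (circlepath 0 \<rho>) (\<lambda>u. ?G u * u powi (- int k - 1))
      = contour_integral (circlepath 0 \<rho>) (\<lambda>u. ?G u / (u - 0) ^ Suc k)"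
    by (simp only: power_int_minus_Suc) simp
  also have "\<dots> = (2 * pi * \<i>) * (deriv ^^ k) ?G 0 / fact k"
    using rho by (intro Cauchy_contour_integral_circlepath continuous_on_subset[OF Gc sub(2)] holomorphic_on_subset[OF G sub(3)]) auto
  finally show ?thesis by (simp add: laurent_def)
qed

lemma laurent_uniform_limit:
  assumes cont: "\<And>n. continuous_on (sphere 0 \<rho>) (H n)" and lim: "uniform_limit (sphere 0 \<rho>) H H' sequentially"
  shows "(\<lambda>n. laurent (H n) i) \<longlonglongrightarrow> laurent H' i"
proof -
  let ?w = "\<lambda>u. cauchy u * u powi (- i - 1)"
  have H': "continuous_on (sphere 0 \<rho>) H'"
    using uniform_limit_theorem[OF _ lim] cont by auto
  have w: "continuous_on (sphere 0 \<rho>) ?w" by (intro continuous_intros cauchy_continuous power_continuous)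
  have "uniform_limit (sphere 0 \<rho>) (\<lambda>n u. H n u * ?w u) (\<lambda>u. H' u * ?w u) sequentially"
    using w H' by (intro uniform_lim_mult lim uniform_limit_const compact_imp_bounded compact_continuous_image) auto
  then have "uniform_limit (sphere 0 \<rho>) (\<lambda>n u. H n u * cauchy u * u powi (- i - 1)) (\<lambda>u. H' u * cauchy u * u powi (- i - 1)) sequentially"
    by (simp only: mult.assoc)
  then have "(\<lambda>n. contour_integral (circlepath 0 \<rho>) (\<lambda>u. H n u * cauchy u * u powi (- i - 1)))
      \<longlonglongrightarrow> contour_integral (circlepath 0 \<rho>) (\<lambda>u. H' u * cauchy u * u powi (- i - 1))"
    using rho integrand_integrable[OF cont] by (intro contour_integral_uniform_limit_circlepath) auto
  then show ?thesis unfolding laurent_def by (intro tendsto_intros) auto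
qed

text \<open>The class \<open>good\<close> contains 1 and is closed under the operations that build a Polya frequency
  series: variation diminution of totally positive sequences.\<close>

definition good :: "(complex \<Rightarrow> complex) \<Rightarrow> bool" where
  "good H \<longleftrightarrow> continuous_on (sphere 0 \<rho>) H \<and> (\<forall>r. alternates (\<lambda>i. Re (laurent H i)) r \<longrightarrow> r < card Y)"

lemma good_cong:
  assumes "\<And>u. u \<in> sphere 0 \<rho> \<Longrightarrow> H u = H' u"
  shows "good H \<longleftrightarrow> good H'"
proof -
  have "laurent H = laurent H'" using laurent_cong[OF assms] by (intro ext)
  moreover have "continuous_on (sphere 0 \<rho>) H \<longleftrightarrow> continuous_on (sphere 0 \<rho>) H'"
    using assms by (intro continuous_on_cong) auto
  ultimately show ?thesis by (simp only: good_def)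
qed

lemma good_one: "good (\<lambda>_. 1)"
proof -
  have "Re (laurent (\<lambda>_. 1) i) = (if i < 0 then \<Sum>v\<in>Y. c v * v powi (- i - 1) else 0)" for i
    by (simp add: laurent_one flip: of_real_power_int of_real_mult)
  then show ?thesis
    using exponential_sum_alternates[OF Y(1), of "\<lambda>v. v" c] Y(2) unfolding good_def
    by (auto simp only: subset_iff greaterThanLessThan_iff continuous_on_const)
qed

lemma good_linear:
  assumes H: "good H" and pq: "p \<ge> 0" "q \<ge> 0"
  shows "good (\<lambda>u. (of_real p + of_real q * u) * H u)"
proof -
  have cont: "continuous_on (sphere 0 \<rho>) H" using H by (simp add: good_def)
  have "Re (laurent (\<lambda>u. (of_real p + of_real q * u) * H u) i) = p * Re (laurent H i) + q * Re (laurent H (i - 1))" for i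
    by (subst laurent_linear[OF cont]) simp
  then have eq: "(\<lambda>i. Re (laurent (\<lambda>u. (of_real p + of_real q * u) * H u) i))
      = (\<lambda>i. p * Re (laurent H i) + q * Re (laurent H (i - 1)))" by (rule ext)
  have "r < card Y" if "alternates (\<lambda>i. p * Re (laurent H i) + q * Re (laurent H (i - 1))) r" for r
  proof -
    have "alternates (\<lambda>i. Re (laurent H i)) r" using that pq by (rule alternates_mult)
    then show ?thesis using H unfolding good_def by blast
  qed
  then show ?thesis unfolding good_def eq using cont by (auto intro!: continuous_intros)
qed

text \<open>The zero \<open>p / q\<close> of the denominator lies outside the circle. Laurent
  coefficients are bounded by a multiple of \<open>\<rho> powi (- i)\<close>, so after weighting by
  \<open>(p / q) powi i\<close> they still tend to 0 at \<open>-\<infinity>\<close>, as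
  \<open>alternates_divide\<close> requires.\<close>

lemma good_divide_linear:
  assumes H: "good H" and q: "q \<ge> 0" and p: "q * \<rho> < p"
  shows "good (\<lambda>u. H u / (of_real p - of_real q * u))"
proof (cases "q = 0")
  case True
  then show ?thesis using good_linear[OF H, of "1 / p" 0] p by simp
next
  case False
  have qp: "q > 0" "p > 0" using q False p rho by (auto intro: le_less_trans[of 0 "q * \<rho>"])
  let ?H = "\<lambda>u. H u / (of_real p - of_real q * u)"
  have ne: "of_real p - of_real q * u \<noteq> 0" if "u \<in> sphere 0 \<rho>" for u :: complex
  proof
    assume "of_real p - of_real q * u = 0"
    then have "complex_of_real p = of_real q * u" by simp
    from arg_cong[OF this, of norm] have "p = q * \<rho>" using that qp by (simp add: norm_mult)
    then show False using p by simp
  qed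
  have cont: "continuous_on (sphere 0 \<rho>) H" using H by (simp add: good_def)
  have cont': "continuous_on (sphere 0 \<rho>) ?H" using ne by (intro continuous_intros cont) auto
  have "laurent H i = laurent (\<lambda>u. (of_real p + of_real (- q) * u) * ?H u) i" for i
    using ne by (intro laurent_cong) auto
  then have rec: "Re (laurent H i) = p * Re (laurent ?H i) - q * Re (laurent ?H (i - 1))" for i
    by (subst (asm) laurent_linear[OF cont']) simp
  obtain M where M: "M \<ge> 0" "\<And>i. norm (laurent ?H i) \<le> M * \<rho> powi (- i)"
    using laurent_bound[OF cont'] by blast
  have lim: "((\<lambda>i. Re (laurent ?H i) * (p / q) powi i) \<longlongrightarrow> 0) at_bot"
  proof (rule Lim_null_comparison)
    show "((\<lambda>i. M * (p / (q * \<rho>)) powi i) \<longlongrightarrow> 0) at_bot"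
      using qp p rho by (intro tendsto_mult_right_zero power_int_tendsto_0_at_bot) simp
    have "norm (Re (laurent ?H i) * (p / q) powi i) \<le> M * (p / (q * \<rho>)) powi i" for i
    proof -
      have "norm (Re (laurent ?H i) * (p / q) powi i) \<le> norm (laurent ?H i) * (p / q) powi i"
        using qp by (simp add: abs_mult abs_Re_le_cmod mult_right_mono)
      also have "\<dots> \<le> (M * \<rho> powi (- i)) * (p / q) powi i"
        using qp M(2) by (intro mult_right_mono) auto
      also have "\<dots> = M * (p / (q * \<rho>)) powi i"
        using rho qp by (simp add: power_int_minus power_int_divide_distrib power_int_mult_distrib field_simps)
      finally show ?thesis .
    qed
    then show "eventually (\<lambda>i. norm (Re (laurent ?H i) * (p / q) powi i) \<le> M * (p / (q * \<rho>)) powi i) at_bot"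
      by simp
  qed
  have "alternates (\<lambda>i. Re (laurent H i)) r" if "alternates (\<lambda>i. Re (laurent ?H i)) r" for r
    unfolding rec using that qp(2,1) lim by (rule alternates_divide)
  then show ?thesis using H cont' by (auto simp: good_def)
qed

text \<open>A sign pattern consists of finitely many strict inequalities, each of which persists for
  the coefficients of a late approximant.\<close>

lemma good_uniform_limit:
  assumes H: "\<And>n. good (H n)" and lim: "uniform_limit (sphere 0 \<rho>) H H' sequentially"
  shows "good H'"
proof -
  have cont: "continuous_on (sphere 0 \<rho>) (H n)" for n using H by (simp add: good_def)
  have "r < card Y" if alt: "alternates (\<lambda>i. Re (laurent H' i)) r" for r
  proof -
    obtain i s where i: "s \<in> {1, -1}" "\<And>k. k < r \<Longrightarrow> i k < i (Suc k)"
      "\<And>k. k \<le> r \<Longrightarrow> 0 < s * (-1) ^ k * Re (laurent H' (i k))"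
      using alt unfolding alternates_def by blast
    have "eventually (\<lambda>n. 0 < s * (-1) ^ k * Re (laurent (H n) (i k))) sequentially" if "k \<le> r" for k
    proof (rule order_tendstoD(1))
      show "(\<lambda>n. s * (-1) ^ k * Re (laurent (H n) (i k))) \<longlonglongrightarrow> s * (-1) ^ k * Re (laurent H' (i k))"
        by (intro tendsto_intros laurent_uniform_limit cont lim)
    qed (use i(3)[OF that] in simp)
    then have "eventually (\<lambda>n. \<forall>k\<in>{..r}. 0 < s * (-1) ^ k * Re (laurent (H n) (i k))) sequentially"
      by (intro eventually_ball_finite) auto
    then obtain n where "\<forall>k\<in>{..r}. 0 < s * (-1) ^ k * Re (laurent (H n) (i k))"
      using eventually_happens trivial_limit_sequentially by blast
    then have "alternates (\<lambda>i. Re (laurent (H n) i)) r" using i(1,2) by (intro alternatesI[of s _ i]) auto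
    then show ?thesis using H[of n] by (simp add: good_def)
  qed
  moreover have "continuous_on (sphere 0 \<rho>) H'"
    using uniform_limit_theorem[OF _ lim] cont by auto
  ultimately show ?thesis by (simp add: good_def)
qed

lemma good_linear_power:
  assumes "good H" "p \<ge> 0" "q \<ge> 0"
  shows "good (\<lambda>u. (of_real p + of_real q * u) ^ k * H u)"
  using good_linear[OF _ assms(2,3)] assms(1)
  by (induction k) (auto simp: mult.assoc)

lemma good_exp:
  assumes H: "good H" and \<gamma>: "\<gamma> \<ge> 0"
  shows "good (\<lambda>u. exp (of_real \<gamma> * u) * H u)"
proof (rule good_uniform_limit[where H = "\<lambda>n u. (of_real 1 + of_real (\<gamma> / real (Suc n)) * u) ^ Suc n * H u"])
  show "good (\<lambda>u. (of_real 1 + of_real (\<gamma> / real (Suc n)) * u) ^ Suc n * H u)" for n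
    using \<gamma> by (intro good_linear_power H) auto
  have cont: "continuous_on (sphere (0 :: complex) \<rho>) H" using H by (simp add: good_def)
  let ?C = "exp (2 * (\<gamma> * \<rho>)) * (\<gamma> * \<rho>)\<^sup>2"
  have "uniform_limit (sphere (0 :: complex) \<rho>) (\<lambda>n u. (of_real 1 + of_real (\<gamma> / real (Suc n)) * u) ^ Suc n) (\<lambda>u. exp (of_real \<gamma> * u)) sequentially"
  proof (rule uniform_limitI)
    fix e :: real assume "e > 0"
    have "(\<lambda>n. ?C / real (Suc n)) \<longlonglongrightarrow> 0"
      by (intro LIMSEQ_Suc[of "\<lambda>n. ?C / real n"] lim_const_over_n)
    then have "eventually (\<lambda>n. ?C / real (Suc n) < e) sequentially"
      using \<open>e > 0\<close> by (rule order_tendstoD(2))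
    then show "eventually (\<lambda>n. \<forall>u\<in>sphere (0 :: complex) \<rho>. dist ((of_real 1 + of_real (\<gamma> / real (Suc n)) * u) ^ Suc n) (exp (of_real \<gamma> * u)) < e) sequentially"
    proof (rule eventually_mono)
      fix n assume n: "?C / real (Suc n) < e"
      have "dist ((of_real 1 + of_real (\<gamma> / real (Suc n)) * u) ^ Suc n) (exp (of_real \<gamma> * u)) < e"
        if u: "u \<in> sphere (0 :: complex) \<rho>" for u :: complex
      proof -
      have "norm (of_real \<gamma> * u) \<le> \<gamma> * \<rho>" using u \<gamma> by (simp add: norm_mult)
      from norm_exp_minus_power_le[OF this, of "Suc n"]
      have "norm (exp (of_real \<gamma> * u) - (1 + of_real \<gamma> * u / of_nat (Suc n)) ^ Suc n) \<le> ?C / real (Suc n)" by simp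
      also note n
        finally show ?thesis
          by (simp only: dist_norm norm_minus_commute[of _ "exp _"] of_real_1 of_real_divide of_real_of_nat_eq times_divide_eq_left)
      qed
      then show "\<forall>u\<in>sphere (0 :: complex) \<rho>. dist ((of_real 1 + of_real (\<gamma> / real (Suc n)) * u) ^ Suc n) (exp (of_real \<gamma> * u)) < e" by blast
    qed
  qed
  then show "uniform_limit (sphere (0 :: complex) \<rho>) (\<lambda>n u. (of_real 1 + of_real (\<gamma> / real (Suc n)) * u) ^ Suc n * H u) (\<lambda>u. exp (of_real \<gamma> * u) * H u) sequentially"
    using cont by (intro uniform_lim_mult uniform_limit_const compact_imp_bounded compact_continuous_image continuous_intros) auto
qed

text \<open>The Taylor coefficients of the combination are the Laurent coefficients with
  non-negative index. If one had a non-zero real part, Descartes' rule would give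
  \<open>card Y\<close> sign changes, one more than \<open>good\<close> permits.\<close>

lemma zeros_imp_zero:
  assumes H: "good H" "H holomorphic_on ball 0 R" "\<rho> < R"
    and X: "finite X" "X \<subseteq> {0<..<\<rho>}" "card X = card Y"
    and zero: "\<And>x. x \<in> X \<Longrightarrow> Re (\<Sum>v\<in>Y. of_real (c v) * complex_loewner H (of_real v) (of_real x)) = 0"
    and x: "x \<in> {0<..<\<rho>}"
  shows "Re (\<Sum>v\<in>Y. of_real (c v) * complex_loewner H (of_real v) (of_real x)) = 0"
proof -
  define G where "G = (\<lambda>u. \<Sum>v\<in>Y. of_real (c v) * complex_loewner H (of_real v) u)"
  define e where "e = (\<lambda>k. Re (laurent H (int k)))"
  have G: "G holomorphic_on ball 0 R"
    unfolding G_def by (intro holomorphic_intros holomorphic_complex_loewner H) auto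
  have sums: "(\<lambda>k. e k * x ^ k) sums Re (G (of_real x))" if "x \<in> {0<..<\<rho>}" for x
  proof -
    have "(\<lambda>k. (deriv ^^ k) G 0 / fact k * (of_real x - 0) ^ k) sums G (of_real x)"
      using that H(3) by (intro holomorphic_power_series[OF G]) auto
    then have "(\<lambda>k. laurent H (int k) * of_real (x ^ k)) sums G (of_real x)"
      by (simp add: laurent_taylor[OF H(2,3)] G_def)
    from sums_Re[OF this] show ?thesis by (simp add: e_def)
  qed
  have "continuous_on (sphere 0 \<rho>) H" using H(1) by (simp add: good_def)
  from laurent_bound[OF this] obtain M where M: "\<And>i. norm (laurent H i) \<le> M * \<rho> powi (- i)" by blast
  have bound: "\<bar>e k\<bar> * \<rho> ^ k \<le> M" for k
  proof -
    have "\<bar>e k\<bar> * \<rho> ^ k \<le> norm (laurent H (int k)) * \<rho> ^ k"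
      using rho by (intro mult_right_mono) (auto simp: e_def abs_Re_le_cmod)
    also have "\<dots> \<le> (M * \<rho> powi (- int k)) * \<rho> ^ k" using rho M by (intro mult_right_mono) auto
    also have "\<dots> = M" using rho by (simp add: power_int_minus)
    finally show ?thesis .
  qed
  have "e k = 0" for k
  proof (rule ccontr)
    assume "e k \<noteq> 0"
    have "(\<lambda>k. e k * x ^ k) sums 0" if "x \<in> X" for x
      using sums[of x] zero[OF that] that X(2) by (auto simp: G_def)
    then have "alternates (\<lambda>i. if i < 0 then 0 else e (nat i)) (card X)"
      using X(1,2) bound \<open>e k \<noteq> 0\<close> by (intro descartes) auto
    then have "alternates (\<lambda>i. Re (laurent H i)) (card X)"
      by (rule alternates_weight) (auto simp: e_def intro!: exI[of _ 1] split: if_splits)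
    then have "card X < card Y" using H(1) unfolding good_def by blast
    then show False using X(3) by simp
  qed
  then show ?thesis using sums_unique2[OF sums[OF x]] by (simp add: G_def)
qed

end

section \<open>Polya frequency series\<close>

locale summable_factors =
  fixes \<alpha> \<beta> :: "nat \<Rightarrow> real"
  assumes alpha: "\<alpha> i \<ge> 0" and beta: "\<beta> i \<ge> 0" and summable: "summable (\<lambda>i. \<alpha> i + \<beta> i)"
begin

definition factor :: "nat \<Rightarrow> complex \<Rightarrow> complex" where
  "factor i z = (1 + of_real (\<alpha> i) * z) / (1 - of_real (\<beta> i) * z)"

definition dom :: "complex set" where
  "dom = {z. \<forall>i. of_real (\<beta> i) * z \<noteq> 1}"

lemma dom_ne: "z \<in> dom \<Longrightarrow> 1 - of_real (\<beta> i) * z \<noteq> 0"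
  by (auto simp: dom_def)

lemma beta_small: "eventually (\<lambda>n. \<beta> n * R \<le> 1 / 2) sequentially"
proof -
  have "(\<lambda>n. (\<alpha> n + \<beta> n) * \<bar>R\<bar>) \<longlonglongrightarrow> 0 * \<bar>R\<bar>"
    by (intro tendsto_mult summable_LIMSEQ_zero summable tendsto_const)
  then have "eventually (\<lambda>n. (\<alpha> n + \<beta> n) * \<bar>R\<bar> < 1 / 2) sequentially"
    by (intro order_tendstoD(2)) auto
  then show ?thesis
  proof (rule eventually_mono)
    fix n assume "(\<alpha> n + \<beta> n) * \<bar>R\<bar> < 1 / 2"
    moreover have "\<beta> n * R \<le> \<beta> n * \<bar>R\<bar>" using beta by (intro mult_left_mono) auto
    moreover have "\<beta> n * \<bar>R\<bar> \<le> (\<alpha> n + \<beta> n) * \<bar>R\<bar>" using alpha by (intro mult_right_mono) auto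
    ultimately show "\<beta> n * R \<le> 1 / 2" by simp
  qed
qed

lemma norm_denominator:
  fixes z :: complex
  assumes "norm z \<le> R" "\<beta> n * R \<le> 1 / 2"
  shows "1 / 2 \<le> norm (1 - of_real (\<beta> n) * z)"
proof -
  have "norm (of_real (\<beta> n) * z) \<le> \<beta> n * R"
    using beta[of n] assms(1) by (simp add: norm_mult mult_left_mono)
  then show ?thesis using norm_triangle_ineq2[of 1 "of_real (\<beta> n) * z"] assms(2) by simp
qed

text \<open>Near \<open>w\<close> only finitely many denominators can vanish. The neighbourhood is
  punctured because \<open>w\<close> itself may be a pole.\<close>

lemma eventually_in_dom: "eventually (\<lambda>z. z \<in> dom) (at w)"
proof -
  obtain N where N: "\<And>n. n \<ge> N \<Longrightarrow> \<beta> n * (norm w + 1) \<le> 1 / 2"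
    using beta_small[of "norm w + 1"] by (auto simp: eventually_sequentially)
  define S where "S = (\<lambda>n. 1 / complex_of_real (\<beta> n)) ` {..<N} - {w}"
  have "open (- S)" by (intro open_Compl finite_imp_closed) (simp add: S_def)
  then have "eventually (\<lambda>z. z \<in> - S) (at w)"
    by (intro eventually_at_in_open') (auto simp: S_def)
  moreover have "eventually (\<lambda>z. z \<in> ball w 1) (at w)" by (intro eventually_at_in_open') auto
  moreover have "eventually (\<lambda>z. z \<noteq> w) (at w)" by (auto simp: eventually_at_filter)
  ultimately show ?thesis
  proof eventually_elim
    fix z assume z: "z \<in> - S" "z \<in> ball w 1" "z \<noteq> w"
    have "of_real (\<beta> n) * z \<noteq> 1" for n
    proof
      assume eq: "of_real (\<beta> n) * z = 1"
      then have "z = 1 / of_real (\<beta> n)" by (metis div_by_1 divide_eq_eq mult_zero_left nonzero_mult_div_cancel_left zero_neq_one)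
      then have "n \<ge> N" using z(1,3) by (auto simp: S_def not_less)
      have "norm z \<le> norm w + 1" using z(2) norm_triangle_sub[of z w] by (simp add: dist_norm norm_minus_commute)
      from norm_denominator[OF this N[OF \<open>n \<ge> N\<close>]] show False using eq by simp
    qed
    then show "z \<in> dom" by (simp add: dom_def)
  qed
qed

lemma open_dom: "open dom"
proof (subst open_subopen, rule ballI)
  fix w assume "w \<in> dom"
  then have "eventually (\<lambda>z. z \<in> dom) (nhds w)"
    using eventually_in_dom[of w] by (auto simp: eventually_at_filter elim: eventually_mono)
  then show "\<exists>T. open T \<and> w \<in> T \<and> T \<subseteq> dom" by (auto simp: eventually_nhds)
qed

text \<open>The complement is countable, and removing countably many points does not disconnect the
  plane.\<close>

lemma connected_dom: "connected dom"
proof -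
  have "- dom \<subseteq> range (\<lambda>i. 1 / complex_of_real (\<beta> i))"
  proof
    fix z assume "z \<in> - dom"
    then obtain i where eq: "of_real (\<beta> i) * z = 1" by (auto simp: dom_def)
    then have "z = 1 / of_real (\<beta> i)" by (metis div_by_1 divide_eq_eq mult_zero_left nonzero_mult_div_cancel_left zero_neq_one)
    then show "z \<in> range (\<lambda>i. 1 / complex_of_real (\<beta> i))" by blast
  qed
  then have "countable (- dom)" by (rule countable_subset) auto
  then have "path_connected (- (- dom))" by (intro path_connected_complement_countable) auto
  then show ?thesis by (simp add: path_connected_imp_connected)
qed

lemma factor_bound:
  assumes "norm z \<le> R" "\<beta> n * R \<le> 1 / 2"
  shows "norm (factor n z - 1) \<le> 2 * R * (\<alpha> n + \<beta> n)"
proof -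
  have d: "1 / 2 \<le> norm (1 - of_real (\<beta> n) * z)" by (rule norm_denominator[OF assms])
  then have ne: "1 - of_real (\<beta> n) * z \<noteq> 0" by (intro notI) simp
  have "factor n z - 1 = ((1 + of_real (\<alpha> n) * z) - (1 - of_real (\<beta> n) * z)) / (1 - of_real (\<beta> n) * z)"
    unfolding factor_def
    by (simp only: diff_divide_distrib[of "1 + of_real (\<alpha> n) * z" "1 - of_real (\<beta> n) * z"] divide_self[OF ne])
  also have "(1 + of_real (\<alpha> n) * z) - (1 - of_real (\<beta> n) * z) = of_real (\<alpha> n + \<beta> n) * z"
    by (simp add: algebra_simps)
  finally have "factor n z - 1 = of_real (\<alpha> n + \<beta> n) * z / (1 - of_real (\<beta> n) * z)" .
  then have "norm (factor n z - 1) = (\<alpha> n + \<beta> n) * norm z / norm (1 - of_real (\<beta> n) * z)"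
    using alpha[of n] beta[of n] by (simp add: norm_divide norm_mult del: of_real_add)
  moreover have "0 \<le> R" using assms(1) norm_ge_zero[of z] by linarith
  then have "(\<alpha> n + \<beta> n) * norm z / norm (1 - of_real (\<beta> n) * z) \<le> (\<alpha> n + \<beta> n) * R / (1 / 2)"
    using d alpha[of n] beta[of n] assms(1) by (intro frac_le mult_left_mono mult_nonneg_nonneg) auto
  ultimately show ?thesis by (simp add: mult_ac)
qed

lemma factor_bound_eventually:
  assumes "bounded K"
  shows "\<exists>R. eventually (\<lambda>n. \<forall>z\<in>K. norm (norm (factor n z - 1)) \<le> 2 * R * (\<alpha> n + \<beta> n)) sequentially"
proof -
  obtain R where R: "\<And>z. z \<in> K \<Longrightarrow> norm z \<le> R" using assms by (auto simp: bounded_iff)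
  have "eventually (\<lambda>n. \<forall>z\<in>K. norm (norm (factor n z - 1)) \<le> 2 * R * (\<alpha> n + \<beta> n)) sequentially"
    using beta_small[of R] by (rule eventually_mono) (use R factor_bound in auto)
  then show ?thesis by blast
qed

text \<open>Convergence holds at every \<open>z\<close>: all but finitely many factors obey the
  summable bound, and a factor with denominator 0 has the value 0.\<close>

lemma LIMSEQ_prodinf: "(\<lambda>N. \<Prod>i<N. factor i z) \<longlonglongrightarrow> (\<Prod>i. factor i z)"
proof -
  obtain R where R: "eventually (\<lambda>n. \<forall>z\<in>{z}. norm (norm (factor n z - 1)) \<le> 2 * R * (\<alpha> n + \<beta> n)) sequentially"
    using factor_bound_eventually[of "{z}"] by auto
  have "summable (\<lambda>n. norm (factor n z - 1))"
  proof (rule summable_comparison_test_ev)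
    show "eventually (\<lambda>n. norm (norm (factor n z - 1)) \<le> 2 * R * (\<alpha> n + \<beta> n)) sequentially"
      using R by simp
    show "summable (\<lambda>n. 2 * R * (\<alpha> n + \<beta> n))" by (intro summable_mult summable)
  qed
  then have "convergent_prod (\<lambda>n. factor n z)"
    by (intro abs_convergent_prod_imp_convergent_prod summable_imp_abs_convergent_prod)
  then show ?thesis
    using convergent_prod_LIMSEQ LIMSEQ_lessThan_iff_atMost[of "\<lambda>A. \<Prod>i\<in>A. factor i z"] by simp
qed

lemma prodinf_zero: "factor i z = 0 \<Longrightarrow> (\<Prod>i. factor i z) = 0"
proof -
  assume z: "factor i z = 0"
  have "eventually (\<lambda>N. (\<Prod>i<N. factor i z) = 0) sequentially"
    using eventually_gt_at_top[of i] by (rule eventually_mono) (use z in \<open>auto intro: prod_zero\<close>)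
  then have "(\<lambda>N. \<Prod>i<N. factor i z) \<longlonglongrightarrow> 0" by (rule tendsto_eventually)
  then show ?thesis using LIMSEQ_prodinf LIMSEQ_unique by blast
qed

lemma uniform_limit_prodinf:
  assumes "compact K" "K \<subseteq> dom"
  shows "uniform_limit K (\<lambda>N z. \<Prod>i<N. factor i z) (\<lambda>z. \<Prod>i. factor i z) sequentially"
proof -
  obtain R where R: "eventually (\<lambda>n. \<forall>z\<in>K. norm (norm (factor n z - 1)) \<le> 2 * R * (\<alpha> n + \<beta> n)) sequentially"
    using factor_bound_eventually[OF compact_imp_bounded[OF assms(1)]] by blast
  have "uniformly_convergent_on K (\<lambda>N z. \<Prod>i<N. factor i z)"
  proof (rule uniformly_convergent_on_prod'[OF _ assms(1)])
    show "continuous_on K (factor n)" for n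
      unfolding factor_def[abs_def] using assms(2) dom_ne by (intro continuous_intros) blast
    show "uniformly_convergent_on K (\<lambda>N z. \<Sum>n<N. norm (factor n z - 1))"
      by (rule uniformly_convergentI[OF Weierstrass_m_test_ev[OF R]]) (intro summable_mult summable)
  qed
  then obtain l where l: "uniform_limit K (\<lambda>N z. \<Prod>i<N. factor i z) l sequentially"
    by (auto simp: uniformly_convergent_on_def)
  have "l z = (\<Prod>i. factor i z)" if "z \<in> K" for z
    using tendsto_uniform_limitI[OF l that] LIMSEQ_prodinf LIMSEQ_unique by blast
  then show ?thesis using l by (subst uniform_limit_cong'[where g = "\<lambda>N z. \<Prod>i<N. factor i z" and i = l]) auto
qed

lemma holomorphic_prodinf: "(\<lambda>z. \<Prod>i. factor i z) holomorphic_on dom"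
proof (rule holomorphic_uniform_sequence[OF open_dom])
  show "(\<lambda>z. \<Prod>i<N. factor i z) holomorphic_on dom" for N
    unfolding factor_def using dom_ne by (intro holomorphic_intros) auto
  fix x assume "x \<in> dom"
  then obtain d where d: "d > 0" "cball x d \<subseteq> dom" using open_dom open_contains_cball by blast
  then show "\<exists>d>0. cball x d \<subseteq> dom \<and> uniform_limit (cball x d) (\<lambda>N z. \<Prod>i<N. factor i z) (\<lambda>z. \<Prod>i. factor i z) sequentially"
    using uniform_limit_prodinf[OF compact_cball] by blast
qed

end

section \<open>The series on the interval: zeros, poles and the Chebyshev property\<close>

locale polya_function = summable_factors \<alpha> \<beta> for \<alpha> \<beta> :: "nat \<Rightarrow> real" +
  fixes c0 \<gamma> :: real and l :: nat and D :: "complex set" and F :: "complex \<Rightarrow> complex" and a b :: real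
  assumes c0: "c0 \<ge> 0" and gamma: "\<gamma> \<ge> 0" and D_eq: "D = {z. \<forall>i. of_real (\<beta> i) * z \<noteq> 1}"
    and F_rep: "\<forall>z\<in>D. F z = of_real c0 * z ^ l * exp (of_real \<gamma> * z)
                 * (\<Prod>i. (1 + of_real (\<alpha> i) * z) / (1 - of_real (\<beta> i) * z))"
    and ab: "a < b" and segment: "ereal ` {a..b} \<subseteq> {largest_zero D F<..<smallest_pole F}"
    and irrational: "\<not> rational_on D F"
begin

lemma D_dom: "D = dom"
  by (simp add: D_eq dom_def)

lemma F_eq: "z \<in> dom \<Longrightarrow> F z = of_real c0 * z ^ l * exp (of_real \<gamma> * z) * (\<Prod>i. factor i z)"
  using F_rep by (simp add: D_dom factor_def)

lemma c0_pos: "c0 > 0"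
proof (rule ccontr)
  assume "\<not> c0 > 0"
  then have "c0 = 0" using c0 by simp
  then have "rational_on D F" unfolding rational_on_def
    by (intro exI[of _ 0] exI[of _ 1]) (simp add: D_dom F_eq)
  then show False using irrational by blast
qed

lemma holomorphic_F: "F holomorphic_on dom"
proof -
  have "(\<lambda>z. of_real c0 * z ^ l * exp (of_real \<gamma> * z) * (\<Prod>i. factor i z)) holomorphic_on dom"
    by (intro holomorphic_intros holomorphic_prodinf)
  then show ?thesis by (rule holomorphic_transform) (simp add: F_eq)
qed

lemma F_real:
  assumes "complex_of_real x \<in> dom"
  shows "Im (F (of_real x)) = 0"
proof -
  have "(\<Prod>i<N. factor i (of_real x)) = of_real (\<Prod>i<N. (1 + \<alpha> i * x) / (1 - \<beta> i * x))" for N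
    by (simp add: factor_def)
  then have "(\<lambda>N. Im (\<Prod>i<N. factor i (of_real x))) = (\<lambda>N. 0)"
    by (intro ext) (simp only: Im_complex_of_real)
  then have "(\<lambda>N. Im (\<Prod>i<N. factor i (of_real x))) \<longlonglongrightarrow> 0" by simp
  then have "Im (\<Prod>i. factor i (of_real x)) = 0"
    using tendsto_Im[OF LIMSEQ_prodinf] LIMSEQ_unique by blast
  then have P: "(\<Prod>i. factor i (of_real x)) = of_real (Re (\<Prod>i. factor i (of_real x)))"
    by (simp add: complex_eq_iff)
  have "F (of_real x) = of_real (c0 * x ^ l * exp (\<gamma> * x) * Re (\<Prod>i. factor i (of_real x)))"
    unfolding F_eq[OF assms] by (subst P) (simp add: exp_of_real[symmetric])
  then show ?thesis by simp
qed

text \<open>The reciprocal of the product is a product of the same kind, with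
  \<open>\<alpha>\<close> and \<open>\<beta>\<close> exchanged and \<open>z\<close> reflected. It is
  holomorphic near \<open>1 / \<beta> i\<close> and vanishes there, so the pole is not
  cancelled.\<close>

lemma pole:
  assumes "\<beta> i > 0"
  shows "is_pole F (of_real (1 / \<beta> i))"
proof -
  interpret swap: summable_factors \<beta> \<alpha>
    by unfold_locales (use alpha beta summable in \<open>auto simp: add.commute\<close>)
  define w where "w = complex_of_real (1 / \<beta> i)"
  define g where "g = (\<lambda>z. \<Prod>k. swap.factor k (- z))"
  have "- w \<in> swap.dom"
  proof -
    have "complex_of_real (\<alpha> k) * - w \<noteq> 1" for k
    proof
      assume "complex_of_real (\<alpha> k) * - w = 1"
      then have "complex_of_real (\<alpha> k * - (1 / \<beta> i)) = of_real 1" by (simp add: w_def)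
      then have "\<alpha> k * - (1 / \<beta> i) = 1" by (simp only: of_real_eq_iff)
      moreover have "\<alpha> k * - (1 / \<beta> i) \<le> 0" using alpha[of k] assms by simp
      ultimately show False by simp
    qed
    then show ?thesis by (simp add: swap.dom_def)
  qed
  then have "isCont (\<lambda>z. \<Prod>k. swap.factor k z) (- w)"
    using swap.holomorphic_prodinf swap.open_dom holomorphic_on_imp_continuous_on continuous_on_eq_continuous_at by blast
  then have "isCont g w" unfolding g_def by (rule isCont_o2[of w uminus, rotated]) (rule continuous_minus[OF continuous_ident])
  moreover have "g w = 0"
  proof -
    have "swap.factor i (- w) = 0" using assms by (simp add: swap.factor_def w_def)
    then show ?thesis unfolding g_def by (rule swap.prodinf_zero)
  qed
  ultimately have g: "(g \<longlongrightarrow> 0) (at w)" by (simp add: isCont_def)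
  have wne: "w \<noteq> 0" using assms by (simp add: w_def)
  let ?q = "\<lambda>z. of_real c0 * z ^ l * exp (of_real \<gamma> * z)"
  have "((\<lambda>z. g z / ?q z) \<longlongrightarrow> 0 / ?q w) (at w)"
    using wne c0_pos by (intro tendsto_divide g tendsto_intros) auto
  then have lim: "((\<lambda>z. g z / ?q z) \<longlongrightarrow> 0) (at w)" by simp
  have "eventually (\<lambda>z. z \<in> dom) (at w)" by (rule eventually_in_dom)
  moreover have "eventually (\<lambda>z. - z \<in> swap.dom) (at w)"
    using swap.open_dom \<open>- w \<in> swap.dom\<close>
    by (intro eventually_at_in_open'[of "uminus -` swap.dom", simplified] open_vimage continuous_intros) auto
  moreover have "eventually (\<lambda>z. z \<noteq> 0) (at w)"
    using wne by (intro eventually_at_in_open'[of "- {0}", simplified]) auto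
  ultimately have ev: "eventually (\<lambda>z. g z / ?q z = inverse (F z) \<and> inverse (F z) \<noteq> 0) (at w)"
  proof eventually_elim
    fix z assume z: "z \<in> dom" "- z \<in> swap.dom" "z \<noteq> 0"
    have "factor k z * swap.factor k (- z) = 1" for k
      using dom_ne[OF z(1), of k] swap.dom_ne[OF z(2), of k] by (simp add: factor_def swap.factor_def)
    then have "(\<Prod>k<N. factor k z) * (\<Prod>k<N. swap.factor k (- z)) = 1" for N
      by (simp flip: prod.distrib)
    moreover have "(\<lambda>N. (\<Prod>k<N. factor k z) * (\<Prod>k<N. swap.factor k (- z))) \<longlonglongrightarrow> (\<Prod>k. factor k z) * g z"
      unfolding g_def by (intro tendsto_mult LIMSEQ_prodinf swap.LIMSEQ_prodinf)
    ultimately have pg: "(\<Prod>k. factor k z) * g z = 1" using LIMSEQ_unique[OF _ tendsto_const] by simp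
    then have "g z \<noteq> 0" by auto
    with pg have "(\<Prod>k. factor k z) = 1 / g z" by (simp add: eq_divide_eq)
    with F_eq[OF z(1)] have "F z = ?q z / g z" by simp
    moreover have "?q z \<noteq> 0" using z(3) c0_pos by simp
    ultimately show "g z / ?q z = inverse (F z) \<and> inverse (F z) \<noteq> 0" using \<open>g z \<noteq> 0\<close> by simp
  qed
  have "((\<lambda>z. inverse (F z)) \<longlongrightarrow> 0) (at w)"
    using lim by (rule Lim_transform_eventually) (use ev in \<open>auto elim: eventually_mono\<close>)
  then have "filterlim (\<lambda>z. inverse (F z)) (at 0) (at w)"
    using ev by (auto simp: filterlim_at elim: eventually_mono)
  then show ?thesis by (simp add: is_pole_def filterlim_inverse_at_iff w_def)
qed

text \<open>Every positive \<open>\<beta> i\<close> is a genuine pole at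
  \<open>1 / \<beta> i\<close>, so the gap up to the smallest pole leaves room beyond
  \<open>b\<close>.\<close>

lemma exists_right_point: "\<exists>r>b. \<forall>i. \<beta> i * r < 1"
proof -
  have "ereal b \<in> ereal ` {a..b}" using ab by simp
  then have "ereal b < smallest_pole F" using segment by (meson greaterThanLessThan_iff subsetD)
  from ereal_dense2[OF this] obtain r where "ereal b < ereal r" and r2: "ereal r < smallest_pole F" by blast
  then have r: "b < r" "ereal r < smallest_pole F" by simp_all
  have "\<beta> i * r < 1" for i
  proof (cases "\<beta> i = 0")
    case False
    then have b: "\<beta> i > 0" using beta[of i] by simp
    have "smallest_pole F \<le> ereal (1 / \<beta> i)"
      unfolding smallest_pole_def using pole[OF b] by (intro Inf_lower) auto
    with r(2) have "ereal r < ereal (1 / \<beta> i)" by (rule less_le_trans)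
    then have "r < 1 / \<beta> i" by simp
    then show ?thesis using b by (simp add: field_simps)
  qed simp
  then show ?thesis using r(1) by blast
qed

text \<open>A centre for the expansion at which all numerators, rewritten in
  \<open>u = z - x0\<close>, keep non-negative coefficients. The factor \<open>z ^ l\<close> has its
  zero at 0, hence the extra condition.\<close>

lemma exists_left_point: "\<exists>x0<a. (\<forall>i. 0 < 1 + \<alpha> i * x0) \<and> (l > 0 \<longrightarrow> x0 > 0)"
proof -
  have "ereal a \<in> ereal ` {a..b}" using ab by simp
  then have "largest_zero D F < ereal a" using segment by (meson greaterThanLessThan_iff subsetD)
  from ereal_dense2[OF this] obtain x0 where "ereal x0 < ereal a" and x02: "largest_zero D F < ereal x0" by blast
  then have x0: "x0 < a" "largest_zero D F < ereal x0" by simp_all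
  have zero: "x < x0" if "of_real x \<in> dom" "F (of_real x) = 0" for x
  proof -
    have "ereal x \<le> largest_zero D F"
      unfolding largest_zero_def D_dom using that by (intro Sup_upper) auto
    then have "ereal x < ereal x0" using x0(2) by (rule le_less_trans)
    then show ?thesis by simp
  qed
  have "0 < 1 + \<alpha> i * x0" for i
  proof (cases "\<alpha> i = 0")
    case False
    then have \<alpha>: "\<alpha> i > 0" using alpha[of i] by simp
    define x where "x = - 1 / \<alpha> i"
    have "x < 0" using \<alpha> by (simp add: x_def)
    have dom: "of_real x \<in> dom"
    proof -
      have "complex_of_real (\<beta> k) * of_real x \<noteq> 1" for k
      proof
        assume "complex_of_real (\<beta> k) * of_real x = 1"
        then have "complex_of_real (\<beta> k * x) = of_real 1" by simp
        then have "\<beta> k * x = 1" by (simp only: of_real_eq_iff)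
        moreover have "\<beta> k * x \<le> 0" using beta[of k] \<open>x < 0\<close> by (simp add: mult_nonneg_nonpos)
        ultimately show False by simp
      qed
      then show ?thesis by (simp add: dom_def)
    qed
    have "factor i (of_real x) = 0" using \<alpha> by (simp add: factor_def x_def)
    then have "F (of_real x) = 0" using F_eq[OF dom] prodinf_zero by simp
    from zero[OF dom this] show ?thesis using \<alpha> by (simp add: x_def field_simps)
  qed simp
  moreover have "x0 > 0" if "l > 0"
    using zero[of 0] F_eq[of 0] that by (simp add: dom_def)
  ultimately show ?thesis using x0(1) by blast
qed

lemma disc_in_dom:
  assumes r: "\<And>i. \<beta> i * r < 1" and x0: "x0 < r"
  shows "ball (of_real x0) (r - x0) \<subseteq> dom"
proof
  fix z :: complex assume z: "z \<in> ball (of_real x0) (r - x0)"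
  have "of_real (\<beta> i) * z \<noteq> 1" for i
  proof
    assume eq: "of_real (\<beta> i) * z = 1"
    then have bi: "\<beta> i > 0" using beta[of i] by (cases "\<beta> i = 0") auto
    from arg_cong[OF eq, of Re] have "\<beta> i * Re z = 1" by simp
    then have "\<beta> i * r < \<beta> i * Re z" using r[of i] by simp
    then have "r < Re z" using bi by simp
    moreover have "Re z - x0 < r - x0"
      using z abs_Re_le_cmod[of "z - of_real x0"] by (simp add: dist_norm norm_minus_commute)
    ultimately show False by simp
  qed
  then show "z \<in> dom" by (simp add: dom_def)
qed

lemma segment_in_dom: "complex_of_real ` {a..b} \<subseteq> dom"
proof -
  obtain r where r: "r > b" "\<And>i. \<beta> i * r < 1" using exists_right_point by blast
  show ?thesis
  proof (rule image_subsetI)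
    fix x assume x: "x \<in> {a..b}"
    then have "of_real x \<in> ball (complex_of_real x) (r - x)" using r(1) by simp
    then show "complex_of_real x \<in> dom" using disc_in_dom[OF r(2), of x] x r(1) by auto
  qed
qed

sublocale real_analytic_function a b D F
proof
  show "a < b" by (rule ab)
  show "open D" unfolding D_dom by (rule open_dom)
  show "F holomorphic_on D" unfolding D_dom by (rule holomorphic_F)
  show "complex_of_real ` {a..b} \<subseteq> D" unfolding D_dom by (rule segment_in_dom)
  show "Im (F (complex_of_real x)) = 0" if "complex_of_real x \<in> D" for x
    using that unfolding D_dom by (rule F_real)
qed

text \<open>Translation by \<open>x0\<close> turns each factor into \<open>(1 + \<alpha> x0 +
  \<alpha> u) / (1 - \<beta> x0 - \<beta> u)\<close>, an admissible multiplication and division;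
  \<open>\<beta> r < 1\<close> and \<open>\<rho> < r - x0\<close> keep its pole outside the
  circle.\<close>

lemma good_shift:
  assumes x0: "\<And>i. 0 < 1 + \<alpha> i * x0" "l > 0 \<Longrightarrow> x0 > 0"
    and r: "\<And>i. \<beta> i * r < 1" and rho': "\<rho> < r - x0"
    and ck: "cauchy_kernel \<rho> Y"
  shows "cauchy_kernel.good \<rho> Y c (\<lambda>u. F (u + of_real x0))"
proof -
  interpret cauchy_kernel \<rho> Y c by fact
  \<comment> \<open>The constant, the exponential and the power at 0, written with the redundant
    linear factor so as to match the closure rules for \<open>good\<close>.\<close>
  define B where "B = (\<lambda>u :: complex. (of_real x0 + of_real 1 * u) ^ l * (exp (of_real \<gamma> * u) * ((of_real (c0 * exp (\<gamma> * x0)) + of_real 0 * u) * 1)))"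
  have "good (\<lambda>u. exp (of_real \<gamma> * u) * ((of_real (c0 * exp (\<gamma> * x0)) + of_real 0 * u) * 1))"
    using good_exp[OF good_linear[OF good_one, of "c0 * exp (\<gamma> * x0)" 0] gamma] c0 by simp
  note base = this
  have B: "good B"
  proof (cases "l = 0")
    case True
    then show ?thesis using base by (simp add: B_def)
  next
    case False
    then show ?thesis unfolding B_def by (intro good_linear_power base) (use x0(2) in auto)
  qed
  have in_dom: "u + of_real x0 \<in> dom" if "u \<in> sphere 0 \<rho>" for u
  proof -
    have "x0 < r" using rho' rho by linarith
    moreover have "u + of_real x0 \<in> ball (of_real x0) (r - x0)"
      using that rho' by (simp add: dist_norm)
    ultimately show ?thesis using disc_in_dom[OF r] by blast
  qed
  let ?f = "\<lambda>i u. factor i (u + of_real x0)"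
  have good_N: "good (\<lambda>u. (\<Prod>i<N. ?f i u) * B u)" for N
  proof (induction N)
    case (Suc N)
    have "\<beta> N * \<rho> < 1 - \<beta> N * x0"
    proof -
      have "\<beta> N * \<rho> \<le> \<beta> N * (r - x0)" using rho' beta by (intro mult_left_mono) auto
      then show ?thesis using r[of N] by (simp add: algebra_simps)
    qed
    from good_divide_linear[OF good_linear[OF Suc less_imp_le[OF x0(1)] alpha] beta this, of N N]
    have "good (\<lambda>u. (of_real (1 + \<alpha> N * x0) + of_real (\<alpha> N) * u) * ((\<Prod>i<N. ?f i u) * B u)
        / (of_real (1 - \<beta> N * x0) - of_real (\<beta> N) * u))" .
    moreover have "?f N u = (of_real (1 + \<alpha> N * x0) + of_real (\<alpha> N) * u) / (of_real (1 - \<beta> N * x0) - of_real (\<beta> N) * u)" for u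
      unfolding factor_def by (intro arg_cong2[of _ _ _ _ "(/)"]) (simp_all add: algebra_simps)
    ultimately show ?case by (simp add: mult_ac)
  qed (use B in simp)
  have "uniform_limit ((\<lambda>u. u + of_real x0) ` sphere 0 \<rho>) (\<lambda>N z. \<Prod>i<N. factor i z) (\<lambda>z. \<Prod>i. factor i z) sequentially"
    using in_dom by (intro uniform_limit_prodinf compact_continuous_image continuous_intros) auto
  then have lim: "uniform_limit (sphere 0 \<rho>) (\<lambda>N u. \<Prod>i<N. ?f i u) (\<lambda>u. \<Prod>i. ?f i u) sequentially"
    by (rule uniform_limit_compose') auto
  have cont: "continuous_on (sphere 0 \<rho>) (\<lambda>u. \<Prod>i. ?f i u)"
  proof (rule continuous_on_compose2[of dom "\<lambda>z. \<Prod>i. factor i z"])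
    show "continuous_on dom (\<lambda>z. \<Prod>i. factor i z)"
      by (rule holomorphic_on_imp_continuous_on[OF holomorphic_prodinf])
  qed (use in_dom in \<open>auto intro!: continuous_intros\<close>)
  have Bcont: "continuous_on (sphere 0 \<rho>) B" using B by (simp add: good_def)
  have "good (\<lambda>u. (\<Prod>i. ?f i u) * B u)"
  proof (rule good_uniform_limit[OF good_N])
    show "uniform_limit (sphere 0 \<rho>) (\<lambda>N u. (\<Prod>i<N. ?f i u) * B u) (\<lambda>u. (\<Prod>i. ?f i u) * B u) sequentially"
      by (intro uniform_lim_mult lim uniform_limit_const compact_imp_bounded compact_continuous_image cont Bcont compact_sphere)
  qed
  moreover have eq: "(\<Prod>i. ?f i u) * B u = F (u + of_real x0)" if "u \<in> sphere 0 \<rho>" for u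
    using F_eq[OF in_dom[OF that]]
    by (simp add: B_def distrib_left exp_add exp_of_real[symmetric] mult_ac add.commute)
  have "good (\<lambda>u. (\<Prod>i. ?f i u) * B u) \<longleftrightarrow> good (\<lambda>u. F (u + of_real x0))"
    by (rule good_cong) (rule eq)
  ultimately show ?thesis by blast
qed

lemma complex_loewner_shift:
  "complex_loewner (\<lambda>u. G (u + x)) v u = complex_loewner G (v + x) (u + x)"
  by (simp add: complex_loewner_def deriv_def DERIV_shift)

text \<open>Separating the terms with \<open>F z\<close> from those with the values at the nodes
  gives an equation that is linear in \<open>F z\<close> with non-zero coefficient
  \<open>p\<close>.\<close>

lemma rational_if_loewner_sum_zero:
  assumes Y: "finite Y" "y \<in> Y" "c y \<noteq> 0"
    and zero: "\<And>z. z \<in> D \<Longrightarrow> (\<Sum>y\<in>Y. of_real (c y) * complex_loewner F (of_real y) z) = 0"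
  shows "rational_on D F"
proof -
  define Z where "Z = complex_of_real ` Y"
  define d where "d = (\<lambda>w. complex_of_real (c (Re w)))"
  define p where "p = lagrange_sum Z d"
  define q where "q = lagrange_sum Z (\<lambda>w. d w * F w)"
  \<comment> \<open>Multiplying numerator and denominator by \<open>m\<close> excludes the nodes, at
    which the difference quotients are not fractions.\<close>
  define m where "m = (\<Prod>w\<in>Z. [:- w, 1:])"
  have Z: "finite Z" using Y by (simp add: Z_def)
  have "p \<noteq> 0"
    using lagrange_sum_eq_0D[OF Z, of d "of_real y"] Y by (auto simp: p_def Z_def d_def)
  moreover have "m \<noteq> 0" using Z by (simp add: m_def)
  ultimately have "p * m \<noteq> 0" by simp
  moreover have "F z = poly (q * m) z / poly (p * m) z" if z: "z \<in> D" "poly (p * m) z \<noteq> 0" for z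
  proof -
    have m: "poly m z = (\<Prod>w\<in>Z. z - w)" by (simp add: m_def poly_prod)
    have zZ: "z \<notin> Z" using z(2) Z by (auto simp: m)
    have "0 = (\<Sum>y\<in>Y. of_real (c y) * complex_loewner F (of_real y) z)" using zero[OF z(1)] by simp
    also have "\<dots> = (\<Sum>w\<in>Z. d w * complex_loewner F w z)"
      unfolding Z_def by (subst sum.reindex) (auto simp: inj_on_def d_def)
    also have "\<dots> = (\<Sum>w\<in>Z. F z * (d w / (z - w)) - d w * F w / (z - w))"
    proof (intro sum.cong refl)
      fix w assume "w \<in> Z"
      then have "z \<noteq> w" using zZ by blast
      then show "d w * complex_loewner F w z = F z * (d w / (z - w)) - d w * F w / (z - w)"
        by (simp add: complex_loewner_def diff_divide_distrib right_diff_distrib mult_ac)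
    qed
    also have "\<dots> = F z * (\<Sum>w\<in>Z. d w / (z - w)) - (\<Sum>w\<in>Z. d w * F w / (z - w))"
      by (simp only: sum_subtractf sum_distrib_left)
    also have "\<dots> = F z * (poly p z / poly m z) - poly q z / poly m z"
      unfolding p_def q_def m using lagrange_sum_partial_fractions[OF Z zZ] by simp
    finally have "F z * poly p z = poly q z" using z(2) by (simp add: field_simps)
    then show ?thesis using z(2) by (simp add: field_simps)
  qed
  ultimately show ?thesis unfolding rational_on_def by blast
qed

lemma unisolvent: "unisolvent_kernel a b (loewner_kernel f)"
proof (rule unisolvent_loewnerI, rule ccontr)
  fix X Y c y
  assume XY: "finite X" "finite Y" "X \<subseteq> {a..b}" "Y \<subseteq> {a..b}" "card X = card Y" "y \<in> Y"
    and zero: "\<And>x. x \<in> X \<Longrightarrow> (\<Sum>y\<in>Y. c y * loewner_kernel f x y) = 0" and "c y \<noteq> 0"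
  obtain r where r: "r > b" "\<And>i. \<beta> i * r < 1" using exists_right_point by blast
  obtain x0 where x0: "x0 < a" "\<And>i. 0 < 1 + \<alpha> i * x0" "l > 0 \<Longrightarrow> x0 > 0"
    using exists_left_point by blast
  \<comment> \<open>Halfway between \<open>b\<close> and \<open>r\<close>, seen from
    \<open>x0\<close>: the circle encloses the translated interval, and the function stays
    holomorphic beyond it.\<close>
  define \<rho> where "\<rho> = ((b - x0) + (r - x0)) / 2"
  have rho': "b - x0 < \<rho>" "\<rho> < r - x0" using r(1) by (auto simp: \<rho>_def)
  define Y' where "Y' = (\<lambda>y. y - x0) ` Y"
  define X' where "X' = (\<lambda>x. x - x0) ` X"
  have sub: "(\<lambda>x. x - x0) ` {a..b} \<subseteq> {0<..<\<rho>}" using rho'(1) x0(1) by auto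
  interpret cauchy_kernel \<rho> Y' "\<lambda>v. c (v + x0)"
  proof
    show "\<rho> > 0" using rho'(1) x0(1) ab by linarith
    show "finite Y'" using XY by (simp add: Y'_def)
    show "Y' \<subseteq> {0<..<\<rho>}" unfolding Y'_def using image_mono[OF XY(4)] sub by (rule order.trans)
  qed
  define H where "H = (\<lambda>u. F (u + of_real x0))"
  have H: "good H" unfolding H_def
    by (rule good_shift[OF x0(2,3) r(2) rho'(2)]) (simp_all add: cauchy_kernel_axioms)
  have "H holomorphic_on ball 0 (r - x0)"
  proof -
    have "(F \<circ> (\<lambda>u. u + of_real x0)) holomorphic_on ball 0 (r - x0)"
    proof (rule holomorphic_on_compose)
      have "(\<lambda>u. u + of_real x0) ` ball 0 (r - x0) \<subseteq> ball (complex_of_real x0) (r - x0)"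
        by (auto simp: dist_norm)
      also have "\<dots> \<subseteq> dom" using disc_in_dom[OF r(2), of x0] r(1) x0(1) ab by auto
      finally show "F holomorphic_on (\<lambda>u. u + of_real x0) ` ball 0 (r - x0)"
        using holomorphic_F holomorphic_on_subset by blast
    qed (intro holomorphic_intros)
    then show ?thesis by (simp add: H_def comp_def)
  qed
  note Hh = this
  define G where "G = (\<lambda>z. \<Sum>y\<in>Y. of_real (c y) * complex_loewner F (of_real y) z)"
  have GH: "(\<Sum>v\<in>Y'. of_real (c (v + x0)) * complex_loewner H (of_real v) u) = G (u + of_real x0)" for u
    unfolding Y'_def G_def H_def complex_loewner_shift by (subst sum.reindex) (auto simp: inj_on_def)
  have G_real: "G (of_real x) = of_real (\<Sum>y\<in>Y. c y * loewner_kernel f x y)" if "x \<in> {a..b}" for x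
    unfolding G_def of_real_sum
    by (intro sum.cong refl) (use XY(4) in \<open>simp add: complex_loewner_of_real[OF that subsetD[OF XY(4)]]\<close>)
  have Re0: "Re (G (of_real x)) = 0" if x: "x \<in> {a..b}" for x
  proof -
    have "Re (\<Sum>v\<in>Y'. of_real (c (v + x0)) * complex_loewner H (of_real v) (of_real (x - x0))) = 0"
    proof (rule zeros_imp_zero[OF H Hh rho'(2), of X'])
      show "finite X'" using XY by (simp add: X'_def)
      show "X' \<subseteq> {0<..<\<rho>}" unfolding X'_def using image_mono[OF XY(3)] sub by (rule order.trans)
      show "card X' = card Y'" using XY(5) by (simp add: X'_def Y'_def card_image inj_on_def)
      show "x - x0 \<in> {0<..<\<rho>}" using sub x by blast
      fix x assume "x \<in> X'"
      then obtain z where z: "z \<in> X" "x = z - x0" by (auto simp: X'_def)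
      then have "z \<in> {a..b}" using XY(3) by blast
      then show "Re (\<Sum>v\<in>Y'. of_real (c (v + x0)) * complex_loewner H (of_real v) (of_real x)) = 0"
        unfolding GH using G_real[of z] zero[OF z(1)] z(2) by simp
    qed
    then show ?thesis unfolding GH by simp
  qed
  have G0: "G (of_real x) = 0" if "x \<in> {a..b}" for x
    using Re0[OF that] G_real[OF that] by (simp del: of_real_sum of_real_mult)
  have G_holo: "G holomorphic_on D"
    unfolding G_def by (intro holomorphic_intros holomorphic_complex_loewner holo S_open)
  \<comment> \<open>Vanishing on the segment spreads to the connected domain by the identity
    theorem; rationality is a statement about all of \<open>D\<close>.\<close>
  have "G z = 0" if "z \<in> D" for z
  proof (rule analytic_continuation[OF G_holo S_open _ S_sup _ _ _ that])
    show "connected D" unfolding D_dom by (rule connected_dom)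
    show "complex_of_real a \<in> D" using S_mem[of a] ab by simp
    show "complex_of_real a islimpt complex_of_real ` {a..b}"
    proof (rule connected_imp_perfect)
      show "connected (complex_of_real ` {a..b})"
        by (intro connected_continuous_image continuous_intros) simp
      show "complex_of_real a \<in> complex_of_real ` {a..b}" using ab by simp
      show "complex_of_real ` {a..b} \<noteq> {x}" for x
      proof
        assume "complex_of_real ` {a..b} = {x}"
        then have "complex_of_real a = x" "complex_of_real b = x" using ab by auto
        then show False using ab by auto
      qed
    qed
    show "G z = 0" if "z \<in> complex_of_real ` {a..b}" for z using that G0 by blast
  qed
  then have "rational_on D F"
    using rational_if_loewner_sum_zero[of Y y c] XY \<open>c y \<noteq> 0\<close> by (simp add: G_def)
  then show False using irrational by blast
qed

end

theorem theorem1: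
  fixes a b :: real and D :: "complex set" and F :: "complex \<Rightarrow> complex" and n :: nat
    and \<nu> :: "real measure" and t :: "nat \<Rightarrow> real"
  defines "f \<equiv> \<lambda>x. Re (F (complex_of_real x))"
  assumes "a < b"
    and "\<not> rational_on D F"
    and "(\<exists>A B \<mu>. nevanlinna_pick F \<and> nevanlinna_pick_representation A B \<mu> D F \<and>
              measure_support \<mu> \<inter> {a..b} = {})
       \<or> (polya_frequency_series D F \<and>
              ereal ` {a..b} \<subseteq> {largest_zero D F<..<smallest_pole F})"
    and "n \<ge> 1"
    and "finite_borel_measure \<nu>"
    and "measure_support \<nu> \<subseteq> {a..b}"
    and "infinite (measure_support \<nu>) \<or> card (measure_support \<nu>) \<ge> n"
    and "strict_mono_on {1..n} t" and "t ` {1..n} \<subseteq> {a..b}"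
  shows "(\<exists>!(R, w). aaa_approximant a b f n \<nu> t R w)
    \<and> (\<exists>!R. \<exists>w. aaa_approximant a b f n \<nu> t R w)
    \<and> (\<forall>R w. aaa_approximant a b f n \<nu> t R w \<longrightarrow>
         (\<forall>z. z \<notin> complex_of_real ` t ` {1..n} \<longrightarrow> R z = aaa_Q F n t w z / aaa_P n t w z) \<and>
         (\<exists>t'. strict_mono_on {1..n - 1} t' \<and> t' ` {1..n - 1} \<subseteq> {a<..<b} \<and>
            (\<exists>h\<in>analytic_class a b. \<forall>x\<in>{a..b}. aaa_V n t t' (of_real x) \<noteq> 0 \<longrightarrow>
               h x = (aaa_P n t w (of_real x) * F (of_real x) - aaa_Q F n t w (of_real x))
                       / aaa_V n t t' (of_real x))))"
proof -
  \<comment> \<open>The two classes of functions are used only up to this point; what follows rests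
    on analyticity, real values and unisolvence.\<close>
  have "real_analytic_function a b D F \<and> unisolvent_kernel a b (loewner_kernel f)"
    using assms(4) unfolding polya_frequency_series_def
  proof (elim disjE exE conjE)
    fix A B \<mu>
    assume "nevanlinna_pick_representation A B \<mu> D F" "measure_support \<mu> \<inter> {a..b} = {}"
    then interpret nevanlinna_function A B \<mu> D F a b
      using assms(2) by unfold_locales
    show ?thesis
      unfolding f_def by (intro conjI real_analytic_function_axioms unisolvent assms(3))
  next
    fix c \<gamma> :: real and \<alpha> \<beta> :: "nat \<Rightarrow> real" and l :: nat
    assume "c \<ge> 0" "\<gamma> \<ge> 0" "\<forall>i. \<alpha> i \<ge> 0" "\<forall>i. \<beta> i \<ge> 0" "summable (\<lambda>i. \<alpha> i + \<beta> i)"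
      "D = {z. \<forall>i. of_real (\<beta> i) * z \<noteq> 1}"
      "\<forall>z\<in>D. F z = of_real c * z ^ l * exp (of_real \<gamma> * z)
                 * (\<Prod>i. (1 + of_real (\<alpha> i) * z) / (1 - of_real (\<beta> i) * z))"
      "ereal ` {a..b} \<subseteq> {largest_zero D F<..<smallest_pole F}"
    then interpret polya_function \<alpha> \<beta> c \<gamma> l D F a b
      using assms(2,3) by unfold_locales blast+
    show ?thesis
      unfolding f_def by (intro conjI real_analytic_function_axioms unisolvent)
  qed
  then interpret real_analytic_function a b D F + unisolvent_kernel a b "loewner_kernel f"
    by blast+
  interpret aaa_analytic a b D F n t \<nu>
  proof -
    have "aaa_problem a b (loewner_kernel f) n t \<nu>"
      by (intro aaa_problem.intro unisolvent_nodes.intro unisolvent_nodes_axioms.intro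
          aaa_problem_axioms.intro unisolvent_kernel_axioms assms(5-10))
    then show "aaa_analytic a b D F n t \<nu>"
      unfolding f_def by (rule aaa_analytic.intro[OF real_analytic_function_axioms])
  qed
  show ?thesis unfolding f_def by (rule aaa_theorem)
qed

end
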